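(* Let $K$ be a simplicial complex homeomorphic to $\mathbb{R}^2$ with a free simplicial action of the group $\Lambda=\langle\alpha,\beta\rangle\cong\mathbb{Z}^2$. Let $l=\{l_{uv}\}$, $l_{uv}=l_{vu}\in\mathbb{R}$, be any set of numbers indexed by the edges $[uv]$ of $K$. Let $\mathcal{G}(K,\Lambda,l)$ be the set of all Gram matrices of the pairs of vectors $a(\theta),b(\theta)$, where $(K,\theta)$ runs over all $2$-periodic polyhedral surfaces such that $|\theta(u)-\theta(v)|^2=l_{uv}$ for every edge $[uv]$ of $K$; it is regarded as a subset of the affine space $\mathbb{R}^3$ with coordinates $g_{11}=(a,a)$, $g_{12}=(a,b)$, $g_{22}=(b,b)$. Then there is a one-dimensional real affine algebraic subvariety of $\mathbb{R}^3$ containing $\mathcal{G}(K,\Lambda,l)$.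
   Context: A mapping of simplicial complexes is simplicial if it maps every simplex linearly onto a simplex; an action of a discrete group on a simplicial complex $K$ is simplicial if every group element acts by a simplicial mapping $K\to K$. The group $\Lambda$ is written additively, with $\alpha,\beta$ a basis. A $2$-periodic polyhedral surface $(K,\theta)$ is given by a mapping $\theta\colon K\to\mathbb{R}^3$ that is linear on simplices of $K$ and equivariant with respect to an action of $\Lambda$ on $\mathbb{R}^3$ in which $\alpha$ and $\beta$ act by translations by some vectors $a=a(\theta)$ and $b=b(\theta)$ respectively. The map $\theta$ is not required to be injective. If $l$ is not realized as the set of squares of edge lengths of any such surface, then $\mathcal{G}(K,\Lambda,l)$ is empty. *)

theory Defs
  imports "HOL-Analysis.Analysis" "HOL-Algebra.Group_Action" "HOL-Algebra.Elementary_Groups"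
begin

section \<open>Simplicial complexes and their geometric realizations\<close>

definition abstract_complex :: "'v set set \<Rightarrow> bool" where
  "abstract_complex K \<longleftrightarrow>
     (\<forall>\<sigma>\<in>K. finite \<sigma> \<and> \<sigma> \<noteq> {}) \<and> (\<forall>\<sigma>\<in>K. \<forall>\<tau>. \<tau> \<subseteq> \<sigma> \<and> \<tau> \<noteq> {} \<longrightarrow> \<tau> \<in> K)"

text \<open>Points of a simplex are given by their barycentric coordinates; the vertex \<open>v\<close> is the
  point \<open>vertex v\<close>.\<close>

definition vertex :: "'v \<Rightarrow> 'v \<Rightarrow> real" where
  "vertex v = indicator {v}"

definition realized_simplex :: "'v set \<Rightarrow> ('v \<Rightarrow> real) set" where
  "realized_simplex \<sigma> = {x. (\<forall>v. 0 \<le> x v) \<and> (\<forall>v. v \<notin> \<sigma> \<longrightarrow> x v = 0) \<and> (\<Sum>v\<in>\<sigma>. x v) = 1}"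

definition realization :: "'v set set \<Rightarrow> ('v \<Rightarrow> real) set" where
  "realization K = (\<Union>\<sigma>\<in>K. realized_simplex \<sigma>)"

text \<open>The weak topology. Each single simplex carries the Euclidean topology, being a subset of
  the finite-dimensional space of functions that vanish off its vertices.\<close>

definition realization_topology :: "'v set set \<Rightarrow> ('v \<Rightarrow> real) topology" where
  "realization_topology K =
     topology (\<lambda>U. U \<subseteq> realization K \<and>
       (\<forall>\<sigma>\<in>K. openin (top_of_set (realized_simplex \<sigma>)) (U \<inter> realized_simplex \<sigma>)))"

lemma openin_realization_topology:
  "openin (realization_topology K) U \<longleftrightarrow> U \<subseteq> realization K \<and>
     (\<forall>\<sigma>\<in>K. openin (top_of_set (realized_simplex \<sigma>)) (U \<inter> realized_simplex \<sigma>))"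
proof -
  have "istopology (\<lambda>U. U \<subseteq> realization K \<and>
       (\<forall>\<sigma>\<in>K. openin (top_of_set (realized_simplex \<sigma>)) (U \<inter> realized_simplex \<sigma>)))"
    unfolding istopology_def
  proof (rule conjI; clarify)
    fix S T
    assume "S \<subseteq> realization K" and
      S: "\<forall>\<sigma>\<in>K. openin (top_of_set (realized_simplex \<sigma>)) (S \<inter> realized_simplex \<sigma>)" and
      T: "\<forall>\<sigma>\<in>K. openin (top_of_set (realized_simplex \<sigma>)) (T \<inter> realized_simplex \<sigma>)"
    have "openin (top_of_set (realized_simplex \<sigma>)) ((S \<inter> T) \<inter> realized_simplex \<sigma>)"
      if "\<sigma> \<in> K" for \<sigma>
    proof -
      have "(S \<inter> T) \<inter> realized_simplex \<sigma> = (S \<inter> realized_simplex \<sigma>) \<inter> (T \<inter> realized_simplex \<sigma>)"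
        by blast
      then show ?thesis
        using S T that by (metis openin_Int)
    qed
    then show "S \<inter> T \<subseteq> realization K \<and>
       (\<forall>\<sigma>\<in>K. openin (top_of_set (realized_simplex \<sigma>)) (S \<inter> T \<inter> realized_simplex \<sigma>))"
      using \<open>S \<subseteq> realization K\<close> by blast
  next
    fix \<U> :: "('a \<Rightarrow> real) set set"
    assume U: "\<forall>S\<in>\<U>. S \<subseteq> realization K \<and>
       (\<forall>\<sigma>\<in>K. openin (top_of_set (realized_simplex \<sigma>)) (S \<inter> realized_simplex \<sigma>))"
    have "openin (top_of_set (realized_simplex \<sigma>)) (\<Union>\<U> \<inter> realized_simplex \<sigma>)"
      if "\<sigma> \<in> K" for \<sigma>
    proof -
      have "\<Union>\<U> \<inter> realized_simplex \<sigma> = \<Union>((\<lambda>S. S \<inter> realized_simplex \<sigma>) ` \<U>)"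
        by blast
      moreover have "openin (top_of_set (realized_simplex \<sigma>)) (\<Union>((\<lambda>S. S \<inter> realized_simplex \<sigma>) ` \<U>))"
        using U that by (intro openin_Union) auto
      ultimately show ?thesis by simp
    qed
    then show "\<Union>\<U> \<subseteq> realization K \<and>
       (\<forall>\<sigma>\<in>K. openin (top_of_set (realized_simplex \<sigma>)) (\<Union>\<U> \<inter> realized_simplex \<sigma>))"
      using U by blast
  qed
  then show ?thesis
    by (simp add: realization_topology_def topology_inverse')
qed


section \<open>Simplicial actions\<close>

definition linear_on_simplex :: "'v set \<Rightarrow> (('v \<Rightarrow> real) \<Rightarrow> 'b::real_vector) \<Rightarrow> bool" where
  "linear_on_simplex \<sigma> f \<longleftrightarrow> (\<forall>x\<in>realized_simplex \<sigma>. f x = (\<Sum>v\<in>\<sigma>. x v *\<^sub>R f (vertex v)))"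

text \<open>A map into a realization is linear on a simplex iff all its barycentric coordinates are.\<close>

definition simplicial_mapping ::
    "'v set set \<Rightarrow> 'w set set \<Rightarrow> (('v \<Rightarrow> real) \<Rightarrow> ('w \<Rightarrow> real)) \<Rightarrow> bool" where
  "simplicial_mapping K L f \<longleftrightarrow>
     (\<forall>\<sigma>\<in>K. (\<forall>w. linear_on_simplex \<sigma> (\<lambda>x. f x w)) \<and>
        (\<exists>\<tau>\<in>L. f ` realized_simplex \<sigma> = realized_simplex \<tau>))"

definition free_simplicial_action ::
    "('g, 'm) monoid_scheme \<Rightarrow> 'v set set \<Rightarrow> ('g \<Rightarrow> ('v \<Rightarrow> real) \<Rightarrow> ('v \<Rightarrow> real)) \<Rightarrow> bool" where
  "free_simplicial_action G K \<phi> \<longleftrightarrow>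
     group_action G (realization K) \<phi> \<and>
     (\<forall>g\<in>carrier G. simplicial_mapping K K (\<phi> g)) \<and>
     (\<forall>x\<in>realization K. stabilizer G \<phi> x = {\<one>\<^bsub>G\<^esub>})"

text \<open>\<open>G\<close> is isomorphic to $\mathbb{Z}^2$ with basis \<open>\<alpha>, \<beta>\<close>. The group operation of \<open>G\<close> is written
  multiplicatively, as everywhere in HOL-Algebra.\<close>

definition free_abelian_basis2 :: "('g, 'm) monoid_scheme \<Rightarrow> 'g \<Rightarrow> 'g \<Rightarrow> bool" where
  "free_abelian_basis2 G \<alpha> \<beta> \<longleftrightarrow>
     group G \<and> \<alpha> \<in> carrier G \<and> \<beta> \<in> carrier G \<and>
     (\<lambda>(m::int, n::int). (\<alpha> [^]\<^bsub>G\<^esub> m) \<otimes>\<^bsub>G\<^esub> (\<beta> [^]\<^bsub>G\<^esub> n)) \<in> iso (integer_group \<times>\<times> integer_group) G"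


section \<open>Periodic polyhedral surfaces\<close>

text \<open>\<open>a\<close> and \<open>b\<close> are the period vectors of \<open>\<theta>\<close>; they are uniquely determined by \<open>\<theta>\<close> when
  \<open>K\<close> is nonempty. The values of \<open>\<theta>\<close> off \<open>realization K\<close> are irrelevant.\<close>

definition periodic_polyhedral_surface ::
    "'v set set \<Rightarrow> ('g, 'm) monoid_scheme \<Rightarrow> 'g \<Rightarrow> 'g \<Rightarrow> ('g \<Rightarrow> ('v \<Rightarrow> real) \<Rightarrow> ('v \<Rightarrow> real)) \<Rightarrow>
     (('v \<Rightarrow> real) \<Rightarrow> real ^ 3) \<Rightarrow> real ^ 3 \<Rightarrow> real ^ 3 \<Rightarrow> bool" where
  "periodic_polyhedral_surface K G \<alpha> \<beta> \<phi> \<theta> a b \<longleftrightarrow>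
     (\<forall>\<sigma>\<in>K. linear_on_simplex \<sigma> \<theta>) \<and>
     (\<exists>\<psi>. group_action G (UNIV :: (real ^ 3) set) \<psi> \<and>
        \<psi> \<alpha> = (\<lambda>p. p + a) \<and> \<psi> \<beta> = (\<lambda>p. p + b) \<and>
        (\<forall>g\<in>carrier G. \<forall>x\<in>realization K. \<theta> (\<phi> g x) = \<psi> g (\<theta> x)))"

definition edge :: "'v set set \<Rightarrow> 'v \<Rightarrow> 'v \<Rightarrow> bool" where
  "edge K u v \<longleftrightarrow> u \<noteq> v \<and> {u, v} \<in> K"

text \<open>A Gram matrix is recorded as the point $(g_{11}, g_{12}, g_{22})$.\<close>

definition period_gram_set ::
    "'v set set \<Rightarrow> ('g, 'm) monoid_scheme \<Rightarrow> 'g \<Rightarrow> 'g \<Rightarrow> ('g \<Rightarrow> ('v \<Rightarrow> real) \<Rightarrow> ('v \<Rightarrow> real)) \<Rightarrow>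
     ('v \<Rightarrow> 'v \<Rightarrow> real) \<Rightarrow> (real ^ 3) set" where
  "period_gram_set K G \<alpha> \<beta> \<phi> l =
     {vector [a \<bullet> a, a \<bullet> b, b \<bullet> b] | \<theta> a b.
        periodic_polyhedral_surface K G \<alpha> \<beta> \<phi> \<theta> a b \<and>
        (\<forall>u v. edge K u v \<longrightarrow> (norm (\<theta> (vertex u) - \<theta> (vertex v)))\<^sup>2 = l u v)}"


section \<open>Real affine algebraic sets and their dimension\<close>

definition algebraic_set :: "'a::euclidean_space set \<Rightarrow> bool" where
  "algebraic_set V \<longleftrightarrow>
     (\<exists>P. (\<forall>p\<in>P. real_polynomial_function p) \<and> V = {x. \<forall>p\<in>P. p x = 0})"

definition irreducible_algebraic_set :: "'a::euclidean_space set \<Rightarrow> bool" where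
  "irreducible_algebraic_set V \<longleftrightarrow> algebraic_set V \<and> V \<noteq> {} \<and>
     (\<forall>A B. algebraic_set A \<and> algebraic_set B \<and> V = A \<union> B \<longrightarrow> V = A \<or> V = B)"

text \<open>The Krull dimension of \<open>V\<close> in the Zariski topology: the supremum of the lengths \<open>n\<close> of
  chains $Z_0 \subset Z_1 \subset \cdots \subset Z_n$ of irreducible algebraic subsets of \<open>V\<close>.
  The empty set has dimension \<open>-\<infinity>\<close>.\<close>

definition algebraic_dim :: "'a::euclidean_space set \<Rightarrow> ereal" where
  "algebraic_dim V =
     Sup {ereal (real n) | n. \<exists>Z :: nat \<Rightarrow> 'a set.
       (\<forall>i\<le>n. irreducible_algebraic_set (Z i) \<and> Z i \<subseteq> V) \<and> (\<forall>i<n. Z i \<subset> Z (Suc i))}"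

end

theory Submission
  imports Defs "HOL-Computational_Algebra.Polynomial" "HOL-Library.Function_Algebras"
begin

text \<open>
  Let \<open>h = g\<^sub>1\<^sub>1 + g\<^sub>2\<^sub>2\<close> be the trace of the Gram matrix. The theorem holds because every polynomial in
  the Gram entries is integral over \<open>\<real>[h]\<close> on the set of all Gram matrices
  (\<open>gram_integral_over_trace\<close>). Such monic relations persist on the Zariski closure of that set, and
  they leave no room for three nested irreducible sets (\<open>no_chain_of_length_2\<close>): a polynomial that
  vanishes on the middle set confines \<open>h\<close>, and then every polynomial, to finitely many values there.
  Adding a line to the closure makes the dimension exactly one (\<open>curve_containing\<close>).

  Integrality is tested on valuations (\<open>valuative_criterion\<close>). Consider the ring of complex functions
  on the set of surfaces, and a valuation ring in it that contains the constants and \<open>h\<close>. Call its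
  members finite or bounded. The squared edge lengths are constants, hence finite. The key claim is that
  some nonzero period \<open>\<lambda> = k a + l b\<close> then has finite scalar products with both \<open>a\<close> and \<open>b\<close>
  (\<open>bounded_period_of_bounded_edges\<close>). Together with the finiteness of \<open>h\<close> this makes all
  Gram entries finite, since \<open>k\<^sup>2 + l\<^sup>2\<close> is an invertible constant.

  The claim rests on the tree of \<open>SL\<^sub>2\<close>. Complexified Euclidean space is the space of quadratic
  polynomials \<open>A z\<^sup>2 + B z + C\<close> with the discriminant as quadratic form. For a ball with centre \<open>a\<close> and
  radius \<open>r\<close>, the polynomials \<open>P\<close> for which \<open>P (a + r y) / r\<close> has finite coefficients form a lattice on
  which the form is finite. Balls are the vertices of a tree ordered by inclusion, and the balls
  whose lattice contains a given vector form a convex subset of it. Three vectors with finite squares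
  that add up to zero lie in a common lattice (\<open>common_ball\<close>). So each triangle of a
  doubly periodic triangulated surface can be coloured by a ball whose lattice contains its
  edges; an edge between two colours lies in both lattices, hence in all lattices between them.

  Suppose that no \<open>\<lambda>\<close> as claimed exists. Then each ball carries an equivariant map of the surface to the
  plane that flattens all triangles of that colour, so that they have area zero. Yet when a colour is
  replaced by the next larger colour, and the map is changed accordingly, a discrete Stokes theorem shows
  that the sum of the areas does not change. At the end there is one colour only, and the sum of the
  areas is that of the torus, which is not zero (\<open>area_of_colouring\<close>).

  Finally, only a square grid is needed instead of \<open>K\<close>: since \<open>|K|\<close> is a plane, there is an equivariant
  map of the unit square to \<open>|K|\<close>, and a fine subdivision of the square is approximated by vertices of \<open>K\<close>
  such that neighbours coincide or span an edge of \<open>K\<close> (\<open>equivariant_grid\<close>).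
\<close>

section \<open>Valuation rings of functions and integrality\<close>

definition is_subring :: "'a::comm_ring_1 set \<Rightarrow> bool" where
  "is_subring C \<longleftrightarrow> 1 \<in> C \<and> (\<forall>x\<in>C. \<forall>y\<in>C. x - y \<in> C \<and> x * y \<in> C)"

lemma is_subringD:
  assumes "is_subring C"
  shows "1 \<in> C" "0 \<in> C"
    and "x \<in> C \<Longrightarrow> y \<in> C \<Longrightarrow> x - y \<in> C"
    and "x \<in> C \<Longrightarrow> y \<in> C \<Longrightarrow> x * y \<in> C"
    and "x \<in> C \<Longrightarrow> y \<in> C \<Longrightarrow> x + y \<in> C"
    and "x \<in> C \<Longrightarrow> - x \<in> C"
proof -
  show one: "1 \<in> C" and diff: "x \<in> C \<Longrightarrow> y \<in> C \<Longrightarrow> x - y \<in> C"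
    and mult: "x \<in> C \<Longrightarrow> y \<in> C \<Longrightarrow> x * y \<in> C" for x y
    using assms by (auto simp: is_subring_def)
  show zero: "0 \<in> C"
    using diff[OF one one] by simp
  show um: "x \<in> C \<Longrightarrow> - x \<in> C" for x
    using diff[OF zero, of x] by simp
  show "x \<in> C \<Longrightarrow> y \<in> C \<Longrightarrow> x + y \<in> C"
    using diff[of x "- y"] um[of y] by simp
qed

lemma is_subring_sum:
  assumes "is_subring C" "\<And>i. i \<in> I \<Longrightarrow> f i \<in> C"
  shows "sum f I \<in> C"
  using assms(2) by (induction I rule: infinite_finite_induct) (auto intro: is_subringD[OF assms(1)])

definition adjoin :: "'a::comm_ring_1 set \<Rightarrow> 'a \<Rightarrow> 'a set" where
  "adjoin C x = {poly P x | P. \<forall>k. coeff P k \<in> C}"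

lemma adjoin:
  assumes C: "is_subring C"
  shows "is_subring (adjoin C x)" "C \<subseteq> adjoin C x" "x \<in> adjoin C x"
proof -
  note sub = is_subringD[OF C]
  show sup: "C \<subseteq> adjoin C x"
  proof
    fix c assume "c \<in> C"
    then have "\<forall>k. coeff [:c:] k \<in> C" by (auto simp: coeff_pCons sub split: nat.split)
    then show "c \<in> adjoin C x" unfolding adjoin_def by force
  qed
  have "\<forall>k. coeff [:0, 1:] k \<in> C" by (auto simp: coeff_pCons sub split: nat.split)
  then show "x \<in> adjoin C x" unfolding adjoin_def by force
  show "is_subring (adjoin C x)"
    unfolding is_subring_def
  proof (intro conjI ballI)
    show "1 \<in> adjoin C x" using sup sub(1) by blast
    fix u v assume "u \<in> adjoin C x" "v \<in> adjoin C x"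
    then obtain P Q where P: "u = poly P x" "\<forall>k. coeff P k \<in> C"
      and Q: "v = poly Q x" "\<forall>k. coeff Q k \<in> C"
      unfolding adjoin_def by auto
    have "\<forall>k. coeff (P - Q) k \<in> C" using P Q by (auto simp: sub)
    then show "u - v \<in> adjoin C x" using P Q unfolding adjoin_def
      by (intro CollectI exI[of _ "P - Q"]) simp
    have "\<forall>k. coeff (P * Q) k \<in> C"
      using P Q by (auto simp: coeff_mult intro!: is_subring_sum[OF C] sub)
    then show "u * v \<in> adjoin C x" using P Q unfolding adjoin_def
      by (intro CollectI exI[of _ "P * Q"]) simp
  qed
qed

lemma idempotent_power:
  fixes e :: "'a::comm_ring_1"
  assumes "e * e = e" "0 < k"
  shows "e ^ k = e"
proof -
  have "e ^ Suc m = e" for m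
  proof (induction m)
    case (Suc m)
    then show ?case using assms(1) by (metis power_Suc)
  qed simp
  then show ?thesis using assms(2) by (metis gr0_implies_Suc)
qed

text \<open>The ring of all functions to a field has zero divisors, but it is von Neumann regular: with
\<open>inverse 0 = 0\<close> the pointwise inverse \<open>g\<close> of \<open>f\<close> satisfies \<open>f g f = f\<close>. The product \<open>f g\<close> is the idempotent
\<open>support_indicator f\<close>, which plays the part of \<open>1\<close> where \<open>f\<close> is invertible.\<close>

definition pinverse :: "('i \<Rightarrow> 'k::field) \<Rightarrow> 'i \<Rightarrow> 'k" where
  "pinverse f = (\<lambda>i. inverse (f i))"

definition support_indicator :: "('i \<Rightarrow> 'k::field) \<Rightarrow> 'i \<Rightarrow> 'k" where
  "support_indicator f = (\<lambda>i. if f i = 0 then 0 else 1)"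

lemma pinverse_pinverse [simp]: "pinverse (pinverse f) = f"
  by (simp add: pinverse_def)

lemma mult_pinverse: "f * pinverse f = support_indicator f" "pinverse f * f = support_indicator f"
  by (auto simp: pinverse_def support_indicator_def fun_eq_iff)

lemma support_indicator_mult: "support_indicator f * f = f" "f * support_indicator f = f" "support_indicator f * support_indicator f = support_indicator f"
  "support_indicator f * pinverse f = pinverse f"
  by (auto simp: pinverse_def support_indicator_def fun_eq_iff)

text \<open>In a field this is the usual notion. In the ring of functions such a set is the preimage of a valuation
ring under the passage to an ultraproduct, or the whole ring; \<open>valuation_ring_concentrated\<close> below yields the
ultrafilter. Working with functions avoids the construction of the ultraproduct as a field.\<close>

definition valuation_ring :: "('i \<Rightarrow> 'k::field) set \<Rightarrow> bool" where
  "valuation_ring C \<longleftrightarrow> is_subring C \<and> (\<forall>f. f \<in> C \<or> pinverse f \<in> C)"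

text \<open>The descent in the proof that a subring which is maximal among those where \<open>y\<close> is not a unit is a valuation
ring. The relation for \<open>1 / x\<close> expresses \<open>(1 - y q\<^sub>0) x\<^sup>n\<close> by lower powers of \<open>x\<close>; multiplying the relation
for \<open>x\<close> by \<open>1 - y q\<^sub>0\<close> therefore removes its leading term. The factor need not be a unit.\<close>

lemma unit_of_smaller_degree:
  fixes x :: "'i \<Rightarrow> 'k::field"
  assumes C: "is_subring C" and support_indicator: "support_indicator x \<in> C"
    and p: "\<And>k. p k \<in> C" "y * (\<Sum>k\<le>n. p k * x ^ k) = 1"
    and q: "\<And>k. q k \<in> C" "y * (\<Sum>k\<le>m. q k * pinverse x ^ k) = 1"
    and y: "y \<in> C" and mn: "m \<le> n" "0 < n"
  shows "\<exists>r. (\<forall>k. r k \<in> C) \<and> y * (\<Sum>k<n. r k * x ^ k) = 1"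
proof -
  note sub = is_subringD[OF C]
  define u where "u = 1 - y * q 0"
  define R where "R = (\<lambda>k. if n \<le> k + m \<and> k < n then q (n - k) * support_indicator x else 0)"
  have "(\<Sum>k\<le>m. q k * pinverse x ^ k) = q 0 + (\<Sum>k=1..m. q k * pinverse x ^ k)"
    by (simp add: sum.atMost_shift sum.atLeast1_atMost_eq lessThan_Suc_atMost)
  then have u1: "u = y * (\<Sum>k=1..m. q k * pinverse x ^ k)"
    using q(2) unfolding u_def by (simp add: algebra_simps)
  have pw: "pinverse x ^ k * x ^ n = support_indicator x * x ^ (n - k)" if "1 \<le> k" "k \<le> n" for k
  proof -
    have "x ^ n = x ^ k * x ^ (n - k)" using that by (simp flip: power_add)
    moreover have "pinverse x ^ k * x ^ k = support_indicator x"
      using that(1) by (simp add: mult_pinverse idempotent_power support_indicator_mult flip: power_mult_distrib)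
    ultimately show ?thesis by (metis mult.assoc)
  qed
  have "u * x ^ n = y * (\<Sum>k=1..m. q k * (pinverse x ^ k * x ^ n))"
    unfolding u1 by (simp add: sum_distrib_right sum_distrib_left mult_ac)
  also have "(\<Sum>k=1..m. q k * (pinverse x ^ k * x ^ n)) = (\<Sum>k=1..m. q k * support_indicator x * x ^ (n - k))"
    using mn by (intro sum.cong) (auto simp: pw mult.assoc)
  also have "\<dots> = (\<Sum>k=n-m..<n. q (n - k) * support_indicator x * x ^ k)"
    by (rule sum.reindex_bij_witness[of _ "\<lambda>k. n - k" "\<lambda>k. n - k"]) (use mn in auto)
  also have "\<dots> = (\<Sum>k<n. R k * x ^ k)"
    by (rule sum.mono_neutral_cong_left) (auto simp: R_def)
  finally have un: "u * x ^ n = y * (\<Sum>k<n. R k * x ^ k)" .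
  define r where "r = (\<lambda>k. (if k = 0 then q 0 else 0) + u * p k + p n * (y * R k))"
  have "(\<Sum>k<n. r k * x ^ k) = q 0 + u * (\<Sum>k<n. p k * x ^ k) + p n * (y * (\<Sum>k<n. R k * x ^ k))"
  proof -
    have "(\<Sum>k<n. (if k = 0 then q 0 else 0) * x ^ k) = (\<Sum>k\<in>{0::nat}. q 0)"
      by (rule sum.mono_neutral_cong_right) (use mn in auto)
    moreover have "r k * x ^ k = (if k = 0 then q 0 else 0) * x ^ k
        + u * (p k * x ^ k) + p n * (y * (R k * x ^ k))" for k
      by (simp only: r_def distrib_right mult.assoc)
    ultimately show ?thesis
      by (simp add: sum.distrib flip: sum_distrib_left)
  qed
  also have "\<dots> = q 0 + u * (\<Sum>k\<le>n. p k * x ^ k)"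
    unfolding un[symmetric] by (simp add: algebra_simps flip: lessThan_Suc_atMost)
  finally have "y * (\<Sum>k<n. r k * x ^ k) = y * q 0 + u * (y * (\<Sum>k\<le>n. p k * x ^ k))"
    by (simp add: algebra_simps)
  then have "y * (\<Sum>k<n. r k * x ^ k) = 1"
    by (simp add: p(2) u_def)
  moreover have "R k \<in> C" for k
    unfolding R_def by (auto intro: sub q support_indicator)
  then have "\<forall>k. r k \<in> C"
    unfolding r_def u_def by (auto intro!: sub p q y)
  ultimately show ?thesis by blast
qed

lemma unit_in_adjoin:
  assumes "x \<notin> C" "is_subring C" "is_subring D" "D = adjoin C x" "c \<in> D" "y * c = 1"
  shows "\<exists>n p. (\<forall>k. p k \<in> C) \<and> y * (\<Sum>k\<le>n. p k * x ^ k) = 1"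
proof -
  obtain P where "c = poly P x" "\<forall>k. coeff P k \<in> C"
    using assms unfolding adjoin_def by auto
  then show ?thesis
    using assms by (intro exI[of _ "degree P"] exI[of _ "coeff P"]) (auto simp: poly_altdef)
qed

text \<open>If neither \<open>x\<close> nor its inverse were in \<open>C\<close>, then \<open>y\<close> would become a unit in both extensions, by relations
of minimal degrees; the descent lemma shortens the longer one. Idempotents come first, because the descent
needs \<open>support_indicator x \<in> C\<close>: the values of a relation at \<open>e = 0\<close> and \<open>e = 1\<close> multiply to a
relation that does not involve \<open>e\<close>.\<close>

lemma maximal_subring_is_valuation_ring:
  fixes C :: "('i \<Rightarrow> 'k::field) set"
  assumes C: "is_subring C" and y: "y \<in> C" and nonunit: "\<And>c. c \<in> C \<Longrightarrow> y * c \<noteq> 1"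
    and maximal: "\<And>D. \<lbrakk>is_subring D; C \<subseteq> D; \<And>c. c \<in> D \<Longrightarrow> y * c \<noteq> 1\<rbrakk> \<Longrightarrow> D = C"
  shows "valuation_ring C" and "\<And>e. e * e = e \<Longrightarrow> e \<in> C"
proof -
  note sub = is_subringD[OF C]
  have ext: "\<exists>n p. (\<forall>k. p k \<in> C) \<and> y * (\<Sum>k\<le>n. p k * x ^ k) = 1" if x: "x \<notin> C" for x
  proof -
    have "adjoin C x \<noteq> C" using adjoin(3)[OF C, of x] x by blast
    then obtain c where "c \<in> adjoin C x" "y * c = 1"
      using maximal adjoin(1,2)[OF C] by blast
    then show ?thesis
      using unit_in_adjoin[OF x C adjoin(1)[OF C] refl] by blast
  qed
  show idem: "e \<in> C" if e: "e * e = e" for e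
  proof (rule ccontr)
    assume "e \<notin> C"
    then obtain n p where p: "\<forall>k. p k \<in> C" "y * (\<Sum>k\<le>n. p k * e ^ k) = 1"
      using ext by blast
    have ek: "e ^ Suc k = e" for k
      using idempotent_power[OF e] by blast
    define s where "s = (\<Sum>k\<in>{1..n}. p k)"
    have sC: "s \<in> C" unfolding s_def using p by (auto intro: is_subring_sum[OF C])
    have "(\<Sum>k\<le>n. p k * e ^ k) = p 0 + (\<Sum>k<n. p (Suc k) * e ^ Suc k)"
      by (simp add: sum.atMost_shift)
    also have "\<dots> = p 0 + s * e"
      unfolding ek s_def by (simp add: sum_distrib_right sum.atLeast1_atMost_eq)
    finally have 1: "y * (p 0 + s * e) = 1" using p by simp
    \<comment> \<open>The relation at \<open>e = 0\<close> and at \<open>e = 1\<close>; the product of the two vanishes.\<close>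
    define A where "A = 1 - y * p 0"
    define B where "B = 1 - y * (p 0 + s)"
    have "(1 - y * (p 0 + s * e)) * (1 - e) = A * (1 - e) - y * s * (e - e * e)"
      "(1 - y * (p 0 + s * e)) * e = B * e + y * s * (e - e * e)"
      by (simp_all only: A_def B_def) (simp_all add: algebra_simps)
    then have AB: "A * (1 - e) = 0" "B * e = 0" by (simp_all only: 1 e) simp_all
    have "A * B = B * (A * (1 - e)) + A * (B * e)"
      by (simp add: algebra_simps)
    then have "A * B = 0" using AB by simp
    then have "y * (p 0 + (p 0 + s) - y * p 0 * (p 0 + s)) = 1"
      unfolding A_def B_def by (simp add: algebra_simps)
    moreover have "p 0 + (p 0 + s) - y * p 0 * (p 0 + s) \<in> C"
      by (intro sub(3-5)) (use p(1) sC y in simp_all)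
    ultimately show False using nonunit by blast
  qed
  show "valuation_ring C"
    unfolding valuation_ring_def
  proof (intro conjI allI C)
    fix x :: "'i \<Rightarrow> 'k"
    define E where "E = (\<lambda>x n. \<exists>p. (\<forall>k. p k \<in> C) \<and> y * (\<Sum>k\<le>n. p k * x ^ k) = 1)"
    have pos: "0 < n" if "E x n" for x n
    proof (rule ccontr)
      assume "\<not> 0 < n"
      then have "E x 0" using that by simp
      then obtain p where "\<forall>k. p k \<in> C" "y * (\<Sum>k\<le>0::nat. p k * x ^ k) = 1"
        unfolding E_def by blast
      then have "p 0 \<in> C" "y * p 0 = 1" by simp_all
      then show False using nonunit by blast
    qed
    have no: False if E: "E x n" "E (pinverse x) m" and mn: "m \<le> n" and least: "\<And>k. k < n \<Longrightarrow> \<not> E x k" for x n m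
    proof -
      obtain p where p: "\<And>k. p k \<in> C" "y * (\<Sum>k\<le>n. p k * x ^ k) = 1" using E unfolding E_def by blast
      obtain q where q: "\<And>k. q k \<in> C" "y * (\<Sum>k\<le>m. q k * pinverse x ^ k) = 1" using E unfolding E_def by blast
      have n: "0 < n" using pos E by blast
      obtain r where r: "\<forall>k. r k \<in> C" "y * (\<Sum>k<n. r k * x ^ k) = 1"
        using unit_of_smaller_degree[OF C idem[OF support_indicator_mult(3)] p q y mn n] by blast
      have "{..<n} = {..n - 1}" using n by auto
      then have "E x (n - 1)" using r unfolding E_def by auto
      then show False using least[of "n - 1"] n by simp
    qed
    show "x \<in> C \<or> pinverse x \<in> C"
    proof (rule ccontr)
      assume "\<not> (x \<in> C \<or> pinverse x \<in> C)"
      then have "\<exists>n. E x n" "\<exists>n. E (pinverse x) n" using ext unfolding E_def by blast+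
      then obtain n m where n: "E x n" "\<And>k. k < n \<Longrightarrow> \<not> E x k"
        and m: "E (pinverse x) m" "\<And>k. k < m \<Longrightarrow> \<not> E (pinverse x) k"
        by (metis LeastI not_less_Least)
      show False
      proof (cases "m \<le> n")
        case True then show ?thesis using no[OF n(1) m(1) True n(2)] by blast
      next
        case False
        then show ?thesis using no[of "pinverse x" m n] m n by simp
      qed
    qed
  qed
qed

text \<open>An element \<open>g\<close> that is not integral over \<open>B\<close> is excluded by some valuation ring containing \<open>B\<close>: let \<open>y\<close> be
the inverse of \<open>g\<close>. A relation \<open>y P(y) = 1\<close> with \<open>P \<in> B[Y]\<close>, multiplied by a power of \<open>g\<close>, is a monic
relation for \<open>g\<close>. Otherwise \<open>y\<close> is not a unit in \<open>B[y]\<close>, and Zorn's lemma gives a maximal subring with that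
property.\<close>

theorem valuative_criterion:
  fixes B :: "('i \<Rightarrow> 'k::field) set"
  assumes B: "is_subring B"
    and g: "\<And>C. valuation_ring C \<Longrightarrow> B \<subseteq> C \<Longrightarrow> g \<in> C"
  shows "\<exists>n p. (\<forall>k. p k \<in> B) \<and> g ^ n = (\<Sum>k<n. p k * g ^ k)"
proof -
  \<comment> \<open>The value \<open>1\<close> at the zeros of \<open>g\<close> makes \<open>y\<close> a unit there, so that these points do not matter.\<close>
  define g1 where "g1 = g + (1 - support_indicator g)"
  define y where "y = pinverse g1"
  have g1nz: "g1 i \<noteq> 0" for i
    by (auto simp: g1_def support_indicator_def)
  have yg1: "y * g1 = 1"
    by (auto simp: y_def pinverse_def fun_eq_iff g1nz)
  define F where "F = {C. is_subring C \<and> adjoin B y \<subseteq> C \<and> (\<forall>c\<in>C. y * c \<noteq> 1)}"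
  have "adjoin B y \<notin> F"
  proof
    assume "adjoin B y \<in> F"
    then have "F \<noteq> {}" by blast
    moreover have "\<Union>\<C> \<in> F" if ne: "\<C> \<noteq> {}" and ch: "subset.chain F \<C>" for \<C>
    proof -
      have F: "C \<in> F" if "C \<in> \<C>" for C using ch that by (auto simp: subset.chain_def)
      have "is_subring (\<Union>\<C>)"
        unfolding is_subring_def
      proof (intro conjI ballI)
        obtain C where "C \<in> \<C>" using ne by blast
        then show "1 \<in> \<Union>\<C>" using F is_subringD(1)[of C] unfolding F_def by blast
        fix u v assume "u \<in> \<Union>\<C>" "v \<in> \<Union>\<C>"
        then obtain C1 C2 where C: "C1 \<in> \<C>" "C2 \<in> \<C>" "u \<in> C1" "v \<in> C2" by blast
        then have "C1 \<subseteq> C2 \<or> C2 \<subseteq> C1" using ch unfolding subset.chain_def by blast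
        then obtain C where "C \<in> \<C>" "u \<in> C" "v \<in> C" using C by blast
        moreover then have "is_subring C" using F unfolding F_def by blast
        ultimately show "u - v \<in> \<Union>\<C>" "u * v \<in> \<Union>\<C>" by (auto intro: is_subringD)
      qed
      then show ?thesis using ne F unfolding F_def by blast
    qed
    ultimately obtain C where CF: "C \<in> F" and max: "\<And>X. X \<in> F \<Longrightarrow> C \<subseteq> X \<Longrightarrow> X = C"
      using subset_Zorn_nonempty[of F] by blast
    have C: "is_subring C" and sup: "adjoin B y \<subseteq> C" and nonunit: "\<And>c. c \<in> C \<Longrightarrow> y * c \<noteq> 1"
      using CF unfolding F_def by auto
    have y: "y \<in> C" using sup adjoin(3)[OF B] by blast
    have mx: "D = C" if "is_subring D" "C \<subseteq> D" "\<And>c. c \<in> D \<Longrightarrow> y * c \<noteq> 1" for D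
      by (rule max) (use that sup in \<open>auto simp: F_def\<close>)
    note V = maximal_subring_is_valuation_ring[OF C y nonunit mx]
    have "g \<in> C"
      using g[OF V(1)] sup adjoin(2)[OF B] by blast
    moreover have "support_indicator g \<in> C"
      by (rule V(2)) (simp_all add: support_indicator_mult)
    ultimately have "g1 \<in> C"
      unfolding g1_def by (intro is_subringD[OF C])
    then show False using nonunit yg1 by blast
  qed
  then obtain c where c: "c \<in> adjoin B y" "y * c = 1"
    using adjoin[OF B, of y] unfolding F_def by blast
  then obtain P where P: "c = poly P y" "\<forall>k. coeff P k \<in> B"
    unfolding adjoin_def by auto
  define m where "m = degree P"
  \<comment> \<open>The exponent \<open>m + 2\<close> instead of \<open>m + 1\<close> makes the relation true at the zeros of \<open>g\<close> as well.\<close>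
  define p where "p = (\<lambda>k. if 1 \<le> k \<and> k \<le> Suc m then coeff P (Suc m - k) else 0)"
  have eq: "y * (\<Sum>k\<le>m. coeff P k * y ^ k) = 1"
    using c P by (simp add: poly_altdef m_def)
  have "g ^ (m + 2) = (\<Sum>k<m + 2. p k * g ^ k)"
  proof
    fix i
    have powi: "(f ^ k) i = f i ^ k" for f :: "'i \<Rightarrow> 'k" and k
      by (induction k) auto
    have sumi: "(sum f A) i = (\<Sum>k\<in>A. f k i)" for f :: "nat \<Rightarrow> 'i \<Rightarrow> 'k" and A
      by (induction A rule: infinite_finite_induct) auto
    show "(g ^ (m + 2)) i = (\<Sum>k<m + 2. p k * g ^ k) i"
    proof (cases "g i = 0")
      case True
      have "p k i * g i ^ k = 0" for k using True by (cases k) (auto simp: p_def)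
      then have "(\<Sum>k<m + 2. p k i * g i ^ k) = 0" by (intro sum.neutral) blast
      then show ?thesis using True by (simp add: powi sumi del: sum.lessThan_Suc)
    next
      case False
      have yi: "y i = inverse (g i)" using False by (simp add: y_def pinverse_def g1_def support_indicator_def)
      have "inverse (g i) * (\<Sum>k\<le>m. coeff P k i * inverse (g i) ^ k) = 1"
        using fun_cong[OF eq, of i] by (simp add: powi sumi yi)
      then have "g i = (\<Sum>k\<le>m. coeff P k i * inverse (g i) ^ k)"
        using False by (simp add: field_simps)
      then have "g i ^ (m + 2) = (\<Sum>k\<le>m. coeff P k i * (inverse (g i) ^ k * g i ^ (m + 1)))"
        by (metis (no_types, lifting) Suc_eq_plus1 add_2_eq_Suc' mult.assoc power_Suc sum.cong sum_distrib_right)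
      also have "\<dots> = (\<Sum>k\<le>m. coeff P k i * g i ^ (Suc m - k))"
        using False by (intro sum.cong) (auto simp: power_diff field_simps power_inverse)
      also have "\<dots> = (\<Sum>k=1..Suc m. p k i * g i ^ k)"
        by (rule sum.reindex_bij_witness[of _ "\<lambda>k. Suc m - k" "\<lambda>k. Suc m - k"]) (auto simp: p_def)
      also have "\<dots> = (\<Sum>k<m + 2. p k i * g i ^ k)"
        by (rule sum.mono_neutral_cong_left) (auto simp: p_def)
      finally show ?thesis by (simp add: powi sumi)
    qed
  qed
  moreover have "\<forall>k. p k \<in> B" using P is_subringD(2)[OF B] by (auto simp: p_def)
  ultimately show ?thesis by blast
qed

section \<open>Quadratic polynomials over a valued ring and the tree of balls\<close>

text \<open>The divisibility preorder of a valuation: \<open>x \<preceq> y\<close> means that the value of \<open>x\<close> is at most that of \<open>y\<close> in absolute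
value. The elements \<open>x \<preceq> 1\<close> are the finite ones, and those with \<open>x \<preceq> 0\<close> form the support. Unless it is
the whole ring, the support is a maximal ideal, and the quotient by it is a valued field of characteristic zero.\<close>

locale dominance =
  fixes le :: "'a::comm_ring_1 \<Rightarrow> 'a \<Rightarrow> bool" (infix "\<preceq>" 50)
  assumes refl [simp]: "x \<preceq> x"
    and trans: "x \<preceq> y \<Longrightarrow> y \<preceq> z \<Longrightarrow> x \<preceq> z"
    and total: "x \<preceq> y \<or> y \<preceq> x"
    and zero [simp]: "0 \<preceq> x"
    and add: "x \<preceq> z \<Longrightarrow> y \<preceq> z \<Longrightarrow> x + y \<preceq> z"
    and mult_right: "x \<preceq> y \<Longrightarrow> x * z \<preceq> y * z"
    and invertible: "\<not> x \<preceq> 0 \<Longrightarrow> \<exists>y. x * y - 1 \<preceq> 0"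
    and int_unit: "k \<noteq> 0 \<Longrightarrow> \<exists>y. of_int k * y = 1 \<and> y \<preceq> 1"
begin

lemma mult_left: "x \<preceq> y \<Longrightarrow> z * x \<preceq> z * y"
  using mult_right[of x y z] by (simp add: mult.commute)

lemma mult: "x \<preceq> y \<Longrightarrow> u \<preceq> v \<Longrightarrow> x * u \<preceq> y * v"
  using trans[OF mult_right mult_left] .

lemma mult_le_one: "x \<preceq> z \<Longrightarrow> c \<preceq> 1 \<Longrightarrow> c * x \<preceq> z"
  using mult[of c 1 x z] by simp

lemma minus_one: "- 1 \<preceq> 1"
proof (cases "1 \<preceq> - 1")
  case True
  then show ?thesis using mult_left[of 1 "- 1" "- 1"] by simp
next
  case False
  then show ?thesis using total[of 1 "- 1"] by simp
qed

lemma minus: "x \<preceq> z \<Longrightarrow> - x \<preceq> z"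
  using mult_le_one[OF _ minus_one, of x z] by simp

lemma diff: "x \<preceq> z \<Longrightarrow> y \<preceq> z \<Longrightarrow> x - y \<preceq> z"
  using add[OF _ minus, of x z y] by simp

lemma of_nat_le_one: "of_nat n \<preceq> 1"
  by (induction n) (auto intro: add)

lemma of_int_le_one: "of_int k \<preceq> 1"
proof (cases k)
  case (nonneg n)
  then show ?thesis by (simp add: of_nat_le_one)
next
  case (neg n)
  then have "of_int k = - (of_nat (Suc n) :: 'a)" by simp
  then show ?thesis using minus[OF of_nat_le_one, of "Suc n"] by metis
qed

lemma int_mult: "x \<preceq> z \<Longrightarrow> of_int k * x \<preceq> z"
  using mult_le_one[OF _ of_int_le_one] .

lemma int_cancel: "of_int k * x \<preceq> z \<Longrightarrow> k \<noteq> 0 \<Longrightarrow> x \<preceq> z"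
proof -
  assume *: "of_int k * x \<preceq> z" "k \<noteq> 0"
  obtain y where y: "of_int k * y = 1" "y \<preceq> 1" using int_unit[OF *(2)] by blast
  have "x = y * (of_int k * x)" by (metis y mult.assoc mult.commute mult_1_left)
  then show ?thesis using mult_le_one[OF *(1) y(2)] by simp
qed

lemma two_cancel: "2 * x \<preceq> z \<Longrightarrow> x \<preceq> z"
  using int_cancel[of 2 x z] by simp

lemma two_mult: "x \<preceq> z \<Longrightarrow> 2 * x \<preceq> z"
  using int_mult[of x z 2] by simp

lemma zero_trans: "x \<preceq> 0 \<Longrightarrow> x \<preceq> z"
  using trans[OF _ zero] .

lemma square_cancel: "x * x \<preceq> 1 \<Longrightarrow> x \<preceq> 1"
proof (cases "x \<preceq> 1")
  case False
  then have "1 \<preceq> x" using total[of x 1] by simp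
  moreover assume "x * x \<preceq> 1"
  ultimately show ?thesis using trans[of x "x * x" 1] mult_right[of 1 x x] by simp
qed

end

type_synonym 'a quadratic = "'a \<times> 'a \<times> 'a"

text \<open>The triple \<open>(A, B, C)\<close> stands for the quadratic polynomial \<open>A z\<^sup>2 + B z + C\<close>, and \<open>pairing\<close> is the
polarization of its discriminant.\<close>

definition pairing :: "'a::comm_ring_1 quadratic \<Rightarrow> 'a quadratic \<Rightarrow> 'a" where
  "pairing P Q = (case P of (A, B, C) \<Rightarrow> case Q of (A', B', C') \<Rightarrow> B * B' - 2 * (A * C' + A' * C))"

definition period :: "'a::comm_ring_1 quadratic \<Rightarrow> 'a quadratic \<Rightarrow> int \<times> int \<Rightarrow> 'a quadratic" where
  "period a b \<mu> = (case a of (A, B, C) \<Rightarrow> case b of (A', B', C') \<Rightarrow> case \<mu> of (k, l) \<Rightarrow>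
     (of_int k * A + of_int l * A', of_int k * B + of_int l * B', of_int k * C + of_int l * C'))"

lemma pairing_add: "pairing (P + Q) R = pairing P R + pairing Q R"
  by (cases P; cases Q; cases R) (simp add: pairing_def algebra_simps)

lemma pairing_minus: "pairing (- P) R = - pairing P R"
  by (cases P; cases R) (simp add: pairing_def algebra_simps)

lemma pairing_commute: "pairing P Q = pairing Q P"
  by (cases P; cases Q) (simp add: pairing_def mult.commute add.commute)

lemma pairing_diff: "pairing (P - Q) R = pairing P R - pairing Q R"
  using pairing_add[of P "- Q" R] by (simp add: pairing_minus)

lemma pairing_period: "pairing (period a b (k, l)) R = of_int k * pairing a R + of_int l * pairing b R"
  by (cases a; cases b; cases R) (simp add: pairing_def period_def algebra_simps)

lemma period_add: "period a b (\<mu> + \<nu>) = period a b \<mu> + period a b \<nu>"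
  by (cases a; cases b; cases \<mu>; cases \<nu>) (simp add: period_def algebra_simps)

lemma period_minus: "period a b (- \<mu>) = - period a b \<mu>"
  by (cases a; cases b; cases \<mu>) (simp add: period_def algebra_simps)

lemma period_simps: "period a b 0 = 0" "period a b (1, 0) = a" "period a b (0, 1) = b"
  by (cases a; cases b; simp add: period_def zero_prod_def)+

context dominance
begin

text \<open>The polynomial \<open>P\<close> is integral on the ball with centre \<open>a\<close> and radius \<open>r\<close> if the three coefficients of
\<open>P (a + r y) / r\<close>, as a polynomial in \<open>y\<close>, are finite. The substitution preserves the discriminant. The conditions
are multiplied out, which gives them a meaning also for radii in the support.\<close>

fun integral_on :: "'a \<times> 'a \<Rightarrow> 'a quadratic \<Rightarrow> bool" where
  "integral_on (a, r) (A, B, C) \<longleftrightarrow>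
     A * r \<preceq> 1 \<and> 2 * A * a + B \<preceq> 1 \<and> A * a * a + B * a + C \<preceq> r"

fun ball_le :: "'a \<times> 'a \<Rightarrow> 'a \<times> 'a \<Rightarrow> bool" where
  "ball_le (a, r) (b, s) \<longleftrightarrow> r \<preceq> s \<and> a - b \<preceq> s"

lemma integral_on_add: "integral_on t P \<Longrightarrow> integral_on t Q \<Longrightarrow> integral_on t (P + Q)"
proof (cases t; cases P; cases Q)
  fix a r A B C A' B' C'
  assume *: "t = (a, r)" "P = (A, B, C)" "Q = (A', B', C')" "integral_on t P" "integral_on t Q"
  have "(A + A') * r = A * r + A' * r"
    "2 * (A + A') * a + (B + B') = (2 * A * a + B) + (2 * A' * a + B')"
    "(A + A') * a * a + (B + B') * a + (C + C') = (A * a * a + B * a + C) + (A' * a * a + B' * a + C')"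
    by (simp_all add: algebra_simps)
  moreover have "A * r + A' * r \<preceq> 1" "(2 * A * a + B) + (2 * A' * a + B') \<preceq> 1"
    "(A * a * a + B * a + C) + (A' * a * a + B' * a + C') \<preceq> r"
    using *(4,5) by (auto simp: * intro!: add)
  ultimately show ?thesis unfolding * by (simp only: add_Pair integral_on.simps)
qed

lemma integral_on_minus: "integral_on t P \<Longrightarrow> integral_on t (- P)"
proof (cases t; cases P)
  fix a r A B C
  assume *: "t = (a, r)" "P = (A, B, C)" "integral_on t P"
  have "(- A) * r = - (A * r)" "2 * (- A) * a + (- B) = - (2 * A * a + B)"
    "(- A) * a * a + (- B) * a + (- C) = - (A * a * a + B * a + C)"
    by (simp_all add: algebra_simps)
  moreover have "- (A * r) \<preceq> 1" "- (2 * A * a + B) \<preceq> 1" "- (A * a * a + B * a + C) \<preceq> r"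
    using *(3) by (simp_all only: * integral_on.simps minus)
  ultimately show ?thesis unfolding * by (simp only: uminus_Pair integral_on.simps)
qed

lemma integral_on_diff: "integral_on t P \<Longrightarrow> integral_on t Q \<Longrightarrow> integral_on t (P - Q)"
  using integral_on_add[OF _ integral_on_minus, of t P Q] by simp

lemma integral_on_zero: "integral_on t 0"
  by (cases t) (simp add: zero_prod_def)

text \<open>The invariance of the polarized discriminant under the substitution \<open>z \<mapsto> a + z\<close>.\<close>

lemma pairing_shift:
  "pairing (A, B, C) (A', B', C') = (2 * A * a + B) * (2 * A' * a + B')
      - 2 * (A * (A' * a * a + B' * a + C') + A' * (A * a * a + B * a + C))"
  by (simp add: pairing_def algebra_simps)

lemma integral_on_pairing:
  assumes "integral_on t P" "integral_on t Q"
  shows "pairing P Q \<preceq> 1"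
proof (cases t; cases P; cases Q)
  fix a r A B C A' B' C'
  assume *: "t = (a, r)" "P = (A, B, C)" "Q = (A', B', C')"
  have "A * (A' * a * a + B' * a + C') \<preceq> A * r" "A' * (A * a * a + B * a + C) \<preceq> A' * r"
    using assms * by (auto intro: mult_left)
  then have "A * (A' * a * a + B' * a + C') \<preceq> 1" "A' * (A * a * a + B * a + C) \<preceq> 1"
    using assms * trans[of _ "A * r" 1] trans[of _ "A' * r" 1] by auto
  moreover have "(2 * A * a + B) * (2 * A' * a + B') \<preceq> 1"
    using assms * by (auto intro: mult_le_one)
  ultimately show ?thesis
    unfolding * pairing_shift[of A B C A' B' C' a] by (intro diff two_mult add)
qed

text \<open>Completing the square: with the centre \<open>a = - B / (2 A)\<close> and the radius \<open>1 / A\<close> the first polynomial becomes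
\<open>y\<^sup>2\<close> plus a finite constant. Finiteness of the pairing then bounds the constant coefficient of the second
polynomial, and finiteness of its discriminant bounds the linear one.\<close>

lemma common_ball_leading:
  assumes A: "\<not> A \<preceq> 0" and AA': "A' \<preceq> A"
    and PP: "pairing (A, B, C) (A, B, C) \<preceq> 1" and QQ: "pairing (A', B', C') (A', B', C') \<preceq> 1"
    and PQ: "pairing (A, B, C) (A', B', C') \<preceq> 1"
  shows "\<exists>t. integral_on t (A, B, C) \<and> integral_on t (A', B', C')"
proof -
  obtain h :: 'a where h: "2 * h = 1" using int_unit[of 2] by auto
  obtain y where y: "A * y - 1 \<preceq> 0" using invertible[OF A] by blast
  define a where "a = - (h * B * y)"
  define p where "p = A * a * a + B * a + C"
  define q where "q = A' * a * a + B' * a + C'"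
  define u where "u = 2 * A * a + B"
  define v where "v = 2 * A' * a + B'"
  have null: "x * w \<preceq> z" if "x \<preceq> 0" for x w z
    using mult_right[OF that, of w] zero_trans[of "x * w" z] by simp
  have "u = - ((A * y) * B * (2 * h)) + B"
    unfolding u_def a_def by (simp only: mult_ac mult_minus_right)
  then have "u = (A * y - 1) * (- B)"
    unfolding h by (simp add: algebra_simps)
  then have u: "u * w \<preceq> z" for w z
    using null[OF y, of "- B * w" z] by (simp add: mult.assoc)
  have Ay: "A * y \<preceq> 1" using add[OF zero_trans[OF y, of 1] refl] by simp
  have A'y: "A' * y \<preceq> 1" by (rule trans[OF mult_right[OF AA'] Ay])
  have cancel: "x \<preceq> y" if "A * x \<preceq> 1" for x
  proof -
    have "y * (A * x) \<preceq> y" using mult_left[OF that, of y] by simp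
    then have "y * (A * x) - (A * y - 1) * x \<preceq> y" by (intro diff null[OF y])
    moreover have "y * (A * x) - (A * y - 1) * x = x" by (simp add: algebra_simps)
    ultimately show ?thesis by simp
  qed
  have eqs: "pairing (A, B, C) (A, B, C) = u * u - 2 * (A * p + A * p)"
    "pairing (A, B, C) (A', B', C') = u * v - 2 * (A * q + A' * p)"
    "pairing (A', B', C') (A', B', C') = v * v - 2 * (A' * q + A' * q)"
    unfolding p_def q_def u_def v_def by (rule pairing_shift)+
  have "u * u - pairing (A, B, C) (A, B, C) \<preceq> 1"
    by (rule diff[OF u PP])
  moreover have "u * u - pairing (A, B, C) (A, B, C) = 2 * (2 * (A * p))"
    unfolding eqs by (simp add: algebra_simps)
  ultimately have "2 * (2 * (A * p)) \<preceq> 1" by (simp only:)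
  then have "A * p \<preceq> 1" by (rule two_cancel[OF two_cancel])
  then have p: "p \<preceq> y" by (rule cancel)
  have "u * v - pairing (A, B, C) (A', B', C') \<preceq> 1"
    by (rule diff[OF u PQ])
  then have "2 * (A * q + A' * p) \<preceq> 1" by (simp add: eqs)
  then have "A * q + A' * p \<preceq> 1" by (rule two_cancel)
  moreover have "A' * p \<preceq> 1" by (rule trans[OF mult_left[OF p] A'y])
  ultimately have "A * q + A' * p - A' * p \<preceq> 1" by (rule diff)
  then have Aq: "A * q \<preceq> 1" by simp
  then have q: "q \<preceq> y" by (rule cancel)
  have "A' * q \<preceq> 1" by (rule trans[OF mult_right[OF AA'] Aq])
  then have "pairing (A', B', C') (A', B', C') + 2 * (A' * q + A' * q) \<preceq> 1"
    by (intro add two_mult QQ)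
  then have "v * v \<preceq> 1" unfolding eqs by simp
  then have v: "v \<preceq> 1" by (rule square_cancel)
  have "integral_on (a, y) (A, B, C)" "integral_on (a, y) (A', B', C')"
    using Ay A'y p q v u[of 1 1] unfolding p_def q_def u_def v_def by simp_all
  then show ?thesis by blast
qed

text \<open>The triangle lemma: two sides whose squares and scalar product are finite have a common lattice. If both
polynomials are linear, then any sufficiently large ball around \<open>0\<close> does.\<close>

lemma common_ball:
  assumes "pairing P P \<preceq> 1" "pairing Q Q \<preceq> 1" "pairing P Q \<preceq> 1"
  shows "\<exists>t. integral_on t P \<and> integral_on t Q"
proof (cases P; cases Q)
  fix A B C A' B' C'
  assume *: "P = (A, B, C)" "Q = (A', B', C')"
  show ?thesis
  proof (cases "A \<preceq> 0 \<and> A' \<preceq> 0")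
    case False
    then consider "\<not> A \<preceq> 0" "A' \<preceq> A" | "\<not> A' \<preceq> 0" "A \<preceq> A'"
      using total[of A A'] trans[of A A' 0] trans[of A' A 0] by blast
    then show ?thesis
    proof cases
      case 1
      show ?thesis using common_ball_leading[OF 1 assms[unfolded *]] unfolding * .
    next
      case 2
      have "pairing Q P \<preceq> 1" using assms(3) by (simp only: pairing_commute)
      then show ?thesis
        using common_ball_leading[OF 2, of B' C' B C] assms(1,2) unfolding * by blast
    qed
  next
    case True
    obtain r where r: "C \<preceq> r" "C' \<preceq> r" using total[of C C'] refl[of C] refl[of C'] by blast
    have lin: "b \<preceq> 1" if "\<alpha> \<preceq> 0" "pairing (\<alpha>, b, c) (\<alpha>, b, c) \<preceq> 1" for \<alpha> b c
    proof -
      have "b * b = pairing (\<alpha>, b, c) (\<alpha>, b, c) + \<alpha> * (4 * c)"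
        by (simp add: pairing_def algebra_simps)
      moreover have "\<alpha> * (4 * c) \<preceq> 1"
        using mult_right[OF that(1), of "4 * c"] zero_trans[of "\<alpha> * (4 * c)" 1] by simp
      ultimately have "b * b \<preceq> 1" using add[OF that(2), of "\<alpha> * (4 * c)"] by simp
      then show ?thesis by (rule square_cancel)
    qed
    have null: "x * w \<preceq> z" if "x \<preceq> 0" for x w z
      using mult_right[OF that, of w] zero_trans[of "x * w" z] by simp
    have "integral_on (0, r) P" "integral_on (0, r) Q"
      using lin[of A B C] lin[of A' B' C'] assms(1,2) True r null[of A r 1] null[of A' r 1]
      by (simp_all add: *)
    then show ?thesis by blast
  qed
qed

lemma ball_le_refl: "ball_le s s"
  by (cases s) simp

lemma ball_le_trans: "ball_le s x \<Longrightarrow> ball_le x y \<Longrightarrow> ball_le s y"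
proof (cases s; cases x; cases y)
  fix a r b u c v
  assume *: "s = (a, r)" "x = (b, u)" "y = (c, v)" "ball_le s x" "ball_le x y"
  then have "a - b \<preceq> v" "b - c \<preceq> v" "r \<preceq> v"
    using trans[of _ u v] by auto
  then show ?thesis using add[of "a - b" v "b - c"] * by simp
qed

text \<open>Two balls with a common point are nested, as in any ultrametric space. So the balls above a given one form a
chain, which makes the order a tree rooted at infinity.\<close>

lemma ball_le_chain: "ball_le s x \<Longrightarrow> ball_le s y \<Longrightarrow> ball_le x y \<or> ball_le y x"
proof (cases s; cases x; cases y)
  fix a r b u c v
  assume *: "s = (a, r)" "x = (b, u)" "y = (c, v)" "ball_le s x" "ball_le s y"
  then have ab: "a - b \<preceq> u" "a - c \<preceq> v" by auto
  consider "u \<preceq> v" | "v \<preceq> u" using total by blast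
  then show ?thesis
  proof cases
    case 1
    have "(a - c) - (a - b) \<preceq> v" by (rule diff[OF ab(2) trans[OF ab(1) 1]])
    then show ?thesis using * 1 by simp
  next
    case 2
    have "(a - b) - (a - c) \<preceq> u" by (rule diff[OF ab(1) trans[OF ab(2) 2]])
    then show ?thesis using * 2 by simp
  qed
qed

text \<open>Convexity of the subtree of a vector along a chain of balls.\<close>

lemma integral_on_convex:
  assumes "ball_le s x" "ball_le x y" "integral_on s P" "integral_on y P"
  shows "integral_on x P"
proof (cases s; cases x; cases y; cases P)
  fix a r b u c v A B C
  assume *: "s = (a, r)" "x = (b, u)" "y = (c, v)" "P = (A, B, C)"
  define d where "d = b - a"
  have "d \<preceq> u" using assms(1) minus[of "a - b" u] by (simp add: * d_def)
  have 1: "A * u \<preceq> 1"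
    using assms(2,4) mult_left[of u v A] trans[of "A * u" "A * v" 1] by (simp add: *)
  have Ad: "A * d \<preceq> 1" by (rule trans[OF mult_left[OF \<open>d \<preceq> u\<close>] 1])
  have a: "2 * A * a + B \<preceq> 1" "A * a * a + B * a + C \<preceq> u"
    using assms(1,3) trans[of _ r u] by (auto simp: *)
  have "2 * A * b + B = (2 * A * a + B) + 2 * (A * d)"
    "A * b * b + B * b + C = (A * a * a + B * a + C) + (2 * A * a + B) * d + (A * d) * d"
    by (simp_all add: d_def algebra_simps)
  moreover have "(2 * A * a + B) + 2 * (A * d) \<preceq> 1"
    "(A * a * a + B * a + C) + (2 * A * a + B) * d + (A * d) * d \<preceq> u"
    by (intro add two_mult mult_le_one a Ad \<open>d \<preceq> u\<close>)+
  ultimately show ?thesis using 1 by (simp only: * integral_on.simps)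
qed

text \<open>Convexity in the remaining direction: the path in the tree between two balls passes through the smallest ball that
contains both. Its radius is the largest of the two radii and the distance of the centres, so joins
stay within a finite set of candidates.\<close>

lemma ball_join:
  assumes "s = (a, r)" "x = (b, u)"
  obtains w where "w \<in> {r, u, b - a}" "ball_le s (a, w)" "ball_le x (a, w)"
    "\<And>P. integral_on s P \<Longrightarrow> integral_on x P \<Longrightarrow> integral_on (a, w) P"
proof -
  have "\<exists>w\<in>{r, u, b - a}. r \<preceq> w \<and> u \<preceq> w \<and> b - a \<preceq> w"
    using total[of r u] total[of r "b - a"] total[of u "b - a"]
      trans[of r u "b - a"] trans[of "b - a" u r] trans[of u r "b - a"] trans[of "b - a" r u]
      trans[of r "b - a" u] trans[of u "b - a" r] refl[of r] refl[of u] refl[of "b - a"] by blast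
  then obtain w where w: "w \<in> {r, u, b - a}" "r \<preceq> w" "u \<preceq> w" "b - a \<preceq> w" by blast
  moreover have "integral_on (a, w) P" if P: "integral_on s P" "integral_on x P" for P
  proof (cases P)
    fix A B C assume "P = (A, B, C)"
    note * = this assms
    have "2 * (A * (b - a)) = (2 * A * b + B) - (2 * A * a + B)"
      by (simp add: algebra_simps)
    also have "\<dots> \<preceq> 1" using P by (intro diff) (simp_all add: *)
    finally have "A * (b - a) \<preceq> 1" by (rule two_cancel)
    then have "A * w \<preceq> 1" using w(1) P by (auto simp: *)
    then show ?thesis using P(1) trans[OF _ w(2)] by (simp add: *)
  qed
  ultimately show ?thesis using that assms by simp
qed

end

section \<open>Areas on a triangulated torus\<close>

text \<open>Each unit square of the grid is cut along its diagonal; \<open>True\<close> marks the half below it. The value is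
twice the signed area of the image of the triangle under the map \<open>(f, g)\<close> to the plane.\<close>

fun tri_area :: "(nat \<times> nat \<Rightarrow> real) \<Rightarrow> (nat \<times> nat \<Rightarrow> real) \<Rightarrow> nat \<times> nat \<times> bool \<Rightarrow> real" where
  "tri_area f g (i, j, True) =
     (f (Suc i, j) - f (i, j)) * (g (Suc i, Suc j) - g (i, j)) -
     (f (Suc i, Suc j) - f (i, j)) * (g (Suc i, j) - g (i, j))"
| "tri_area f g (i, j, False) =
     (f (Suc i, Suc j) - f (i, j)) * (g (i, Suc j) - g (i, j)) -
     (f (i, Suc j) - f (i, j)) * (g (Suc i, Suc j) - g (i, j))"

definition triangles :: "nat \<Rightarrow> (nat \<times> nat \<times> bool) set" where
  "triangles n = {..<n} \<times> {..<n} \<times> UNIV"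

text \<open>Opposite sides of the \<open>n \<times> n\<close> square are identified, whence the reduction modulo \<open>n\<close> in the second
triangle. The edge itself is recorded by its position next to the first triangle.\<close>

inductive shared_edge ::
    "nat \<Rightarrow> nat \<times> nat \<times> bool \<Rightarrow> nat \<times> nat \<times> bool \<Rightarrow> nat \<times> nat \<Rightarrow> nat \<times> nat \<Rightarrow> bool" for n where
  diagonal: "i < n \<Longrightarrow> j < n \<Longrightarrow>
    shared_edge n (i, j, True) (i, j, False) (i, j) (Suc i, Suc j)"
| vertical: "i < n \<Longrightarrow> j < n \<Longrightarrow>
    shared_edge n (i, j, True) (Suc i mod n, j, False) (Suc i, j) (Suc i, Suc j)"
| horizontal: "i < n \<Longrightarrow> j < n \<Longrightarrow>
    shared_edge n (i, j, False) (i, Suc j mod n, True) (i, Suc j) (Suc i, Suc j)"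

definition quasiperiodic :: "nat \<Rightarrow> (nat \<times> nat \<Rightarrow> 'b::ab_group_add) \<Rightarrow> 'b \<Rightarrow> 'b \<Rightarrow> bool" where
  "quasiperiodic n f c d \<longleftrightarrow>
     (\<forall>j\<le>n. f (n, j) = f (0, j) + c) \<and> (\<forall>i\<le>n. f (i, n) = f (i, 0) + d)"

lemma quasiperiodic_diff:
  "quasiperiodic n f c d \<Longrightarrow> quasiperiodic n g c' d' \<Longrightarrow>
   quasiperiodic n (\<lambda>p. f p - g p) (c - c') (d - d')"
  by (auto simp: quasiperiodic_def)

lemma quasiperiodic_linear:
  fixes f g :: "nat \<times> nat \<Rightarrow> real"
  shows "quasiperiodic n f c d \<Longrightarrow> quasiperiodic n g c' d' \<Longrightarrow>
   quasiperiodic n (\<lambda>p. x * f p + y * g p) (x * c + y * c') (x * d + y * d')"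
  by (auto simp: quasiperiodic_def algebra_simps)

lemma sum_mod_shift:
  fixes h :: "nat \<Rightarrow> real"
  assumes "0 < n"
  shows "(\<Sum>j<n. h (Suc j mod n)) = (\<Sum>j<n. h j)"
proof -
  obtain m where n: "n = Suc m" using assms gr0_implies_Suc by blast
  have "(\<Sum>j<n. h (Suc j mod n)) = (\<Sum>j<m. h (Suc j)) + h 0"
    by (simp add: n)
  also have "\<dots> = (\<Sum>j<n. h j)"
    unfolding n by (simp add: sum.lessThan_Suc_shift del: sum.lessThan_Suc)
  finally show ?thesis .
qed

lemma sum_triangles:
  "(\<Sum>t\<in>triangles n. h t) = (\<Sum>i<n. \<Sum>j<n. h (i, j, True) + h (i, j, False))"
proof -
  have "(\<Sum>t\<in>triangles n. h t) = (\<Sum>i<n. \<Sum>j<n. \<Sum>b\<in>UNIV. h (i, j, b))"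
    unfolding triangles_def by (simp add: sum.cartesian_product)
  then show ?thesis by (simp add: UNIV_bool add.commute)
qed

text \<open>Here \<open>D\<close> is a region of the torus, given by its triangles.\<close>

definition area :: "nat \<Rightarrow> (nat \<times> nat \<times> bool) set \<Rightarrow> (nat \<times> nat \<Rightarrow> real) \<Rightarrow> (nat \<times> nat \<Rightarrow> real) \<Rightarrow> real" where
  "area n D f g = (\<Sum>t\<in>triangles n. if t \<in> D then tri_area f g t else 0)"

definition boundary_constant :: "nat \<Rightarrow> (nat \<times> nat \<times> bool) set \<Rightarrow> (nat \<times> nat \<Rightarrow> real) \<Rightarrow> bool" where
  "boundary_constant n D g \<longleftrightarrow>
     (\<forall>s t p q. shared_edge n s t p q \<longrightarrow> (s \<in> D) \<noteq> (t \<in> D) \<longrightarrow> g p = g q)"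

text \<open>Discrete Stokes theorem. For periodic \<open>f\<close> the area form is the coboundary of the periodic cochain
\<open>e p q = (f p + f q) (g q - g p)\<close>, and this cochain vanishes on the boundary of \<open>D\<close> where \<open>g\<close> is
constant along edges.\<close>

lemma area_eq_0:
  assumes n: "0 < n" and f: "quasiperiodic n f 0 0" and g: "quasiperiodic n g c d"
    and bc: "boundary_constant n D g"
  shows "area n D f g = 0"
proof -
  define e where "e = (\<lambda>p q. (f p + f q) * (g q - g p))"
  define ind where "ind = (\<lambda>t. if t \<in> D then 1 else 0 :: real)"
  have bd: "ind s * e p q = ind t * e p q" if "shared_edge n s t p q" for s t p q
  proof (cases "(s \<in> D) = (t \<in> D)")
    case False
    then have "g p = g q" using bc that unfolding boundary_constant_def by blast
    then show ?thesis by (simp add: e_def)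
  qed (simp add: ind_def)
  have w: "tri_area f g (i, j, True) = e (i, j) (Suc i, j) + e (Suc i, j) (Suc i, Suc j) - e (i, j) (Suc i, Suc j)"
    "tri_area f g (i, j, False) = e (i, j) (Suc i, Suc j) - e (i, Suc j) (Suc i, Suc j) - e (i, j) (i, Suc j)" for i j
    by (simp_all add: e_def algebra_simps)
  have per: "e (i, n) (Suc i, n) = e (i, 0) (Suc i, 0)" "e (n, i) (n, Suc i) = e (0, i) (0, Suc i)"
    if "i < n" for i
    using that f g by (auto simp: e_def quasiperiodic_def)
  have H: "(\<Sum>j<n. ind (i, j, True) * e (i, j) (Suc i, j)) =
      (\<Sum>j<n. ind (i, j, False) * e (i, Suc j) (Suc i, Suc j))" if "i < n" for i
  proof -
    have "(\<Sum>j<n. ind (i, j, True) * e (i, j) (Suc i, j)) =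
        (\<Sum>j<n. ind (i, Suc j mod n, True) * e (i, Suc j mod n) (Suc i, Suc j mod n))"
      by (rule sum_mod_shift[OF n, symmetric])
    also have "\<dots> = (\<Sum>j<n. ind (i, j, False) * e (i, Suc j) (Suc i, Suc j))"
    proof (rule sum.cong[OF refl])
      fix j assume "j \<in> {..<n}"
      then have j: "j < n" by simp
      have "e (i, Suc j mod n) (Suc i, Suc j mod n) = e (i, Suc j) (Suc i, Suc j)"
        using j per(1)[OF that] by (cases "Suc j = n") auto
      then show "ind (i, Suc j mod n, True) * e (i, Suc j mod n) (Suc i, Suc j mod n) =
          ind (i, j, False) * e (i, Suc j) (Suc i, Suc j)"
        using bd[OF horizontal[OF that j]] by (simp only:)
    qed
    finally show ?thesis .
  qed
  have V: "(\<Sum>i<n. ind (i, j, False) * e (i, j) (i, Suc j)) =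
      (\<Sum>i<n. ind (i, j, True) * e (Suc i, j) (Suc i, Suc j))" if "j < n" for j
  proof -
    have "(\<Sum>i<n. ind (i, j, False) * e (i, j) (i, Suc j)) =
        (\<Sum>i<n. ind (Suc i mod n, j, False) * e (Suc i mod n, j) (Suc i mod n, Suc j))"
      by (rule sum_mod_shift[OF n, symmetric])
    also have "\<dots> = (\<Sum>i<n. ind (i, j, True) * e (Suc i, j) (Suc i, Suc j))"
    proof (rule sum.cong[OF refl])
      fix i assume "i \<in> {..<n}"
      then have i: "i < n" by simp
      have "e (Suc i mod n, j) (Suc i mod n, Suc j) = e (Suc i, j) (Suc i, Suc j)"
        using i per(2)[OF that] by (cases "Suc i = n") auto
      then show "ind (Suc i mod n, j, False) * e (Suc i mod n, j) (Suc i mod n, Suc j) =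
          ind (i, j, True) * e (Suc i, j) (Suc i, Suc j)"
        using bd[OF vertical[OF i that]] by (simp only:)
    qed
    finally show ?thesis .
  qed
  have "area n D f g = (\<Sum>t\<in>triangles n. ind t * tri_area f g t)"
    unfolding area_def ind_def by (rule sum.cong) auto
  also have "\<dots> = (\<Sum>i<n. \<Sum>j<n. ind (i, j, True) * tri_area f g (i, j, True)
      + ind (i, j, False) * tri_area f g (i, j, False))"
    by (rule sum_triangles)
  also have "\<dots> = (\<Sum>i<n. \<Sum>j<n.
       (ind (i, j, True) * e (i, j) (Suc i, j) - ind (i, j, False) * e (i, Suc j) (Suc i, Suc j))
     + (ind (i, j, True) * e (Suc i, j) (Suc i, Suc j) - ind (i, j, False) * e (i, j) (i, Suc j)))"
  proof (intro sum.cong refl)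
    fix i j assume "i \<in> {..<n}" "j \<in> {..<n}"
    then have "ind (i, j, True) * e (i, j) (Suc i, Suc j) = ind (i, j, False) * e (i, j) (Suc i, Suc j)"
      by (intro bd diagonal) auto
    then show "ind (i, j, True) * tri_area f g (i, j, True) + ind (i, j, False) * tri_area f g (i, j, False) =
       (ind (i, j, True) * e (i, j) (Suc i, j) - ind (i, j, False) * e (i, Suc j) (Suc i, Suc j))
     + (ind (i, j, True) * e (Suc i, j) (Suc i, Suc j) - ind (i, j, False) * e (i, j) (i, Suc j))"
      unfolding w right_diff_distrib distrib_left by linarith
  qed
  also have "\<dots> = (\<Sum>i<n. (\<Sum>j<n. ind (i, j, True) * e (i, j) (Suc i, j))
      - (\<Sum>j<n. ind (i, j, False) * e (i, Suc j) (Suc i, Suc j)))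
    + (\<Sum>j<n. (\<Sum>i<n. ind (i, j, True) * e (Suc i, j) (Suc i, Suc j))
      - (\<Sum>i<n. ind (i, j, False) * e (i, j) (i, Suc j)))"
    by (simp add: sum.distrib sum_subtractf
        sum.swap[of "\<lambda>i j. ind (i, j, True) * e (Suc i, j) (Suc i, Suc j)"]
        sum.swap[of "\<lambda>i j. ind (i, j, False) * e (i, j) (i, Suc j)"])
  also have "\<dots> = 0"
    using H V by (simp add: sum.neutral)
  finally show ?thesis .
qed

lemma tri_area_bilinear:
  "tri_area (\<lambda>p. x * f p + y * f' p) g t = x * tri_area f g t + y * tri_area f' g t"
  "tri_area f (\<lambda>p. x * g p + y * g' p) t = x * tri_area f g t + y * tri_area f g' t"
  "tri_area f g t = - tri_area g f t"
  by (cases "(f, g, t)" rule: tri_area.cases; simp add: algebra_simps)+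

lemma area_linear_left:
  "area n D (\<lambda>p. x * f p + y * f' p) g = x * area n D f g + y * area n D f' g"
  unfolding area_def sum_distrib_left sum.distrib[symmetric]
  by (intro sum.cong refl) (simp add: tri_area_bilinear(1))

lemma area_commute: "area n D f g = - area n D g f"
  unfolding area_def sum_negf[symmetric]
  by (intro sum.cong refl) (simp add: tri_area_bilinear(3)[of f g])

lemma area_linear_right:
  "area n D g (\<lambda>p. x * f p + y * f' p) = x * area n D g f + y * area n D g f'"
  using area_linear_left[of n D x f y f' g] by (simp add: area_commute[of n D g] )

lemma area_diff:
  "area n D (\<lambda>p. f p - f' p) g = area n D f g - area n D f' g"
  "area n D g (\<lambda>p. f p - f' p) = area n D g f - area n D g f'"
  using area_linear_left[of n D 1 f "- 1" f' g] area_linear_right[of n D g 1 f "- 1" f']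
  by simp_all

lemma area_self: "area n D f f = 0"
  using area_commute[of n D f f] by simp

text \<open>The area of a region depends only on the periods, as long as the boundary is sufficiently degenerate. The pair
\<open>(p, q)\<close> contracts the boundary, and \<open>F'\<close>, \<open>G'\<close> are the combinations of \<open>p\<close> and \<open>q\<close> with the periods
of \<open>F\<close>, \<open>G\<close>. In the bilinear expansion around them each error term has a periodic factor and is removed by
Stokes. Note that \<open>G\<close> may vary along the boundary.\<close>

lemma area_eq_det:
  assumes n: "0 < n"
    and F: "quasiperiodic n F c d" and G: "quasiperiodic n G c' d'"
    and p: "quasiperiodic n p 1 0" and q: "quasiperiodic n q 0 1"
    and bc: "boundary_constant n D F" "boundary_constant n D p" "boundary_constant n D q"
  shows "area n D F G = (c * d' - d * c') * area n D p q"
proof -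
  define F' where "F' = (\<lambda>x. c * p x + d * q x)"
  define G' where "G' = (\<lambda>x. c' * p x + d' * q x)"
  define f where "f = (\<lambda>x. F x - F' x)"
  define g where "g = (\<lambda>x. G x - G' x)"
  have F': "quasiperiodic n F' c d" and G': "quasiperiodic n G' c' d'"
    unfolding F'_def G'_def
    using quasiperiodic_linear[OF p q, of c d] quasiperiodic_linear[OF p q, of c' d'] by simp_all
  have f: "quasiperiodic n f 0 0" and g: "quasiperiodic n g 0 0"
    unfolding f_def g_def using quasiperiodic_diff[OF F F'] quasiperiodic_diff[OF G G'] by simp_all
  have bcF': "boundary_constant n D F'" and bcG': "boundary_constant n D G'"
    using bc unfolding boundary_constant_def F'_def G'_def by auto
  have bcf: "boundary_constant n D f"
    using bc(1) bcF' unfolding boundary_constant_def f_def by metis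
  have "area n D F G = area n D F' G' + area n D f g + area n D f G' + area n D F' g"
    by (simp add: f_def g_def area_diff)
  also have "area n D f g = 0"
    using area_eq_0[OF n g f bcf] area_commute[of n D f g] by simp
  also have "area n D f G' = 0"
    by (rule area_eq_0[OF n f G' bcG'])
  also have "area n D F' g = 0"
    using area_eq_0[OF n g F' bcF'] area_commute[of n D F' g] by simp
  also have "area n D F' G' = (c * d' - d * c') * area n D p q"
    unfolding F'_def G'_def area_linear_left area_linear_right area_self
    by (simp add: area_commute[of n D q p] algebra_simps)
  finally show ?thesis by simp
qed

lemma total_area:
  assumes n: "0 < n" and F: "quasiperiodic n F c d" and G: "quasiperiodic n G c' d'"
    and det: "c * d' - d * c' = 1"
  shows "(\<Sum>t\<in>triangles n. tri_area F G t) = 2"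
proof -
  define p q :: "nat \<times> nat \<Rightarrow> real" where "p = (\<lambda>(i, j). real i / real n)" and "q = (\<lambda>(i, j). real j / real n)"
  have p: "quasiperiodic n p 1 0" and q: "quasiperiodic n q 0 1"
    using n by (auto simp: p_def q_def quasiperiodic_def)
  have bc: "boundary_constant n UNIV h" for h
    unfolding boundary_constant_def by simp
  have "(\<Sum>t\<in>triangles n. tri_area F G t) = area n UNIV F G"
    unfolding area_def by simp
  also have "\<dots> = area n UNIV p q"
    using area_eq_det[OF n F G p q bc bc bc] det by simp
  also have "\<dots> = (\<Sum>i<n. \<Sum>j<n. tri_area p q (i, j, True) + tri_area p q (i, j, False))"
    unfolding area_def by (simp add: sum_triangles del: tri_area.simps)
  also have "\<dots> = (\<Sum>i<n. \<Sum>j<n. 2 / (real n * real n))"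
    using n by (intro sum.cong refl) (simp add: p_def q_def field_simps)
  also have "\<dots> = 2" using n by simp
  finally show ?thesis .
qed

lemma finite_preorder_minimal:
  fixes le :: "'a \<Rightarrow> 'a \<Rightarrow> bool"
  assumes S: "finite S" "S \<noteq> {}" and refl: "\<And>x. le x x"
    and trans: "\<And>x y z. le x y \<Longrightarrow> le y z \<Longrightarrow> le x z"
  obtains s where "s \<in> S" "\<And>x. x \<in> S \<Longrightarrow> le x s \<Longrightarrow> le s x"
proof -
  define h where "h = (\<lambda>s. card {x \<in> S. le x s})"
  obtain s where s: "s \<in> S" "\<And>x. x \<in> S \<Longrightarrow> h s \<le> h x"
    using S(2) ex_has_least_nat[of "\<lambda>x. x \<in> S" _ h] by blast
  have "le s x" if "x \<in> S" "le x s" for x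
  proof (rule ccontr)
    assume "\<not> le s x"
    then have "{y \<in> S. le y x} \<subset> {y \<in> S. le y s}"
      using that s(1) refl[of s] trans[OF _ that(2)] by blast
    then have "h x < h s" unfolding h_def using S(1) by (intro psubset_card_mono) auto
    then show False using s(2)[OF that(1)] by simp
  qed
  then show ?thesis using that s(1) by blast
qed

text \<open>The colours \<open>S\<close> form a finite tree, and \<open>M t\<close> is the set of vectors that are small for the colour \<open>t\<close>. The
function \<open>F t\<close> is constant along edges that are small for \<open>t\<close>. Colours \<open>s\<close> and \<open>t\<close> either use the same
map, or the edges that are small for both can be contracted equivariantly. In either case the area of a region
bounded by such edges is the same for both maps. So a minimal colour can be merged with the next
one above it without a change of the sum, and induction leaves a single colour, for which the sum is
the area of the torus.

The condition on \<open>\<tau>\<close> concerns only edges between different colours: inside a region that has been recoloured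
the edges need not be small for the new colour.\<close>

theorem area_of_colouring:
  fixes le :: "'t \<Rightarrow> 't \<Rightarrow> bool" and M :: "'t \<Rightarrow> 'v::ab_group_add set"
    and F G :: "'t \<Rightarrow> nat \<times> nat \<Rightarrow> real"
  assumes n: "0 < n"
    and le_refl: "\<And>s. le s s"
    and le_trans: "\<And>s x y. le s x \<Longrightarrow> le x y \<Longrightarrow> le s y"
    and le_chain: "\<And>s x y. le s x \<Longrightarrow> le s y \<Longrightarrow> le x y \<or> le y x"
    and convex: "\<And>s x y v. le s x \<Longrightarrow> le x y \<Longrightarrow> v \<in> M s \<Longrightarrow> v \<in> M y \<Longrightarrow> v \<in> M x"
    and F: "\<And>t. quasiperiodic n (F t) (c t) (d t)" and G: "\<And>t. quasiperiodic n (G t) (c' t) (d' t)"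
    and det: "\<And>t. c t * d' t - d t * c' t = 1"
    and const: "\<And>t x y. \<theta> y - \<theta> x \<in> M t \<Longrightarrow> F t x = F t y"
    and compare: "\<And>s t. (F s = F t \<and> G s = G t) \<or>
      (\<exists>(p :: nat \<times> nat \<Rightarrow> real) (q :: nat \<times> nat \<Rightarrow> real). quasiperiodic n p 1 0 \<and> quasiperiodic n q 0 1 \<and>
        (\<forall>x y. \<theta> y - \<theta> x \<in> M s \<longrightarrow> \<theta> y - \<theta> x \<in> M t \<longrightarrow> p x = p y \<and> q x = q y))"
    and S: "finite S" "S \<noteq> {}" 
    and join: "\<forall>x\<in>S. \<forall>y\<in>S. \<exists>z\<in>S. le x z \<and> le y z \<and> M x \<inter> M y \<subseteq> M z"
    and \<tau>: "\<And>t. t \<in> triangles n \<Longrightarrow> \<tau> t \<in> S"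
    and edges: "\<And>s t x y. shared_edge n s t x y \<Longrightarrow> \<tau> s \<noteq> \<tau> t \<Longrightarrow> \<theta> y - \<theta> x \<in> M (\<tau> s) \<inter> M (\<tau> t)"
  shows "(\<Sum>t\<in>triangles n. tri_area (F (\<tau> t)) (G (\<tau> t)) t) = 2"
  using S join \<tau> edges
proof (induction "card S" arbitrary: S \<tau> rule: less_induct)
  case less
  show ?case
  proof (cases "\<exists>z. S = {z}")
    case True
    then obtain z where "S = {z}" by blast
    then have "(\<Sum>t\<in>triangles n. tri_area (F (\<tau> t)) (G (\<tau> t)) t) = (\<Sum>t\<in>triangles n. tri_area (F z) (G z) t)"
      using less.prems(4) by (intro sum.cong) auto
    then show ?thesis using total_area[OF n F G det] by simp
  next
    case False
    obtain s where s: "s \<in> S" and minimal: "\<And>x. x \<in> S \<Longrightarrow> le x s \<Longrightarrow> le s x"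
      
      using finite_preorder_minimal[of S le] less.prems(1,2) le_refl le_trans by metis
    define X where "X = {x \<in> S - {s}. le s x}"
    have "finite X" using less.prems(1) by (simp add: X_def)
    moreover have "X \<noteq> {}"
    proof -
      obtain z where z: "z \<in> S" "z \<noteq> s" using False s by blast
      obtain j where j: "j \<in> S" "le s j" "le z j" using less.prems(3) s z by blast
      show ?thesis
      proof (cases "j = s")
        case True
        then have "z \<in> X" using minimal[OF z(1)] j z by (simp add: X_def)
        then show ?thesis by blast
      next
        case False
        then have "j \<in> X" using j by (simp add: X_def)
        then show ?thesis by blast
      qed
    qed
    ultimately obtain s' where s'X: "s' \<in> X" and minX: "\<And>x. x \<in> X \<Longrightarrow> le x s' \<Longrightarrow> le s' x"
      using finite_preorder_minimal[of X le] le_refl le_trans by blast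
    have s': "s' \<in> S - {s}" "le s s'" using s'X by (auto simp: X_def)
    have least: "le s' x" if "x \<in> S - {s}" "le s x" for x
      using le_chain[OF s'(2) that(2)] minX[of x] that by (auto simp: X_def)
    define \<tau>' where "\<tau>' = (\<lambda>t. if \<tau> t = s then s' else \<tau> t)"
    define D where "D = {t. \<tau> t = s}"
    \<comment> \<open>An edge between the colour \<open>s\<close> and another one is small for \<open>s'\<close> as well.\<close>
    have up: "\<theta> y - \<theta> x \<in> M s'" if "\<theta> y - \<theta> x \<in> M s" "\<theta> y - \<theta> x \<in> M z" "z \<in> S - {s}" for x y z
    proof -
      have "z \<in> S" using that(3) by simp
      then have "\<exists>j\<in>S. le s j \<and> le z j \<and> M s \<inter> M z \<subseteq> M j"
        using less.prems(3) s by simp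
      then obtain j where j: "j \<in> S" "le s j" "le z j" "M s \<inter> M z \<subseteq> M j" by blast
      show ?thesis
      proof (cases "j = s")
        case True
        then have "le s z" using minimal[OF \<open>z \<in> S\<close>] j(3) by simp
        then have "le s' z" by (rule least[OF that(3)])
        then show ?thesis by (rule convex[OF s'(2) _ that(1,2)])
      next
        case False
        then have "le s' j" using j(1,2) by (intro least) simp_all
        moreover have "\<theta> y - \<theta> x \<in> M j" using j(4) that(1,2) by blast
        ultimately show ?thesis by (rule convex[OF s'(2) _ that(1)])
      qed
    qed
    have bd: "\<theta> y - \<theta> x \<in> M s \<and> \<theta> y - \<theta> x \<in> M s'"
      if "shared_edge n u v x y" "(u \<in> D) \<noteq> (v \<in> D)" for u v x y
    proof -
      have tri: "u \<in> triangles n" "v \<in> triangles n"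
        using that(1) n by (auto elim!: shared_edge.cases simp: triangles_def)
      have "\<tau> u \<noteq> \<tau> v" using that(2) unfolding D_def by auto
      then have "\<theta> y - \<theta> x \<in> M (\<tau> u) \<inter> M (\<tau> v)" using less.prems(5) that(1) by blast
      then show ?thesis
        using that(2) up[of y x "\<tau> u"] up[of y x "\<tau> v"] less.prems(4) tri
        unfolding D_def by auto
    qed
    have bdc: "boundary_constant n D h"
      if "\<And>x y. \<theta> y - \<theta> x \<in> M s \<Longrightarrow> \<theta> y - \<theta> x \<in> M s' \<Longrightarrow> h x = h y" for h
      using bd that unfolding boundary_constant_def by blast
    have "area n D (F s) (G s) = area n D (F s') (G s')"
      using compare[of s s']
    proof
      assume "\<exists>(p :: nat \<times> nat \<Rightarrow> real) (q :: nat \<times> nat \<Rightarrow> real). quasiperiodic n p 1 0 \<and> quasiperiodic n q 0 1 \<and>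
        (\<forall>x y. \<theta> y - \<theta> x \<in> M s \<longrightarrow> \<theta> y - \<theta> x \<in> M s' \<longrightarrow> p x = p y \<and> q x = q y)"
      then obtain p q :: "nat \<times> nat \<Rightarrow> real" where pq: "quasiperiodic n p 1 0" "quasiperiodic n q 0 1"
        and "\<And>x y. \<theta> y - \<theta> x \<in> M s \<Longrightarrow> \<theta> y - \<theta> x \<in> M s' \<Longrightarrow> p x = p y \<and> q x = q y"
        by blast
      then have "boundary_constant n D p" "boundary_constant n D q"
        "boundary_constant n D (F s)" "boundary_constant n D (F s')"
        using bdc const by blast+
      then show ?thesis
        using area_eq_det[OF n F[of s] G[of s] pq] area_eq_det[OF n F[of s'] G[of s'] pq] det by simp
    qed simp
    moreover have "(\<Sum>t\<in>triangles n. tri_area (F (\<tau> t)) (G (\<tau> t)) t) - area n D (F s) (G s) =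
        (\<Sum>t\<in>triangles n. tri_area (F (\<tau>' t)) (G (\<tau>' t)) t) - area n D (F s') (G s')"
      unfolding area_def sum_subtractf[symmetric]
      by (intro sum.cong) (auto simp: D_def \<tau>'_def)
    moreover have "(\<Sum>t\<in>triangles n. tri_area (F (\<tau>' t)) (G (\<tau>' t)) t) = 2"
    proof (rule less.hyps)
      show "card (S - {s}) < card S" using less.prems(1) s by (metis card_Diff1_less)
      show "finite (S - {s})" "S - {s} \<noteq> {}" using less.prems(1) s' by auto
      show "\<tau>' t \<in> S - {s}" if "t \<in> triangles n" for t
        using less.prems(4)[OF that] s'(1) by (auto simp: \<tau>'_def)
      show "\<forall>x\<in>S - {s}. \<forall>y\<in>S - {s}. \<exists>z\<in>S - {s}. le x z \<and> le y z \<and> M x \<inter> M y \<subseteq> M z"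
      proof (intro ballI)
        fix x y assume xy: "x \<in> S - {s}" "y \<in> S - {s}"
        then obtain z where z: "z \<in> S" "le x z" "le y z" "M x \<inter> M y \<subseteq> M z"
          using less.prems(3) by blast
        show "\<exists>z\<in>S - {s}. le x z \<and> le y z \<and> M x \<inter> M y \<subseteq> M z"
        proof (cases "z = s")
          case True
          then have "le s x" using minimal[of x] xy(1) z(2) by simp
          then have "le y x" using le_trans[of y s x] z(3) True by simp
          then show ?thesis using xy(1) le_refl[of x] by blast
        next
          case False
          then show ?thesis using z by blast
        qed
      qed
      fix u v x y assume *: "shared_edge n u v x y" "\<tau>' u \<noteq> \<tau>' v"
      have tri: "u \<in> triangles n" "v \<in> triangles n"
        using *(1) n by (auto elim!: shared_edge.cases simp: triangles_def)
      have "\<tau> u \<noteq> \<tau> v" using *(2) unfolding \<tau>'_def by metis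
      then have m: "\<theta> y - \<theta> x \<in> M (\<tau> u) \<inter> M (\<tau> v)" using less.prems(5) *(1) by blast
      consider "\<tau> u = s" | "\<tau> v = s" | "\<tau> u \<noteq> s" "\<tau> v \<noteq> s" by blast
      then show "\<theta> y - \<theta> x \<in> M (\<tau>' u) \<inter> M (\<tau>' v)"
      proof cases
        case 1
        then show ?thesis
          using m up[of y x "\<tau> v"] less.prems(4)[OF tri(2)] \<open>\<tau> u \<noteq> \<tau> v\<close> by (auto simp: \<tau>'_def)
      next
        case 2
        then show ?thesis
          using m up[of y x "\<tau> u"] less.prems(4)[OF tri(1)] \<open>\<tau> u \<noteq> \<tau> v\<close> by (auto simp: \<tau>'_def)
      next
        case 3
        then show ?thesis using m by (simp add: \<tau>'_def)
      qed
    qed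
    ultimately show ?thesis by simp
  qed
qed

section \<open>Bounded periods of doubly periodic grids\<close>

text \<open>Vertices whose positions differ by an element of \<open>M\<close> are to be identified. The hypothesis on \<open>c\<close>, \<open>d\<close> says
that the character \<open>(k, l) \<mapsto> k c + l d\<close> of the period lattice is trivial on the stabilizer of every
class. So it is well defined to send a vertex to the character of the translation that takes
a chosen representative of its orbit to its class.\<close>

lemma equivariant_function:
  fixes \<theta> :: "nat \<times> nat \<Rightarrow> 'a::comm_ring_1 quadratic" and c d :: real
  assumes \<theta>: "quasiperiodic n \<theta> a b"
    and M: "0 \<in> M" "\<And>x y. x \<in> M \<Longrightarrow> y \<in> M \<Longrightarrow> x - y \<in> M"
    and char: "\<And>k l. period a b (k, l) \<in> M \<Longrightarrow> of_int k * c + of_int l * d = 0"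
  shows "\<exists>f. quasiperiodic n f c d \<and> (\<forall>x y. \<theta> y - \<theta> x \<in> M \<longrightarrow> f x = f y)"
proof -
  define P where "P = period a b"
  define ch where "ch = (\<lambda>(k :: int, l :: int). of_int k * c + of_int l * d)"
  have ch_add: "ch (\<mu> + \<nu>) = ch \<mu> + ch \<nu>" and ch_minus: "ch (- \<mu>) = - ch \<mu>" for \<mu> \<nu>
    by (cases \<mu>; cases \<nu>; simp add: ch_def algebra_simps)+
  have P_add: "P (\<mu> + \<nu>) = P \<mu> + P \<nu>" and P_minus: "P (- \<mu>) = - P \<mu>" and P_0: "P 0 = 0" for \<mu> \<nu>
    by (simp_all add: P_def period_add period_minus period_simps)
  have ch0: "ch \<mu> = 0" if "P \<mu> \<in> M" for \<mu>
    using char that by (cases \<mu>) (auto simp: ch_def P_def)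
  have M_minus: "- x \<in> M" if "x \<in> M" for x
    using M(2)[OF M(1) that] by simp
  have M_add: "x + y \<in> M" if "x \<in> M" "y \<in> M" for x y
    using M(2)[OF that(1) M_minus[OF that(2)]] by simp
  define R where "R = (\<lambda>x w. \<exists>\<mu>. \<theta> x - \<theta> w - P \<mu> \<in> M)"
  define r where "r = (\<lambda>x. SOME w. R x w)"
  define m where "m = (\<lambda>x. SOME \<mu>. \<theta> x - \<theta> (r x) - P \<mu> \<in> M)"
  define f where "f = (\<lambda>x. ch (m x))"
  have "R x x" for x
    unfolding R_def by (rule exI[of _ 0]) (simp add: P_0 M)
  then have "R x (r x)" for x
    unfolding r_def by (rule someI)
  then have m: "\<theta> x - \<theta> (r x) - P (m x) \<in> M" for x
    unfolding m_def R_def by (rule someI_ex)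
  have shift: "f y = f x + ch \<mu>" if \<mu>: "\<theta> y - \<theta> x - P \<mu> \<in> M" for x y \<mu>
  proof -
    have "R x w \<longleftrightarrow> R y w" for w
    proof
      assume "R x w"
      then obtain \<nu> where "\<theta> x - \<theta> w - P \<nu> \<in> M" unfolding R_def by blast
      from M_add[OF this \<mu>] have "\<theta> y - \<theta> w - P (\<nu> + \<mu>) \<in> M" by (simp add: P_add algebra_simps)
      then show "R y w" unfolding R_def by blast
    next
      assume "R y w"
      then obtain \<nu> where "\<theta> y - \<theta> w - P \<nu> \<in> M" unfolding R_def by blast
      from M(2)[OF this \<mu>] have "\<theta> x - \<theta> w - P (\<nu> + - \<mu>) \<in> M"
        unfolding P_add P_minus by (simp add: algebra_simps)
      then show "R x w" unfolding R_def by blast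
    qed
    then have r: "r x = r y" unfolding r_def by presburger
    have "(\<theta> y - \<theta> (r y) - P (m y)) - (\<theta> x - \<theta> (r x) - P (m x)) - (\<theta> y - \<theta> x - P \<mu>) \<in> M"
      by (intro M(2) m \<mu>)
    also have "(\<theta> y - \<theta> (r y) - P (m y)) - (\<theta> x - \<theta> (r x) - P (m x)) - (\<theta> y - \<theta> x - P \<mu>)
        = P (m x + \<mu> + - m y)"
      unfolding r P_add P_minus by (simp add: algebra_simps)
    finally have "ch (m x + \<mu> + - m y) = 0" by (rule ch0)
    then show ?thesis unfolding f_def ch_add ch_minus by simp
  qed
  have P1: "P (1, 0) = a" "P (0, 1) = b" by (simp_all add: P_def period_simps)
  have "quasiperiodic n f c d"
    unfolding quasiperiodic_def
  proof (intro conjI allI impI)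
    fix j assume "j \<le> n"
    then have "\<theta> (n, j) - \<theta> (0, j) - P (1, 0) \<in> M" using \<theta> M(1) by (simp add: quasiperiodic_def P1)
    from shift[OF this] show "f (n, j) = f (0, j) + c" by (simp add: ch_def)
  next
    fix j assume "j \<le> n"
    then have "\<theta> (j, n) - \<theta> (j, 0) - P (0, 1) \<in> M" using \<theta> M(1) by (simp add: quasiperiodic_def P1)
    from shift[OF this] show "f (j, n) = f (j, 0) + d" by (simp add: ch_def)
  qed
  moreover have "f x = f y" if "\<theta> y - \<theta> x \<in> M" for x y
    using shift[of y x 0] that ch0[of 0] M(1) by (simp add: P_0)
  ultimately show ?thesis by blast
qed

context dominance
begin

lemma pairing_period_right: "pairing v (period a b (k, l)) = of_int k * pairing v a + of_int l * pairing v b"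
  using pairing_period[of a b k l v] by (simp add: pairing_commute)

text \<open>Finiteness of a pairing passes to all parallel periods, because nonzero integers are units.\<close>

lemma parallel_period:
  assumes "pairing v (period a b (k, l)) \<preceq> 1" "(k, l) \<noteq> 0" "k * l' = l * k'"
  shows "pairing v (period a b (k', l')) \<preceq> 1"
proof (cases "k = 0")
  case False
  have "of_int k * pairing v (period a b (k', l')) = of_int k' * pairing v (period a b (k, l))"
  proof -
    have "of_int (k * l') * pairing v b = of_int (l * k') * pairing v b"
      by (simp only: assms(3))
    then show ?thesis by (simp add: pairing_period_right algebra_simps)
  qed
  then show ?thesis using int_mult[OF assms(1), of k'] int_cancel[OF _ False] by simp
next
  case True
  then have l: "l \<noteq> 0" using assms(2) by (simp add: zero_prod_def)
  have "of_int l * pairing v (period a b (k', l')) = of_int l' * pairing v (period a b (k, l))"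
    using assms(3) True l by (simp add: pairing_period_right algebra_simps)
  then show ?thesis using int_mult[OF assms(1), of l'] int_cancel[OF _ l] by simp
qed

text \<open>By Cramer's rule, \<open>a\<close> and \<open>b\<close> are rational combinations of two independent periods.\<close>

lemma independent_periods:
  assumes "pairing (period a b (k, l)) (period a b (k, l)) \<preceq> 1"
    "pairing (period a b (k, l)) (period a b (k', l')) \<preceq> 1" "k * l' - l * k' \<noteq> 0"
  shows "pairing (period a b (k, l)) a \<preceq> 1 \<and> pairing (period a b (k, l)) b \<preceq> 1"
proof -
  define v where "v = period a b (k, l)"
  define x where "x = pairing v (period a b (k, l))"
  define y where "y = pairing v (period a b (k', l'))"
  have xy: "x \<preceq> 1" "y \<preceq> 1" using assms unfolding x_def y_def v_def by blast+
  have "of_int (k * l' - l * k') * pairing v a = of_int l' * x - of_int l * y"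
    "of_int (k * l' - l * k') * pairing v b = of_int k * y - of_int k' * x"
    unfolding x_def y_def pairing_period_right by (simp_all add: algebra_simps)
  moreover have "of_int l' * x - of_int l * y \<preceq> 1" "of_int k * y - of_int k' * x \<preceq> 1"
    by (intro diff int_mult xy)+
  ultimately show ?thesis
    using int_cancel[OF _ assms(3)] unfolding v_def by metis
qed

definition bounded_period :: "'a quadratic \<Rightarrow> 'a quadratic \<Rightarrow> int \<times> int \<Rightarrow> bool" where
  "bounded_period a b \<mu> \<longleftrightarrow>
     \<mu> \<noteq> 0 \<and> pairing (period a b \<mu>) a \<preceq> 1 \<and> pairing (period a b \<mu>) b \<preceq> 1"

text \<open>Suppose that there is no bounded period. For a ball \<open>t\<close> let \<open>\<Lambda> t\<close> be the set of the nonzero periods that are integral on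
\<open>t\<close>. Its members are parallel, since independent ones would be bounded. This gives a direction
\<open>dir t\<close>. If \<open>\<Lambda> t\<close> is empty, the vectors in the lattice of \<open>t\<close> are contracted and the direction is arbitrary.
Otherwise all vectors with finite pairing with \<open>dir t\<close> are contracted; periods with that property are again parallel
to \<open>dir t\<close>. In both cases the character \<open>det (dir t) _\<close> of the period lattice descends to a function \<open>F t\<close>
that is constant along the edges in the lattice of \<open>t\<close>, and \<open>G t\<close> is a linear function with complementary
periods.

Two balls with a common integral period have the same direction and hence the same functions. If
there is no common integral period, then both coordinates of the grid can be made constant along the edges in both
lattices. So the colouring theorem applies and contradicts the vanishing of all areas.\<close>

lemma bounded_period_of_integral_triangles:
  fixes \<theta> :: "nat \<times> nat \<Rightarrow> 'a quadratic"
  assumes n: "0 < n" and \<theta>: "quasiperiodic n \<theta> a b"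
    and \<tau>: "\<And>s t x y. shared_edge n s t x y \<Longrightarrow>
        integral_on (\<tau> s) (\<theta> y - \<theta> x) \<and> integral_on (\<tau> t) (\<theta> y - \<theta> x)"
    and \<tau>_lower: "\<And>i j. i < n \<Longrightarrow> j < n \<Longrightarrow>
        integral_on (\<tau> (i, j, True)) (\<theta> (Suc i, j) - \<theta> (i, j))"
    and \<tau>_upper: "\<And>i j. i < n \<Longrightarrow> j < n \<Longrightarrow>
        integral_on (\<tau> (i, j, False)) (\<theta> (i, Suc j) - \<theta> (i, j))"
  shows "\<exists>\<mu>. bounded_period a b \<mu>"
proof (rule ccontr)
  assume none: "\<not> ?thesis"
  define P where "P = period a b"
  define det where "det = (\<lambda>\<mu> \<nu> :: int \<times> int. fst \<mu> * snd \<nu> - snd \<mu> * fst \<nu>)"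
  have dep: "det \<mu> \<nu> = 0"
    if "\<mu> \<noteq> 0" "pairing (P \<mu>) (P \<mu>) \<preceq> 1" "pairing (P \<mu>) (P \<nu>) \<preceq> 1" for \<mu> \<nu>
  proof (rule ccontr)
    assume "det \<mu> \<nu> \<noteq> 0"
    then have "bounded_period a b \<mu>"
      using independent_periods[of a b "fst \<mu>" "snd \<mu>" "fst \<nu>" "snd \<nu>"] that
      by (simp add: bounded_period_def P_def det_def)
    then show False using none by blast
  qed
  have par: "pairing v (P \<nu>) \<preceq> 1" if "\<mu> \<noteq> 0" "pairing v (P \<mu>) \<preceq> 1" "det \<mu> \<nu> = 0" for v \<mu> \<nu>
    using parallel_period[of v a b "fst \<mu>" "snd \<mu>" "snd \<nu>" "fst \<nu>"] that
    unfolding P_def det_def by simp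
  define \<Lambda> where "\<Lambda> = (\<lambda>t. {\<mu>. \<mu> \<noteq> 0 \<and> integral_on t (P \<mu>)})"
  define dirs where "dirs = (\<lambda>t. {\<nu>. \<nu> \<noteq> 0 \<and> (\<exists>\<mu>\<in>\<Lambda> t. det \<mu> \<nu> = 0)})"
  define dir where "dir = (\<lambda>t. if \<Lambda> t = {} then (1, 0) else SOME \<nu>. \<nu> \<in> dirs t)"
  define M where "M = (\<lambda>t. if \<Lambda> t = {} then {v. integral_on t v} else {v. pairing v (P (dir t)) \<preceq> 1})"
  have dir: "dir t \<in> dirs t" if ne: "\<Lambda> t \<noteq> {}" for t
  proof -
    obtain \<mu> where "\<mu> \<in> \<Lambda> t" using ne by blast
    moreover have "det \<mu> \<mu> = 0" by (simp add: det_def)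
    ultimately have "\<mu> \<in> dirs t" unfolding dirs_def \<Lambda>_def by blast
    then show ?thesis using someI[of "\<lambda>\<nu>. \<nu> \<in> dirs t"] ne unfolding dir_def by simp
  qed
  have dir_nz: "dir t \<noteq> 0" for t
    using dir[of t] unfolding dirs_def dir_def by (auto simp: zero_prod_def)
  have pd: "pairing v (P (dir t)) \<preceq> 1" if ne: "\<Lambda> t \<noteq> {}" and v: "integral_on t v" for t v
  proof -
    obtain \<mu> where \<mu>: "\<mu> \<in> \<Lambda> t" "det \<mu> (dir t) = 0" using dir[OF ne] unfolding dirs_def by blast
    then have "pairing v (P \<mu>) \<preceq> 1" using integral_on_pairing[OF v] unfolding \<Lambda>_def by blast
    then show ?thesis using par \<mu> unfolding \<Lambda>_def by blast
  qed
  have int_M: "v \<in> M t" if "integral_on t v" for t v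
    using that pd unfolding M_def by auto
  have M_char: "det (dir t) \<mu> = 0" if "P \<mu> \<in> M t" for t \<mu>
  proof (cases "\<Lambda> t = {}")
    case True
    then have "integral_on t (P \<mu>)" using that by (simp add: M_def)
    then have "\<mu> = 0" using True unfolding \<Lambda>_def by blast
    then show ?thesis by (simp add: det_def)
  next
    case False
    then obtain \<nu> where \<nu>: "\<nu> \<in> \<Lambda> t" "det \<nu> (dir t) = 0" using dir unfolding dirs_def by blast
    have "pairing (P \<nu>) (P (dir t)) \<preceq> 1" using pd[OF False] \<nu> unfolding \<Lambda>_def by blast
    then have "pairing (P (dir t)) (P \<nu>) \<preceq> 1" by (simp only: pairing_commute)
    then have "pairing (P (dir t)) (P (dir t)) \<preceq> 1" using par \<nu> unfolding \<Lambda>_def by blast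
    moreover have "pairing (P (dir t)) (P \<mu>) \<preceq> 1"
      using that False unfolding M_def by (simp add: pairing_commute)
    ultimately show ?thesis using dep dir_nz by blast
  qed
  have "pairing 0 v = 0" for v :: "'a quadratic"
    by (cases v) (simp add: pairing_def zero_prod_def)
  then have M0: "0 \<in> M t" for t
    by (simp add: M_def integral_on_zero)
  have M_diff: "x - y \<in> M t" if "x \<in> M t" "y \<in> M t" for t x y
  proof (cases "\<Lambda> t = {}")
    case True
    then show ?thesis using that integral_on_diff unfolding M_def by simp
  next
    case False
    then show ?thesis using that diff unfolding M_def by (simp add: pairing_diff)
  qed
  define c d :: "'a \<times> 'a \<Rightarrow> real" where "c = (\<lambda>t. - of_int (snd (dir t)))" and "d = (\<lambda>t. of_int (fst (dir t)))"
  define N where "N = (\<lambda>t. (c t)\<^sup>2 + (d t)\<^sup>2)"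
  define Q where "Q = (\<lambda>t f. quasiperiodic n f (c t) (d t) \<and> (\<forall>x y. \<theta> y - \<theta> x \<in> M t \<longrightarrow> f x = f y))"
  define F where "F = (\<lambda>t. SOME f. Q t f)"
  define G where "G = (\<lambda>t (i, j). - (d t / N t) * (real i / real n) + c t / N t * (real j / real n))"
  have "\<exists>f. Q t f" for t
    unfolding Q_def
  proof (rule equivariant_function[OF \<theta> M0 M_diff])
    fix k l assume "period a b (k, l) \<in> M t"
    then have "det (dir t) (k, l) = 0" using M_char unfolding P_def by blast
    then have "real_of_int (det (dir t) (k, l)) = 0" by simp
    then show "real_of_int k * c t + real_of_int l * d t = 0"
      by (simp add: det_def c_def d_def algebra_simps)
  qed
  then have QF: "Q t (F t)" for t unfolding F_def by (rule someI_ex)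
  have N: "N t \<noteq> 0" for t
    using dir_nz[of t] by (auto simp: N_def c_def d_def zero_prod_def prod_eq_iff sum_power2_eq_zero_iff)
  have "(\<Sum>t\<in>triangles n. tri_area (F (\<tau> t)) (G (\<tau> t)) t) = 2"
  proof (rule area_of_colouring[where le = ball_le and M = "\<lambda>t. {v. integral_on t v}"
        and c = c and d = d and c' = "\<lambda>t. - (d t / N t)" and d' = "\<lambda>t. c t / N t" and \<theta> = \<theta>])
    define Z where "Z = fst ` \<tau> ` triangles n"
    \<comment> \<open>Centres and radii of all joins of the colours that occur.\<close>
    define W where "W = snd ` \<tau> ` triangles n \<union> (\<lambda>(x, y). y - x) ` (Z \<times> Z)"
    have fin: "finite (triangles n)" by (simp add: triangles_def)
    have "(0, 0, True) \<in> triangles n" using n by (simp add: triangles_def)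
    then show "finite (Z \<times> W)" "Z \<times> W \<noteq> {}" using fin unfolding Z_def W_def by auto
    show "\<tau> t \<in> Z \<times> W" if "t \<in> triangles n" for t
      using that unfolding Z_def W_def by (auto simp: mem_Times_iff)
    show "\<forall>x\<in>Z \<times> W. \<forall>y\<in>Z \<times> W. \<exists>z\<in>Z \<times> W. ball_le x z \<and> ball_le y z \<and>
        {v. integral_on x v} \<inter> {v. integral_on y v} \<subseteq> {v. integral_on z v}"
    proof (intro ballI)
      fix s t assume st: "s \<in> Z \<times> W" "t \<in> Z \<times> W"
      obtain x r y u where xy: "s = (x, r)" "t = (y, u)" by (metis prod.exhaust)
      obtain w where w: "w \<in> {r, u, y - x}" "ball_le s (x, w)" "ball_le t (x, w)"
        "\<And>P. integral_on s P \<Longrightarrow> integral_on t P \<Longrightarrow> integral_on (x, w) P"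
        using ball_join[OF xy] by blast
      have "y - x \<in> W" using st unfolding W_def xy by auto
      then have "(x, w) \<in> Z \<times> W" using st w(1) unfolding xy by auto
      then show "\<exists>z\<in>Z \<times> W. ball_le s z \<and> ball_le t z \<and>
        {v. integral_on s v} \<inter> {v. integral_on t v} \<subseteq> {v. integral_on z v}"
        using w by blast
    qed
    show "\<theta> y - \<theta> x \<in> {v. integral_on (\<tau> s) v} \<inter> {v. integral_on (\<tau> t) v}"
      if "shared_edge n s t x y" for s t x y
      using \<tau>[OF that] by blast
    show "0 < n" by (rule n)
    show "ball_le s s" for s by (rule ball_le_refl)
    show "ball_le s y" if "ball_le s x" "ball_le x y" for s x y using that by (rule ball_le_trans)
    show "ball_le x y \<or> ball_le y x" if "ball_le s x" "ball_le s y" for s x y using that by (rule ball_le_chain)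
    show "v \<in> {v. integral_on x v}" if "ball_le s x" "ball_le x y" "v \<in> {v. integral_on s v}" "v \<in> {v. integral_on y v}" for s x y v
      using integral_on_convex[OF that(1,2)] that(3,4) by blast
    show "quasiperiodic n (F t) (c t) (d t)" for t using QF[of t] unfolding Q_def by blast
    show "quasiperiodic n (G t) (- (d t / N t)) (c t / N t)" for t
      using n unfolding quasiperiodic_def G_def by (simp add: field_simps)
    show "c t * (c t / N t) - d t * - (d t / N t) = 1" for t
    proof -
      have "x * (x / z) - y * - (y / z) = (x\<^sup>2 + y\<^sup>2) / z" for x y z :: real
        by (simp add: power2_eq_square add_divide_distrib)
      then have "c t * (c t / N t) - d t * - (d t / N t) = ((c t)\<^sup>2 + (d t)\<^sup>2) / N t" .
      also have "(c t)\<^sup>2 + (d t)\<^sup>2 = N t" by (simp add: N_def)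
      finally show ?thesis using N[of t] by simp
    qed
    show "F t x = F t y" if "\<theta> y - \<theta> x \<in> {v. integral_on t v}" for t x y
      using QF[of t] int_M that unfolding Q_def by blast
    show "F s = F t \<and> G s = G t \<or> (\<exists>(p :: nat \<times> nat \<Rightarrow> real) (q :: nat \<times> nat \<Rightarrow> real).
        quasiperiodic n p 1 0 \<and> quasiperiodic n q 0 1 \<and>
        (\<forall>x y. \<theta> y - \<theta> x \<in> {v. integral_on s v} \<longrightarrow> \<theta> y - \<theta> x \<in> {v. integral_on t v} \<longrightarrow>
          p x = p y \<and> q x = q y))" for s t
    proof (cases "\<Lambda> s \<inter> \<Lambda> t = {}")
      case False
      then obtain \<mu> where \<mu>: "\<mu> \<in> \<Lambda> s" "\<mu> \<in> \<Lambda> t" by blast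
      have "dirs z = {\<nu>. \<nu> \<noteq> 0 \<and> det \<mu> \<nu> = 0}" if "\<mu> \<in> \<Lambda> z" for z
      proof -
        have "det \<mu> \<nu> = 0" if \<kappa>: "\<kappa> \<in> \<Lambda> z" "det \<kappa> \<nu> = 0" for \<kappa> \<nu>
        proof -
          have "pairing (P \<mu>) (P \<mu>) \<preceq> 1" "pairing (P \<mu>) (P \<kappa>) \<preceq> 1"
            using integral_on_pairing \<open>\<mu> \<in> \<Lambda> z\<close> \<kappa>(1) unfolding \<Lambda>_def by blast+
          then have "det \<mu> \<kappa> = 0" using dep \<open>\<mu> \<in> \<Lambda> z\<close> unfolding \<Lambda>_def by blast
          moreover have "fst \<kappa> * det \<mu> \<nu> = fst \<mu> * det \<kappa> \<nu> + fst \<nu> * det \<mu> \<kappa>"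
            "snd \<kappa> * det \<mu> \<nu> = snd \<mu> * det \<kappa> \<nu> + snd \<nu> * det \<mu> \<kappa>"
            by (simp_all add: det_def algebra_simps)
          moreover have "fst \<kappa> \<noteq> 0 \<or> snd \<kappa> \<noteq> 0"
            using \<kappa>(1) unfolding \<Lambda>_def by (auto simp: zero_prod_def prod_eq_iff)
          ultimately show ?thesis using \<kappa>(2) by auto
        qed
        then show ?thesis using that unfolding dirs_def by blast
      qed
      then have "dirs s = dirs t" using \<mu> by simp
      moreover have ne: "\<Lambda> s \<noteq> {}" "\<Lambda> t \<noteq> {}" using \<mu> by blast+
      ultimately have dir: "dir s = dir t" unfolding dir_def by simp
      then have "M s = M t" unfolding M_def using ne by simp
      then have "F s = F t" "G s = G t"
        unfolding F_def G_def Q_def N_def c_def d_def dir by simp_all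
      then show ?thesis by blast
    next
      case True
      define I where "I = {v. integral_on s v \<and> integral_on t v}"
      have I: "0 \<in> I" "\<And>x y. x \<in> I \<Longrightarrow> y \<in> I \<Longrightarrow> x - y \<in> I"
        unfolding I_def using integral_on_zero integral_on_diff by blast+
      have zero: "k = 0 \<and> l = 0" if "period a b (k, l) \<in> I" for k l
        using True that unfolding I_def \<Lambda>_def P_def by (auto simp: zero_prod_def)
      obtain p :: "nat \<times> nat \<Rightarrow> real" where "quasiperiodic n p 1 0" "\<forall>x y. \<theta> y - \<theta> x \<in> I \<longrightarrow> p x = p y"
        using equivariant_function[OF \<theta> I, of 1 0] zero by auto
      moreover obtain q :: "nat \<times> nat \<Rightarrow> real" where "quasiperiodic n q 0 1" "\<forall>x y. \<theta> y - \<theta> x \<in> I \<longrightarrow> q x = q y"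
        using equivariant_function[OF \<theta> I, of 0 1] zero by auto
      ultimately show ?thesis unfolding I_def by blast
    qed
  qed
  moreover have "tri_area (F (\<tau> t)) (G (\<tau> t)) t = 0" if tri: "t \<in> triangles n" for t
  proof -
    obtain i j b where t: "t = (i, j, b)" "i < n" "j < n" using tri by (auto simp: triangles_def)
    have F: "F z x = F z y" if "integral_on z (\<theta> y - \<theta> x)" for z x y
      using QF[of z] int_M[OF that] unfolding Q_def by blast
    show ?thesis
    proof (cases b)
      case True
      have "F (\<tau> (i, j, True)) (i, j) = F (\<tau> (i, j, True)) (Suc i, Suc j)"
        using \<tau>[OF diagonal[OF t(2,3)]] by (intro F) blast
      moreover have "F (\<tau> (i, j, True)) (i, j) = F (\<tau> (i, j, True)) (Suc i, j)"
        by (intro F \<tau>_lower t)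
      ultimately show ?thesis by (simp add: t(1) True)
    next
      case False
      have "F (\<tau> (i, j, False)) (i, j) = F (\<tau> (i, j, False)) (Suc i, Suc j)"
        using \<tau>[OF diagonal[OF t(2,3)]] by (intro F) blast
      moreover have "F (\<tau> (i, j, False)) (i, j) = F (\<tau> (i, j, False)) (i, Suc j)"
        by (intro F \<tau>_upper t)
      ultimately show ?thesis by (simp add: t(1) False)
    qed
  qed
  ultimately show False by simp
qed

text \<open>Only edges that start in the fundamental square are assumed to be finite; periodicity provides the others. The
colours come from the triangle lemma.\<close>

theorem bounded_period_of_bounded_edges:
  fixes \<theta> :: "nat \<times> nat \<Rightarrow> 'a quadratic"
  assumes n: "0 < n" and \<theta>: "quasiperiodic n \<theta> a b"
    and edges: "\<And>i j i' j'. i < n \<Longrightarrow> j < n \<Longrightarrow> (i', j') \<in> {(Suc i, j), (i, Suc j), (Suc i, Suc j)} \<Longrightarrow>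
        pairing (\<theta> (i', j') - \<theta> (i, j)) (\<theta> (i', j') - \<theta> (i, j)) \<preceq> 1"
  shows "\<exists>\<mu>. bounded_period a b \<mu>"
proof -
  define e where "e = (\<lambda>p q. \<theta> q - \<theta> p)"
  have per: "e (i, Suc j) (Suc i, Suc j) = e (i, Suc j mod n) (Suc i, Suc j mod n)"
    "e (Suc j, i) (Suc j, Suc i) = e (Suc j mod n, i) (Suc j mod n, Suc i)" if "i < n" "j < n" for i j
    using that \<theta> unfolding e_def quasiperiodic_def by (cases "Suc j = n"; simp)+
  have common: "\<exists>t. integral_on t u \<and> integral_on t v \<and> integral_on t (u + v)"
    if "pairing u u \<preceq> 1" "pairing v v \<preceq> 1" "pairing (u + v) (u + v) \<preceq> 1" for u v
  proof -
    have "pairing (u + v) (u + v) - pairing u u - pairing v v = 2 * pairing u v"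
      using pairing_add[of u v "u + v"] pairing_add[of u v u] pairing_add[of u v v]
      by (simp add: pairing_commute)
    then have "2 * pairing u v \<preceq> 1" using diff[OF diff[OF that(3,1)] that(2)] by simp
    then show ?thesis using common_ball[OF that(1,2)] two_cancel integral_on_add by metis
  qed
  define ok where "ok = (\<lambda>z t. case t of (i, j, b) \<Rightarrow> integral_on z (e (i, j) (Suc i, Suc j)) \<and>
    (if b then integral_on z (e (i, j) (Suc i, j)) \<and> integral_on z (e (Suc i, j) (Suc i, Suc j))
     else integral_on z (e (i, j) (i, Suc j)) \<and> integral_on z (e (i, Suc j) (Suc i, Suc j))))"
  have "\<exists>z. ok z t" if tri: "t \<in> triangles n" for t
  proof -
    obtain i j b where t: "t = (i, j, b)" "i < n" "j < n" using tri by (auto simp: triangles_def)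
    have m: "Suc i mod n < n" "Suc j mod n < n" using n by simp_all
    have E: "pairing (e (i, j) (i', j')) (e (i, j) (i', j')) \<preceq> 1"
      if "i < n" "j < n" "(i', j') \<in> {(Suc i, j), (i, Suc j), (Suc i, Suc j)}" for i j i' j'
      unfolding e_def by (rule edges[OF that])
    have sum1: "e (i, j) (Suc i, j) + e (Suc i, j) (Suc i, Suc j) = e (i, j) (Suc i, Suc j)"
      and sum2: "e (i, j) (i, Suc j) + e (i, Suc j) (Suc i, Suc j) = e (i, j) (Suc i, Suc j)"
      by (simp_all add: e_def)
    show ?thesis
    proof (cases b)
      case True
      have "pairing (e (Suc i, j) (Suc i, Suc j)) (e (Suc i, j) (Suc i, Suc j)) \<preceq> 1"
        unfolding per(2)[OF t(3,2)] by (rule E) (use m t in auto)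
      then show ?thesis
        using common[of "e (i, j) (Suc i, j)" "e (Suc i, j) (Suc i, Suc j)"]
          E[of i j "Suc i" j] E[of i j "Suc i" "Suc j"] t(2,3)
        unfolding sum1 t(1) ok_def by (auto simp: True)
    next
      case False
      have "pairing (e (i, Suc j) (Suc i, Suc j)) (e (i, Suc j) (Suc i, Suc j)) \<preceq> 1"
        unfolding per(1)[OF t(2,3)] by (rule E) (use m t in auto)
      then show ?thesis
        using common[of "e (i, j) (i, Suc j)" "e (i, Suc j) (Suc i, Suc j)"]
          E[of i j i "Suc j"] E[of i j "Suc i" "Suc j"] t(2,3)
        unfolding sum2 t(1) ok_def by (auto simp: False)
    qed
  qed
  then obtain \<tau> where \<tau>: "\<And>t. t \<in> triangles n \<Longrightarrow> ok (\<tau> t) t" by metis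
  have tri: "(i, j, c) \<in> triangles n" if "i < n" "j < n" for i j c
    using that by (simp add: triangles_def)
  show ?thesis
  proof (rule bounded_period_of_integral_triangles[OF n \<theta>, of \<tau>])
    show "integral_on (\<tau> s) (\<theta> y - \<theta> x) \<and> integral_on (\<tau> t) (\<theta> y - \<theta> x)"
      if "shared_edge n s t x y" for s t x y
      using that
    proof cases
      case (diagonal i j)
      then show ?thesis using \<tau>[OF tri[of i j True]] \<tau>[OF tri[of i j False]]
        by (simp add: ok_def e_def)
    next
      case (vertical i j)
      then have "Suc i mod n < n" using n by simp
      then show ?thesis
        using vertical \<tau>[OF tri[of i j True]] \<tau>[OF tri[of "Suc i mod n" j False]] per(2)[of j i]
        by (simp add: ok_def) (simp add: e_def)
    next
      case (horizontal i j)
      then have "Suc j mod n < n" using n by simp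
      then show ?thesis
        using horizontal \<tau>[OF tri[of i j False]] \<tau>[OF tri[of i "Suc j mod n" True]] per(1)[of i j]
        by (simp add: ok_def) (simp add: e_def)
    qed
    show "integral_on (\<tau> (i, j, True)) (\<theta> (Suc i, j) - \<theta> (i, j))"
      "integral_on (\<tau> (i, j, False)) (\<theta> (i, Suc j) - \<theta> (i, j))" if "i < n" "j < n" for i j
      using \<tau>[OF tri[OF that, of True]] \<tau>[OF tri[OF that, of False]] by (simp_all add: ok_def e_def)
  qed
qed

end

section \<open>Integrality of the Gram entries over the trace\<close>

text \<open>In a field this says that \<open>x / z \<in> C\<close>. The present form needs no division and has the right meaning modulo the
support.\<close>

definition dominated :: "('i \<Rightarrow> 'k::field) set \<Rightarrow> ('i \<Rightarrow> 'k) \<Rightarrow> ('i \<Rightarrow> 'k) \<Rightarrow> bool" where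
  "dominated C x z \<longleftrightarrow> (\<forall>w. w * z \<in> C \<longrightarrow> w * x \<in> C)"

lemma support_indicator_in_valuation_ring: "valuation_ring C \<Longrightarrow> support_indicator f \<in> C"
proof -
  have "pinverse (support_indicator f) = support_indicator f" by (auto simp: pinverse_def support_indicator_def)
  then show "valuation_ring C \<Longrightarrow> support_indicator f \<in> C" by (metis valuation_ring_def)
qed

text \<open>Either the functions living on the support of \<open>f\<close> or those living on its complement are all in \<open>C\<close>.
If \<open>z\<close> on one part and \<open>w\<close> on the other were both outside \<open>C\<close>, then a function that equals \<open>z\<close> on
one part and \<open>1 / w\<close> on the other would be excluded together with its inverse.\<close>

lemma valuation_ring_concentrated:
  assumes C: "valuation_ring C"
  shows "(\<forall>z. support_indicator f * z \<in> C) \<or> (\<forall>w. (1 - support_indicator f) * w \<in> C)"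
proof (rule ccontr)
  assume "\<not> ?thesis"
  then obtain z w where zw: "support_indicator f * z \<notin> C" "(1 - support_indicator f) * w \<notin> C" by blast
  define g where "g = support_indicator f * z + (1 - support_indicator f) * pinverse w"
  have sub: "is_subring C" using C by (simp add: valuation_ring_def)
  have eC: "support_indicator f \<in> C" "1 - support_indicator f \<in> C"
    using support_indicator_in_valuation_ring[OF C] is_subringD[OF sub] by blast+
  have "support_indicator f * g = support_indicator f * z" "(1 - support_indicator f) * pinverse g = (1 - support_indicator f) * w"
    by (auto simp: g_def fun_eq_iff support_indicator_def pinverse_def)
  then show False
    using zw C eC is_subringD(4)[OF sub] unfolding valuation_ring_def by metis
qed

lemma of_int_fun: "(of_int k :: 'i \<Rightarrow> 'k::ring_1) = (\<lambda>_. of_int k)"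
proof -
  have n: "(of_nat n :: 'i \<Rightarrow> 'k) = (\<lambda>_. of_nat n)" for n
    by (induction n) (auto simp: fun_eq_iff)
  show ?thesis by (cases k) (simp_all add: n fun_eq_iff)
qed

lemma dominance_valuation_ring:
  fixes C :: "('i \<Rightarrow> 'k::field_char_0) set"
  assumes C: "valuation_ring C" and const: "\<And>c. (\<lambda>_. c) \<in> C"
  shows "dominance (dominated C)"
proof
  have sub: "is_subring C" using C by (simp add: valuation_ring_def)
  note s = is_subringD[OF sub]
  show "dominated C x x" for x by (simp add: dominated_def)
  show "dominated C x z" if "dominated C x y" "dominated C y z" for x y z
    using that by (simp add: dominated_def)
  show "dominated C 0 x" for x by (simp add: dominated_def s)
  show "dominated C (x + y) z" if "dominated C x z" "dominated C y z" for x y z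
    using that by (simp add: dominated_def distrib_left s)
  show "dominated C (x * z) (y * z)" if "dominated C x y" for x y z
    unfolding dominated_def
  proof (intro allI impI)
    fix w assume "w * (y * z) \<in> C"
    then have "(w * z) * y \<in> C" by (simp add: mult_ac)
    then have "(w * z) * x \<in> C" using that unfolding dominated_def by blast
    then show "w * (x * z) \<in> C" by (simp add: mult_ac)
  qed
  show "dominated C x y \<or> dominated C y x" for x y
  proof (rule ccontr)
    assume "\<not> (dominated C x y \<or> dominated C y x)"
    then obtain w u where w: "w * y \<in> C" "w * x \<notin> C" and u: "u * x \<in> C" "u * y \<notin> C"
      unfolding dominated_def by blast
    define e where "e = support_indicator (u * y)"
    have "pinverse (u * y) \<in> C" using C u(2) unfolding valuation_ring_def by blast
    then have "((w * y) * (u * x)) * pinverse (u * y) \<in> C" by (intro s w u)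
    also have "((w * y) * (u * x)) * pinverse (u * y) = (w * x) * ((u * y) * pinverse (u * y))"
      by (simp only: mult_ac)
    also have "\<dots> = e * (w * x)" by (simp only: mult_pinverse e_def mult.commute)
    finally have "e * (w * x) \<in> C" .
    then have "(1 - e) * (w * x) \<notin> C"
      using s(5)[of "e * (w * x)" "(1 - e) * (w * x)"] w(2) by (auto simp: left_diff_distrib)
    then have "e * (u * y) \<in> C"
      using valuation_ring_concentrated[OF C, of "u * y"] unfolding e_def by blast
    then show False using u(2) by (simp only: e_def support_indicator_mult)
  qed
  show "\<exists>y. dominated C (x * y - 1) 0" if nz: "\<not> dominated C x 0" for x
  proof (intro exI[of _ "pinverse x"])
    obtain w where "w * x \<notin> C" using nz unfolding dominated_def by blast
    then have "support_indicator x * (w * x) \<notin> C" by (metis mult.left_commute support_indicator_mult(1))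
    then have "(1 - support_indicator x) * v \<in> C" for v
      using valuation_ring_concentrated[OF C, of x] by blast
    then have "- ((1 - support_indicator x) * v) \<in> C" for v by (rule s)
    then show "dominated C (x * pinverse x - 1) 0"
      unfolding dominated_def mult_pinverse by (simp add: algebra_simps)
  qed
  show "\<exists>y. of_int k * y = 1 \<and> dominated C y 1" if "k \<noteq> 0" for k
  proof (intro exI conjI)
    show "of_int k * (\<lambda>_. inverse (of_int k)) = (1 :: 'i \<Rightarrow> 'k)"
      using that by (simp add: of_int_fun fun_eq_iff)
    show "dominated C (\<lambda>_. inverse (of_int k)) 1"
      unfolding dominated_def using const s(4) by auto
  qed
qed

lemma dominated_one: "is_subring C \<Longrightarrow> dominated C x 1 \<longleftrightarrow> x \<in> C"
  unfolding dominated_def using is_subringD(1,4)[of C] by (metis mult.commute mult_1_left)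

text \<open>An isometry from complexified Euclidean space to quadratic polynomials:
\<open>B\<^sup>2 - 4 A C = x\<^sup>2 + (y + i z) (y - i z)\<close>.\<close>

definition quadratic_of :: "('i \<Rightarrow> real ^ 3) \<Rightarrow> ('i \<Rightarrow> complex) quadratic" where
  "quadratic_of v = (\<lambda>i. - (of_real (v i $ 2) + \<i> * of_real (v i $ 3)) / 2,
     \<lambda>i. of_real (v i $ 1), \<lambda>i. (of_real (v i $ 2) - \<i> * of_real (v i $ 3)) / 2)"

lemma quadratic_of_diff: "quadratic_of (\<lambda>i. v i - w i) = quadratic_of v - quadratic_of w"
  and quadratic_of_add: "quadratic_of (\<lambda>i. v i + w i) = quadratic_of v + quadratic_of w"
  by (simp_all add: quadratic_of_def fun_eq_iff field_simps)

lemma pairing_quadratic_of: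
  "pairing (quadratic_of v) (quadratic_of w) = (\<lambda>i. of_real (v i \<bullet> w i))"
proof
  fix i
  have two: "(2 :: 'a \<Rightarrow> complex) i = 2"
    using fun_cong[OF of_int_fun[of 2, where 'i = 'a and 'k = complex], of i] by simp
  show "pairing (quadratic_of v) (quadratic_of w) i = of_real (v i \<bullet> w i)"
    by (simp add: pairing_def quadratic_of_def two inner_vec_def sum_3 complex_eq_iff field_simps)
qed

text \<open>The bounded period makes \<open>k g\<^sub>1\<^sub>1 + l g\<^sub>1\<^sub>2\<close> and \<open>k g\<^sub>1\<^sub>2 + l g\<^sub>2\<^sub>2\<close> finite, and the trace \<open>g\<^sub>1\<^sub>1 + g\<^sub>2\<^sub>2\<close> is finite by
assumption. These three linear forms determine the Gram entries: their determinant is \<open>k\<^sup>2 + l\<^sup>2\<close>.\<close>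

lemma gram_entries_in_valuation_ring:
  fixes C :: "('i \<Rightarrow> complex) set" and X :: "'i \<Rightarrow> nat \<times> nat \<Rightarrow> real ^ 3" and A B :: "'i \<Rightarrow> real ^ 3"
  assumes C: "valuation_ring C" and const: "\<And>c. (\<lambda>_. c) \<in> C"
    and n: "0 < n" and X: "\<And>i. quasiperiodic n (X i) (A i) (B i)"
    and edges: "\<And>k x y x' y'. x < n \<Longrightarrow> y < n \<Longrightarrow> (x', y') \<in> {(Suc x, y), (x, Suc y), (Suc x, Suc y)} \<Longrightarrow>
        (norm (X k (x', y') - X k (x, y)))\<^sup>2 = L (x, y) (x', y')"
    and tr: "(\<lambda>i. of_real (A i \<bullet> A i + B i \<bullet> B i)) \<in> C"
  shows "(\<lambda>i. of_real (A i \<bullet> A i)) \<in> C" "(\<lambda>i. of_real (A i \<bullet> B i)) \<in> C" "(\<lambda>i. of_real (B i \<bullet> B i)) \<in> C"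
proof -
  interpret dominance "dominated C" by (rule dominance_valuation_ring[OF C const])
  have sub: "is_subring C" using C by (simp add: valuation_ring_def)
  note one = dominated_one[OF sub]
  define \<theta> where "\<theta> = (\<lambda>p. quadratic_of (\<lambda>i. X i p))"
  define a b where "a = quadratic_of A" and "b = quadratic_of B"
  have "quasiperiodic n \<theta> a b"
    using X unfolding quasiperiodic_def \<theta>_def a_def b_def
    by (simp flip: quadratic_of_add)
  moreover have "dominated C (pairing (\<theta> (x', y') - \<theta> (x, y)) (\<theta> (x', y') - \<theta> (x, y))) 1"
    if "x < n" "y < n" "(x', y') \<in> {(Suc x, y), (x, Suc y), (Suc x, Suc y)}" for x y x' y'
  proof -
    have "pairing (\<theta> (x', y') - \<theta> (x, y)) (\<theta> (x', y') - \<theta> (x, y)) = (\<lambda>_. of_real (L (x, y) (x', y')))"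
      unfolding \<theta>_def quadratic_of_diff[symmetric] pairing_quadratic_of
      by (simp only: dot_square_norm edges[OF that])
    then show ?thesis using const one by simp
  qed
  ultimately obtain \<mu> where "bounded_period a b \<mu>"
    using bounded_period_of_bounded_edges[OF n] by blast
  then obtain k l where kl: "(k, l) \<noteq> 0"
    "dominated C (pairing (period a b (k, l)) a) 1" "dominated C (pairing (period a b (k, l)) b) 1"
    unfolding bounded_period_def by (metis prod.exhaust)
  define g11 g12 g22 where "g11 = pairing a a" and "g12 = pairing a b" and "g22 = pairing b b"
  have g: "g11 = (\<lambda>i. of_real (A i \<bullet> A i))" "g12 = (\<lambda>i. of_real (A i \<bullet> B i))" "g22 = (\<lambda>i. of_real (B i \<bullet> B i))"
    by (simp_all add: g11_def g12_def g22_def a_def b_def pairing_quadratic_of)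
  have "pairing b a = g12" by (simp only: g12_def pairing_commute)
  then have 1: "dominated C (of_int k * g11 + of_int l * g12) 1" "dominated C (of_int k * g12 + of_int l * g22) 1"
    using kl by (simp_all add: pairing_period g11_def g12_def g22_def)
  have h: "dominated C (g11 + g22) 1"
    using tr unfolding one g by (simp add: plus_fun_def)
  have "of_int (k * k + l * l) * g11 = of_int k * (of_int k * g11 + of_int l * g12)
      - of_int l * (of_int k * g12 + of_int l * g22) + of_int (l * l) * (g11 + g22)"
    by (simp add: algebra_simps)
  moreover have "dominated C \<dots> 1" by (intro add diff int_mult 1 h)
  moreover have kl2: "k * k + l * l \<noteq> 0" using kl(1) by (simp add: zero_prod_def sum_squares_eq_zero_iff)
  ultimately have g11: "dominated C g11 1" using int_cancel by metis
  have g22: "dominated C g22 1" using diff[OF h g11] by simp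
  have g12: "dominated C g12 1"
  proof (cases "k = 0")
    case False
    have "dominated C (of_int k * g12) 1"
      using diff[OF 1(2) int_mult[OF g22, of l]] by simp
    then show ?thesis using int_cancel False by blast
  next
    case True
    then have "l \<noteq> 0" using kl2 by simp
    moreover have "dominated C (of_int l * g12) 1" using 1(1) True by simp
    ultimately show ?thesis using int_cancel by blast
  qed
  show "(\<lambda>i. of_real (A i \<bullet> A i)) \<in> C" "(\<lambda>i. of_real (A i \<bullet> B i)) \<in> C" "(\<lambda>i. of_real (B i \<bullet> B i)) \<in> C"
    using g11 g12 g22 unfolding one g by blast+
qed

lemma polynomial_in_subring:
  fixes v :: "'i \<Rightarrow> real ^ 3"
  assumes sub: "is_subring C" and const: "\<And>c :: complex. (\<lambda>_. c) \<in> C"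
    and v: "\<And>m. (\<lambda>i. of_real (v i $ m)) \<in> C" and p: "real_polynomial_function p"
  shows "(\<lambda>i. of_real (p (v i))) \<in> C"
  using p
proof induction
  case (linear f)
  have "(\<lambda>i. of_real (f (v i))) = (\<Sum>m\<in>UNIV. (\<lambda>i. of_real (v i $ m)) * (\<lambda>_. complex_of_real (f (axis m 1))))"
  proof
    fix i
    have sumi: "(sum g M) i = (\<Sum>k\<in>M. g k i)" for g :: "3 \<Rightarrow> 'i \<Rightarrow> complex" and M
      by (induction M rule: infinite_finite_induct) auto
    have lin: "linear f" by (rule bounded_linear.linear[OF linear])
    have "f (v i) = f (\<Sum>m\<in>UNIV. v i $ m *\<^sub>R axis m 1)"
      using basis_expansion[of "v i"] by (simp add: scalar_mult_eq_scaleR)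
    also have "\<dots> = (\<Sum>m\<in>UNIV. v i $ m * f (axis m 1))"
      by (simp add: linear_sum[OF lin] linear_cmul[OF lin])
    finally have "f (v i) = (\<Sum>m\<in>UNIV. v i $ m * f (axis m 1))" .
    then show "of_real (f (v i)) = (\<Sum>m\<in>UNIV. (\<lambda>i. of_real (v i $ m)) * (\<lambda>_. complex_of_real (f (axis m 1)))) i"
      by (simp add: sumi)
  qed
  moreover have "(\<Sum>m\<in>UNIV. (\<lambda>i. of_real (v i $ m)) * (\<lambda>_. complex_of_real (f (axis m 1)))) \<in> C"
    by (intro is_subring_sum[OF sub] is_subringD(4)[OF sub] v const)
  ultimately show ?case by (simp only:)
next
  case (add f g)
  then show ?case using is_subringD(5)[OF sub, OF add.IH] by (simp add: plus_fun_def)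
next
  case (mult f g)
  then show ?case using is_subringD(4)[OF sub, OF mult.IH] by (simp add: times_fun_def)
qed (rule const)

lemma poly_Re: "poly (map_poly Re P) x = Re (poly P (of_real x))"
  by (induction P) (simp_all add: map_poly_pCons)

lemma is_subring_polynomials:
  fixes h :: "'i \<Rightarrow> complex"
  shows "is_subring {\<lambda>i. poly P (h i) | P. True}"
  unfolding is_subring_def
proof (intro conjI ballI)
  show "1 \<in> {\<lambda>i. poly P (h i) | P. True}"
    by (intro CollectI exI[of _ 1]) (simp add: fun_eq_iff)
  fix u v assume "u \<in> {\<lambda>i. poly P (h i) | P. True}" "v \<in> {\<lambda>i. poly P (h i) | P. True}"
  then obtain P Q where PQ: "u = (\<lambda>i. poly P (h i))" "v = (\<lambda>i. poly Q (h i))" by blast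
  show "u - v \<in> {\<lambda>i. poly P (h i) | P. True}"
    by (intro CollectI exI[of _ "P - Q"]) (simp add: PQ fun_eq_iff)
  show "u * v \<in> {\<lambda>i. poly P (h i) | P. True}"
    by (intro CollectI exI[of _ "P * Q"]) (simp add: PQ fun_eq_iff)
qed

text \<open>The index \<open>i\<close> runs over the surfaces, while \<open>L\<close> and the exponents and coefficients of the relation do not
depend on it. The valuative criterion gives complex coefficients; taking real parts keeps the relation monic.\<close>

theorem gram_integral_over_trace:
  fixes X :: "'i \<Rightarrow> nat \<times> nat \<Rightarrow> real ^ 3" and A B :: "'i \<Rightarrow> real ^ 3"
  assumes n: "0 < n" and X: "\<And>i. quasiperiodic n (X i) (A i) (B i)"
    and edges: "\<And>k x y x' y'. x < n \<Longrightarrow> y < n \<Longrightarrow> (x', y') \<in> {(Suc x, y), (x, Suc y), (Suc x, Suc y)} \<Longrightarrow>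
        (norm (X k (x', y') - X k (x, y)))\<^sup>2 = L (x, y) (x', y')"
    and p: "real_polynomial_function p"
  defines "gram \<equiv> \<lambda>i. vector [A i \<bullet> A i, A i \<bullet> B i, B i \<bullet> B i] :: real ^ 3"
  shows "\<exists>m (c :: nat \<Rightarrow> real poly). \<forall>i.
    p (gram i) ^ m = (\<Sum>k<m. poly (c k) (gram i $ 1 + gram i $ 3) * p (gram i) ^ k)"
proof -
  define h where "h = (\<lambda>i. gram i $ 1 + gram i $ 3)"
  define R where "R = {\<lambda>i. poly P (complex_of_real (h i)) | P. True}"
  have hR: "(\<lambda>i. complex_of_real (h i)) \<in> R"
    unfolding R_def by (intro CollectI exI[of _ "[:0, 1:]"]) simp
  have constR: "(\<lambda>_. c) \<in> R" for c
    unfolding R_def by (intro CollectI exI[of _ "[:c:]"]) simp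
  have "(\<lambda>i. of_real (p (gram i))) \<in> C" if C: "valuation_ring C" "R \<subseteq> C" for C
  proof (rule polynomial_in_subring[OF _ _ _ p])
    show "is_subring C" using C by (simp add: valuation_ring_def)
    show const: "(\<lambda>_. c) \<in> C" for c using constR C by blast
    have tr: "(\<lambda>i. of_real (A i \<bullet> A i + B i \<bullet> B i)) \<in> C"
      using hR C(2) unfolding h_def gram_def by auto
    note * = gram_entries_in_valuation_ring[OF C(1) const n X edges tr]
    show "(\<lambda>i. of_real (gram i $ m)) \<in> C" for m
      using * exhaust_3[of m] unfolding gram_def by auto
  qed
  then obtain m c where c: "\<And>k. c k \<in> R"
    and eq: "(\<lambda>i. complex_of_real (p (gram i))) ^ m = (\<Sum>k<m. c k * (\<lambda>i. of_real (p (gram i))) ^ k)"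
    using valuative_criterion[OF is_subring_polynomials[of "\<lambda>i. complex_of_real (h i)", folded R_def],
        of "\<lambda>i. complex_of_real (p (gram i))"] by blast
  have "\<exists>P. \<forall>i. c k i = poly P (complex_of_real (h i))" for k
    using c[of k] unfolding R_def by auto
  then obtain P where P: "\<And>k i. c k i = poly (P k) (complex_of_real (h i))" by metis
  have "p (gram i) ^ m = (\<Sum>k<m. poly (map_poly Re (P k)) (h i) * p (gram i) ^ k)" for i
  proof -
    have powi: "(f ^ k) i = f i ^ k" for f :: "'i \<Rightarrow> complex" and k
      by (induction k) auto
    have sumi: "(sum f M) i = (\<Sum>k\<in>M. f k i)" for f :: "nat \<Rightarrow> 'i \<Rightarrow> complex" and M
      by (induction M rule: infinite_finite_induct) auto
    have "complex_of_real (p (gram i) ^ m) =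
        (\<Sum>k<m. poly (P k) (of_real (h i)) * of_real (p (gram i) ^ k))"
      using fun_cong[OF eq, of i] by (simp add: powi sumi P)
    then have "p (gram i) ^ m = Re (\<Sum>k<m. poly (P k) (of_real (h i)) * of_real (p (gram i) ^ k))"
      by (metis Re_complex_of_real)
    then show ?thesis by (simp add: poly_Re)
  qed
  then show ?thesis unfolding h_def by (intro exI[of _ m] exI[of _ "\<lambda>k. map_poly Re (P k)"]) simp
qed

section \<open>Grids of vertices in a triangulated plane\<close>

lemma topspace_realization [simp]: "topspace (realization_topology K) = realization K"
proof -
  have "realization K \<inter> realized_simplex \<sigma> = realized_simplex \<sigma>" if "\<sigma> \<in> K" for \<sigma>
    using that unfolding realization_def by blast
  then have "openin (realization_topology K) (realization K)"
    unfolding openin_realization_topology by simp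
  then have "realization K \<subseteq> topspace (realization_topology K)"
    by (rule openin_subset)
  moreover have "topspace (realization_topology K) \<subseteq> realization K"
    using openin_topspace[of "realization_topology K"] unfolding openin_realization_topology by blast
  ultimately show ?thesis by (rule subset_antisym[rotated])
qed

definition open_star :: "'v set set \<Rightarrow> 'v \<Rightarrow> ('v \<Rightarrow> real) set" where
  "open_star K v = {x \<in> realization K. 0 < x v}"

lemma openin_open_star: "openin (realization_topology K) (open_star K v)"
proof -
  have "openin (top_of_set (realized_simplex \<sigma>)) (open_star K v \<inter> realized_simplex \<sigma>)" if "\<sigma> \<in> K" for \<sigma>
  proof -
    have "open {x :: 'a \<Rightarrow> real. 0 < x v}"
      by (intro open_Collect_less continuous_on_const continuous_on_product_coordinates)
    moreover have "open_star K v \<inter> realized_simplex \<sigma> = realized_simplex \<sigma> \<inter> {x. 0 < x v}"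
      using that unfolding open_star_def realization_def by blast
    ultimately show ?thesis by (auto simp: openin_open)
  qed
  then show ?thesis
    unfolding openin_realization_topology by (auto simp: open_star_def)
qed

lemma abstract_complex_face:
  assumes "abstract_complex K" "\<sigma> \<in> K" "\<tau> \<subseteq> \<sigma>" "\<tau> \<noteq> {}"
  shows "\<tau> \<in> K"
proof -
  have "\<forall>\<tau>. \<tau> \<subseteq> \<sigma> \<and> \<tau> \<noteq> {} \<longrightarrow> \<tau> \<in> K"
    using assms(1,2) unfolding abstract_complex_def by (elim conjE) (drule (1) bspec)
  then show ?thesis using assms(3,4) by simp
qed

lemma realizationE:
  assumes "abstract_complex K" "x \<in> realization K"
  obtains \<sigma> where "\<sigma> \<in> K" "finite \<sigma>" "x \<in> realized_simplex \<sigma>"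
  using assms unfolding realization_def abstract_complex_def by blast

lemma in_some_open_star:
  assumes "abstract_complex K" "x \<in> realization K"
  shows "\<exists>v. x \<in> open_star K v"
proof -
  obtain \<sigma> where \<sigma>: "finite \<sigma>" "x \<in> realized_simplex \<sigma>" using assms by (rule realizationE)
  then have "(\<Sum>v\<in>\<sigma>. x v) = 1" "\<And>v. 0 \<le> x v" unfolding realized_simplex_def by auto
  then obtain v where "x v \<noteq> 0" by (metis sum.neutral zero_neq_one)
  then have "0 < x v" using \<open>\<And>v. 0 \<le> x v\<close>[of v] by simp
  then show ?thesis using assms unfolding open_star_def by blast
qed

lemma support_subset_simplex:
  assumes "x \<in> realized_simplex \<sigma>" "0 < x v"
  shows "v \<in> \<sigma>"
proof (rule ccontr)
  assume "v \<notin> \<sigma>"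
  then have "x v = 0" using assms(1) by (simp add: realized_simplex_def)
  then show False using assms(2) by simp
qed

lemma open_stars_meet:
  assumes K: "abstract_complex K" and x: "x \<in> open_star K u" "x \<in> open_star K v"
  shows "u = v \<or> edge K u v"
proof -
  have "x \<in> realization K" "0 < x u" "0 < x v" using x by (simp_all add: open_star_def)
  then obtain \<sigma> where \<sigma>: "\<sigma> \<in> K" "x \<in> realized_simplex \<sigma>"
    using realizationE[OF K] by metis
  have "u \<in> \<sigma>" by (rule support_subset_simplex[OF \<sigma>(2) \<open>0 < x u\<close>])
  moreover have "v \<in> \<sigma>" by (rule support_subset_simplex[OF \<sigma>(2) \<open>0 < x v\<close>])
  ultimately have "{u, v} \<in> K" by (intro abstract_complex_face[OF K \<sigma>(1)]) auto
  then show ?thesis unfolding edge_def by blast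
qed

lemma open_star_vertex:
  assumes K: "abstract_complex K" and x: "x \<in> open_star K v"
  shows "{v} \<in> K"
proof -
  have "x \<in> realization K" "0 < x v" using x by (simp_all add: open_star_def)
  then obtain \<sigma> where \<sigma>: "\<sigma> \<in> K" "x \<in> realized_simplex \<sigma>"
    using realizationE[OF K] by metis
  have "v \<in> \<sigma>" by (rule support_subset_simplex[OF \<sigma>(2) \<open>0 < x v\<close>])
  then show ?thesis by (intro abstract_complex_face[OF K \<sigma>(1)]) auto
qed

lemma vertex_in_simplex:
  assumes "finite \<sigma>" "v \<in> \<sigma>"
  shows "vertex v \<in> realized_simplex \<sigma>"
proof -
  have "(\<Sum>u\<in>\<sigma>. vertex v u) = (\<Sum>u\<in>\<sigma>. if u = v then 1 else 0)"
    by (intro sum.cong) (auto simp: vertex_def)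
  then have "(\<Sum>u\<in>\<sigma>. vertex v u) = 1" using assms by simp
  moreover have "0 \<le> vertex v u" "u \<notin> \<sigma> \<Longrightarrow> vertex v u = 0" for u
    using assms(2) by (auto simp: vertex_def indicator_def)
  ultimately show ?thesis by (simp add: realized_simplex_def)
qed

lemma vertex_in_realization: "{v} \<in> K \<Longrightarrow> vertex v \<in> realization K"
  unfolding realization_def using vertex_in_simplex[of "{v}" v] by blast

lemma realized_simplex_single: "realized_simplex {v} = {vertex v}"
proof (intro equalityI subsetI)
  fix x assume "x \<in> realized_simplex {v}"
  then have "x = vertex v" by (auto simp: realized_simplex_def vertex_def fun_eq_iff indicator_def)
  then show "x \<in> {vertex v}" by simp
qed (use vertex_in_simplex[of "{v}" v] in auto)

lemma simplicial_vertex: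
  assumes K: "abstract_complex K" and f: "simplicial_mapping K K f" and v: "{v} \<in> K"
  shows "\<exists>w. {w} \<in> K \<and> f (vertex v) = vertex w"
proof -
  obtain \<tau> where \<tau>: "\<tau> \<in> K" "f ` realized_simplex {v} = realized_simplex \<tau>"
    using f v unfolding simplicial_mapping_def by blast
  have "finite \<tau>" "\<tau> \<noteq> {}" using \<tau>(1) K unfolding abstract_complex_def by auto
  then obtain w where w: "w \<in> \<tau>" "finite \<tau>" by blast
  then have "vertex w \<in> {f (vertex v)}"
    using \<tau>(2) vertex_in_simplex[OF w(2,1)] unfolding realized_simplex_single by blast
  moreover have "{w} \<in> K" using w by (intro abstract_complex_face[OF K \<tau>(1)]) auto
  ultimately show ?thesis by auto
qed

lemma simplicial_open_star:
  assumes K: "abstract_complex K" and f: "simplicial_mapping K K f"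
    and fK: "\<And>x. x \<in> realization K \<Longrightarrow> f x \<in> realization K"
    and w: "f (vertex v) = vertex w" and x: "x \<in> open_star K v"
  shows "f x \<in> open_star K w"
proof -
  have xv: "x \<in> realization K" "0 < x v" using x by (simp_all add: open_star_def)
  then obtain \<sigma> where \<sigma>: "\<sigma> \<in> K" "finite \<sigma>" "x \<in> realized_simplex \<sigma>"
    using realizationE[OF K] by metis
  have v: "v \<in> \<sigma>" "0 < x v" by (rule support_subset_simplex[OF \<sigma>(3) xv(2)], rule xv(2))
  have nonneg: "0 \<le> y u" if "y \<in> realization K" for y u
    using that by (auto simp: realization_def realized_simplex_def)
  have "f x w = (\<Sum>u\<in>\<sigma>. x u * f (vertex u) w)"
  proof -
    have "linear_on_simplex \<sigma> (\<lambda>x. f x w)" using f \<sigma>(1) by (simp add: simplicial_mapping_def)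
    then show ?thesis using \<sigma>(3) by (simp add: linear_on_simplex_def)
  qed
  moreover have "x v * f (vertex v) w \<le> (\<Sum>u\<in>\<sigma>. x u * f (vertex u) w)"
  proof (rule member_le_sum[OF v(1) _ \<sigma>(2)])
    fix u assume "u \<in> \<sigma> - {v}"
    then have "vertex u \<in> realized_simplex \<sigma>" by (intro vertex_in_simplex \<sigma>(2)) simp
    then have "vertex u \<in> realization K" using \<sigma>(1) unfolding realization_def by blast
    then have "0 \<le> f (vertex u) w" by (intro nonneg fK)
    moreover have "0 \<le> x u" by (intro nonneg xv)
    ultimately show "0 \<le> x u * f (vertex u) w" by simp
  qed
  moreover have "f (vertex v) w = 1" unfolding w by (simp add: vertex_def)
  ultimately have "x v \<le> f x w" by simp
  then show ?thesis using v(2) fK[OF xv(1)] by (simp add: open_star_def)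
qed

text \<open>On each simplex the map is linear with values in a single simplex.\<close>

lemma simplicial_continuous:
  assumes K: "abstract_complex K" and f: "simplicial_mapping K K f"
    and fK: "\<And>x. x \<in> realization K \<Longrightarrow> f x \<in> realization K"
  shows "continuous_map (realization_topology K) (realization_topology K) f"
  unfolding continuous_map
proof (intro conjI allI impI)
  show "f ` topspace (realization_topology K) \<subseteq> topspace (realization_topology K)"
    using fK by auto
  fix U assume U: "openin (realization_topology K) U"
  have "openin (top_of_set (realized_simplex \<sigma>)) ({x \<in> realization K. f x \<in> U} \<inter> realized_simplex \<sigma>)"
    if \<sigma>: "\<sigma> \<in> K" for \<sigma>
  proof -
    obtain \<tau> where \<tau>: "\<tau> \<in> K" "f ` realized_simplex \<sigma> = realized_simplex \<tau>"
      using f \<sigma> unfolding simplicial_mapping_def by blast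
    have "continuous_on (realized_simplex \<sigma>) f"
    proof (rule continuous_on_coordinatewise_then_product)
      fix w
      have "continuous_on (realized_simplex \<sigma>) (\<lambda>x. \<Sum>v\<in>\<sigma>. x v *\<^sub>R f (vertex v) w)"
        by (intro continuous_intros continuous_on_subset[OF continuous_on_product_coordinates subset_UNIV])
      moreover have "f x w = (\<Sum>v\<in>\<sigma>. x v *\<^sub>R f (vertex v) w)" if "x \<in> realized_simplex \<sigma>" for x
      proof -
        have "linear_on_simplex \<sigma> (\<lambda>x. f x w)" using f \<sigma> by (simp add: simplicial_mapping_def)
        then show ?thesis using that by (simp add: linear_on_simplex_def)
      qed
      ultimately show "continuous_on (realized_simplex \<sigma>) (\<lambda>x. f x w)"
        by (simp cong: continuous_on_cong)
    qed
    moreover have "openin (top_of_set (realized_simplex \<tau>)) (U \<inter> realized_simplex \<tau>)"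
      using U \<tau>(1) unfolding openin_realization_topology by blast
    moreover have "f \<in> realized_simplex \<sigma> \<rightarrow> realized_simplex \<tau>" using \<tau>(2) by blast
    ultimately have "openin (top_of_set (realized_simplex \<sigma>)) (realized_simplex \<sigma> \<inter> f -` (U \<inter> realized_simplex \<tau>))"
      using continuous_openin_preimage by blast
    moreover have "realized_simplex \<sigma> \<inter> f -` (U \<inter> realized_simplex \<tau>) = {x \<in> realization K. f x \<in> U} \<inter> realized_simplex \<sigma>"
      using \<tau>(2) \<sigma> unfolding realization_def by blast
    ultimately show ?thesis by simp
  qed
  then show "openin (realization_topology K) {x \<in> topspace (realization_topology K). f x \<in> U}"
    unfolding openin_realization_topology by auto
qed

text \<open>A Coons patch: the segments from \<open>0\<close> to \<open>A 0\<close> and to \<open>B 0\<close> and their images under \<open>B\<close> and \<open>A\<close> form a closed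
quadrangle, because \<open>A (B 0) = B (A 0)\<close>. The two linear interpolations between opposite sides are added, and the
bilinear interpolation of the corners is subtracted.\<close>

lemma equivariant_square:
  fixes A B :: "'e::real_normed_vector \<Rightarrow> 'e"
  assumes A: "continuous_on UNIV A" and B: "continuous_on UNIV B" and AB: "\<And>x. A (B x) = B (A x)"
  shows "\<exists>F :: real \<times> real \<Rightarrow> 'e. continuous_on UNIV F \<and>
    (\<forall>t. F (1, t) = A (F (0, t))) \<and> (\<forall>s. F (s, 1) = B (F (s, 0)))"
proof -
  define F where "F = (\<lambda>z. (1 - snd z) *\<^sub>R (fst z *\<^sub>R A 0) + snd z *\<^sub>R B (fst z *\<^sub>R A 0)
     + (1 - fst z) *\<^sub>R (snd z *\<^sub>R B 0) + fst z *\<^sub>R A (snd z *\<^sub>R B 0)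
     - (fst z * (1 - snd z)) *\<^sub>R A 0 - ((1 - fst z) * snd z) *\<^sub>R B 0 - (fst z * snd z) *\<^sub>R A (B 0))"
  have "continuous_on UNIV (\<lambda>z :: real \<times> real. B (fst z *\<^sub>R A 0))"
    by (rule continuous_on_compose2[OF B]) (auto intro!: continuous_intros)
  moreover have "continuous_on UNIV (\<lambda>z :: real \<times> real. A (snd z *\<^sub>R B 0))"
    by (rule continuous_on_compose2[OF A]) (auto intro!: continuous_intros)
  ultimately have "continuous_on UNIV F"
    unfolding F_def by (intro continuous_intros)
  moreover have "F (0, t) = t *\<^sub>R B 0" "F (1, t) = A (t *\<^sub>R B 0)"
    "F (t, 0) = t *\<^sub>R A 0" "F (t, 1) = B (t *\<^sub>R A 0)" for t
    by (simp_all add: F_def AB[of 0] algebra_simps)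
  ultimately show ?thesis by (intro exI[of _ F]) simp
qed

lemma equivariant_square_in_plane:
  fixes A B :: "'x \<Rightarrow> 'x"
  assumes hom: "T homeomorphic_space (euclidean :: (real ^ 2) topology)"
    and A: "continuous_map T T A" and B: "continuous_map T T B"
    and AB: "\<And>x. x \<in> topspace T \<Longrightarrow> A (B x) = B (A x)"
  shows "\<exists>F :: real \<times> real \<Rightarrow> 'x. continuous_map euclidean T F \<and>
    (\<forall>t. F (1, t) = A (F (0, t))) \<and> (\<forall>s. F (s, 1) = B (F (s, 0)))"
proof -
  obtain H G where H: "continuous_map T (euclidean :: (real ^ 2) topology) H"
    and G: "continuous_map euclidean T G"
    and GH: "\<And>x. x \<in> topspace T \<Longrightarrow> G (H x) = x" and HG: "\<And>y. H (G y) = y"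
    using hom unfolding homeomorphic_space_def homeomorphic_maps_def by auto
  have GT: "G y \<in> topspace T" for y
    using continuous_map_image_subset_topspace[OF G] by auto
  have AT: "A x \<in> topspace T" "B x \<in> topspace T" if "x \<in> topspace T" for x
    using continuous_map_image_subset_topspace[OF A] continuous_map_image_subset_topspace[OF B] that by auto
  have "continuous_map euclidean euclidean (H \<circ> A \<circ> G)" "continuous_map euclidean euclidean (H \<circ> B \<circ> G)"
    by (intro continuous_map_compose[OF G] continuous_map_compose[OF A H] continuous_map_compose[OF B H])+
  then have "continuous_on UNIV (H \<circ> A \<circ> G)" "continuous_on UNIV (H \<circ> B \<circ> G)"
    by simp_all
  moreover have "(H \<circ> A \<circ> G) ((H \<circ> B \<circ> G) y) = (H \<circ> B \<circ> G) ((H \<circ> A \<circ> G) y)" for y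
    using GT AT GH AB by simp
  ultimately obtain F :: "real \<times> real \<Rightarrow> real ^ 2" where F: "continuous_on UNIV F"
    "\<And>t. F (1, t) = (H \<circ> A \<circ> G) (F (0, t))" "\<And>s. F (s, 1) = (H \<circ> B \<circ> G) (F (s, 0))"
    using equivariant_square[of "H \<circ> A \<circ> G" "H \<circ> B \<circ> G"] by blast
  show ?thesis
  proof (intro exI conjI allI)
    show "continuous_map euclidean T (G \<circ> F)"
      using F(1) by (intro continuous_map_compose[OF _ G]) simp
    show "(G \<circ> F) (1, t) = A ((G \<circ> F) (0, t))" "(G \<circ> F) (s, 1) = B ((G \<circ> F) (s, 0))" for s t
      using GT AT GH by (simp_all add: F)
  qed
qed

text \<open>Simplicial approximation. By compactness the open stars pulled back to the square have a Lebesgue number, and for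
a fine grid each grid point \<open>p\<close> gets a vertex whose open star contains the images of \<open>p\<close> and of its three
neighbours ahead. The image of such a neighbour then lies in the stars of both labels. Labels on the far
sides are the images under \<open>A\<close> and \<open>B\<close> of those on the near sides. As only neighbours
ahead are involved, the labels on the near sides can be chosen without regard to the far sides.\<close>

lemma equivariant_grid:
  assumes K: "abstract_complex K"
    and hom: "realization_topology K homeomorphic_space (euclidean :: (real ^ 2) topology)"
    and A: "simplicial_mapping K K A" "\<And>x. x \<in> realization K \<Longrightarrow> A x \<in> realization K"
    and B: "simplicial_mapping K K B" "\<And>x. x \<in> realization K \<Longrightarrow> B x \<in> realization K"
    and AB: "\<And>x. x \<in> realization K \<Longrightarrow> A (B x) = B (A x)"
  shows "\<exists>n w. 0 < n \<and> (\<forall>i\<le>n. \<forall>j\<le>n. {w (i, j)} \<in> K) \<and>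
    (\<forall>j\<le>n. vertex (w (n, j)) = A (vertex (w (0, j)))) \<and>
    (\<forall>i\<le>n. vertex (w (i, n)) = B (vertex (w (i, 0)))) \<and>
    (\<forall>i<n. \<forall>j<n. \<forall>p\<in>{(Suc i, j), (i, Suc j), (Suc i, Suc j)}. w p = w (i, j) \<or> edge K (w p) (w (i, j)))"
proof -
  obtain F :: "real \<times> real \<Rightarrow> 'a \<Rightarrow> real" where F: "continuous_map euclidean (realization_topology K) F"
    and FA: "\<And>t. F (1, t) = A (F (0, t))" and FB: "\<And>s. F (s, 1) = B (F (s, 0))"
    using equivariant_square_in_plane[OF hom simplicial_continuous[OF K A] simplicial_continuous[OF K B]] AB
    by auto
  have FK: "F z \<in> realization K" for z
    using continuous_map_image_subset_topspace[OF F] by auto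
  define Q where "Q = {0..1::real} \<times> {0..1::real}"
  define U where "U = (\<lambda>v. {z. F z \<in> open_star K v})"
  have op: "open (U v)" for v
    using openin_continuous_map_preimage[OF F openin_open_star[of K v]] by (simp add: U_def)
  have sub: "Q \<subseteq> \<Union>(range U)"
    using in_some_open_star[OF K FK] unfolding U_def by auto
  have "compact Q" unfolding Q_def by (intro compact_Times compact_Icc)
  then obtain \<epsilon> where \<epsilon>: "0 < \<epsilon>" "\<And>z. z \<in> Q \<Longrightarrow> \<exists>S\<in>range U. ball z \<epsilon> \<subseteq> S"
    by (rule Heine_Borel_lemma[OF _ sub]) (use op in auto)
  obtain n :: nat where n': "2 / \<epsilon> < real n" using reals_Archimedean2 by blast
  moreover have "0 < 2 / \<epsilon>" using \<epsilon>(1) by simp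
  ultimately have "0 < real n" by linarith
  then have n: "0 < n" and n2: "2 / real n < \<epsilon>" using n' \<epsilon>(1) by (simp_all add: field_simps)
  define g where "g = (\<lambda>(i, j). (real i / real n, real j / real n))"
  have gQ: "g (i, j) \<in> Q" if "i < n" "j < n" for i j
    using that n by (auto simp: g_def Q_def)
  have "\<forall>p. \<exists>v. p \<in> {..<n} \<times> {..<n} \<longrightarrow> ball (g p) \<epsilon> \<subseteq> U v"
  proof
    fix p show "\<exists>v. p \<in> {..<n} \<times> {..<n} \<longrightarrow> ball (g p) \<epsilon> \<subseteq> U v"
    proof (cases "p \<in> {..<n} \<times> {..<n}")
      case True
      then obtain S where "S \<in> range U" "ball (g p) \<epsilon> \<subseteq> S" using \<epsilon>(2)[of "g p"] gQ by auto
      then show ?thesis by blast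
    qed simp
  qed
  then obtain w0 where "\<forall>p. p \<in> {..<n} \<times> {..<n} \<longrightarrow> ball (g p) \<epsilon> \<subseteq> U (w0 p)"
    by (rule choice[THEN exE])
  then have w0: "ball (g (i, j)) \<epsilon> \<subseteq> U (w0 (i, j))" if "i < n" "j < n" for i j
    using that by simp
  have w0K: "{w0 (i, j)} \<in> K" if "i < n" "j < n" for i j
  proof -
    have "g (i, j) \<in> U (w0 (i, j))" using w0[OF that] \<epsilon>(1) by auto
    then show ?thesis using open_star_vertex[OF K] unfolding U_def by blast
  qed
  obtain a where a: "\<And>v. {v} \<in> K \<Longrightarrow> {a v} \<in> K \<and> A (vertex v) = vertex (a v)"
    using simplicial_vertex[OF K A(1)] by metis
  obtain b where b: "\<And>v. {v} \<in> K \<Longrightarrow> {b v} \<in> K \<and> B (vertex v) = vertex (b v)"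
    using simplicial_vertex[OF K B(1)] by metis
  \<comment> \<open>Labels on the far sides are transported from the near sides.\<close>
  define r where "r = (\<lambda>i. if i = n then 0 else i)"
  define w1 where "w1 = (\<lambda>(i, j). if j = n then b (w0 (r i, 0)) else w0 (r i, j))"
  define w where "w = (\<lambda>(i, j). if i = n then a (w1 (i, j)) else w1 (i, j))"
  have r: "r i < n" if "i \<le> n" for i using that n by (auto simp: r_def)
  have w1K: "{w1 (i, j)} \<in> K" if "i \<le> n" "j \<le> n" for i j
    using that r w0K b n by (auto simp: w1_def)
  have wK: "{w (i, j)} \<in> K" if "i \<le> n" "j \<le> n" for i j
    using that w1K a by (auto simp: w_def)
  have per1: "vertex (w (n, j)) = A (vertex (w (0, j)))" if "j \<le> n" for j
  proof -
    have "w (n, j) = a (w1 (0, j))" "w (0, j) = w1 (0, j)"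
      using n by (simp_all add: w_def w1_def r_def)
    then show ?thesis using a w1K[of 0 j] that by simp
  qed
  have per2: "vertex (w (i, n)) = B (vertex (w (i, 0)))" if "i \<le> n" for i
  proof (cases "i = n")
    case False
    then have "w (i, n) = b (w0 (i, 0))" "w (i, 0) = w0 (i, 0)" "{w0 (i, 0)} \<in> K"
      using n that w0K by (simp_all add: w_def w1_def r_def)
    then show ?thesis using b by simp
  next
    case True
    have 0: "{w0 (0, 0)} \<in> K" using w0K n by blast
    then have "vertex (w (n, n)) = A (B (vertex (w0 (0, 0))))"
      using n a b by (simp add: w_def w1_def r_def)
    also have "\<dots> = B (A (vertex (w0 (0, 0))))" by (rule AB[OF vertex_in_realization[OF 0]])
    also have "A (vertex (w0 (0, 0))) = vertex (w (n, 0))"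
      using 0 n a by (simp add: w_def w1_def r_def)
    finally show ?thesis by (simp add: True)
  qed
  have star1: "F (g (i, j)) \<in> open_star K (w1 (i, j))" if "i < n" "j \<le> n" for i j
  proof (cases "j = n")
    case False
    then have "g (i, j) \<in> U (w0 (i, j))" using w0[of i j] that \<epsilon>(1) by auto
    then show ?thesis using that False by (simp add: U_def w1_def r_def)
  next
    case True
    have "g (i, 0) \<in> U (w0 (i, 0))" using w0[of i 0] that n \<epsilon>(1) by auto
    then have "F (g (i, 0)) \<in> open_star K (w0 (i, 0))" by (simp add: U_def)
    then have "B (F (g (i, 0))) \<in> open_star K (b (w0 (i, 0)))"
      using b w0K[of i 0] that n by (intro simplicial_open_star[OF K B]) auto
    moreover have "F (g (i, n)) = B (F (g (i, 0)))" using FB n by (simp add: g_def)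
    ultimately show ?thesis using that True by (simp add: w1_def r_def)
  qed
  have star: "F (g (i, j)) \<in> open_star K (w (i, j))" if "i \<le> n" "j \<le> n" for i j
  proof (cases "i = n")
    case False
    then show ?thesis using star1[of i j] that by (simp add: w_def)
  next
    case True
    have "F (g (0, j)) \<in> open_star K (w1 (0, j))" using star1 n that by simp
    then have "A (F (g (0, j))) \<in> open_star K (a (w1 (0, j)))"
      using a w1K[of 0 j] that by (intro simplicial_open_star[OF K A]) auto
    moreover have "F (g (n, j)) = A (F (g (0, j)))" using FA n by (simp add: g_def)
    moreover have "w1 (n, j) = w1 (0, j)" by (simp add: w1_def r_def)
    ultimately show ?thesis using True by (simp add: w_def)
  qed
  have "w p = w (i, j) \<or> edge K (w p) (w (i, j))"
    if ij: "i < n" "j < n" and p: "p \<in> {(Suc i, j), (i, Suc j), (Suc i, Suc j)}" for i j p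
  proof -
    obtain i' j' where p': "p = (i', j')" "i' \<le> n" "j' \<le> n" "i' = i \<or> i' = Suc i" "j' = j \<or> j' = Suc j"
      using ij p by auto
    have "dist (g (i, j)) (g p) \<le> dist (real i / real n) (real i' / real n) + dist (real j / real n) (real j' / real n)"
      unfolding p' g_def by (simp add: dist_Pair_Pair) (rule sqrt_sum_squares_le_sum_abs[THEN order.trans], simp)
    also have "\<dots> \<le> 1 / real n + 1 / real n"
      using p'(4,5) by (intro add_mono) (auto simp: dist_real_def simp flip: diff_divide_distrib)
    also have "\<dots> < \<epsilon>" using n2 by simp
    finally have "F (g p) \<in> open_star K (w0 (i, j))"
      using w0[OF ij] unfolding U_def by auto
    moreover have "w0 (i, j) = w (i, j)" using ij by (simp add: w_def w1_def r_def)
    moreover have "F (g p) \<in> open_star K (w p)" using star p' by simp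
    ultimately show ?thesis using open_stars_meet[OF K] by metis
  qed
  then show ?thesis using n wK per1 per2 by (intro exI[of _ n] exI[of _ w]) blast
qed

section \<open>Krull dimension\<close>

lemma irreducible_zero_product:
  assumes Z: "irreducible_algebraic_set Z"
    and p: "real_polynomial_function p" and q: "real_polynomial_function q"
    and pq: "\<And>x. x \<in> Z \<Longrightarrow> p x * q x = 0"
  shows "(\<forall>x\<in>Z. p x = 0) \<or> (\<forall>x\<in>Z. q x = 0)"
proof -
  have sub: "algebraic_set {x \<in> Z. f x = 0}" if f: "real_polynomial_function f" for f
  proof -
    obtain P where P: "\<forall>p\<in>P. real_polynomial_function p" "Z = {x. \<forall>p\<in>P. p x = 0}"
      using Z unfolding irreducible_algebraic_set_def algebraic_set_def by blast
    then have "{x \<in> Z. f x = 0} = {x. \<forall>p\<in>insert f P. p x = 0}" by auto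
    moreover have "\<forall>p\<in>insert f P. real_polynomial_function p" using P(1) f by blast
    ultimately show ?thesis unfolding algebraic_set_def by blast
  qed
  have "Z = {x \<in> Z. p x = 0} \<union> {x \<in> Z. q x = 0}"
    using pq mult_eq_0_iff by blast
  then have "Z = {x \<in> Z. p x = 0} \<or> Z = {x \<in> Z. q x = 0}"
    using Z sub[OF p] sub[OF q] unfolding irreducible_algebraic_set_def by blast
  then show ?thesis by blast
qed

lemma separating_polynomial:
  assumes "algebraic_set Y" "Y \<subset> Z"
  obtains p where "real_polynomial_function p" "\<And>x. x \<in> Y \<Longrightarrow> p x = 0" "\<exists>x\<in>Z. p x \<noteq> 0"
proof -
  obtain P where P: "\<forall>p\<in>P. real_polynomial_function p" "Y = {x. \<forall>p\<in>P. p x = 0}"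
    using assms unfolding algebraic_set_def by blast
  obtain z where "z \<in> Z" "z \<notin> Y" using assms by blast
  then obtain p where "p \<in> P" "p z \<noteq> 0" using P by blast
  then show ?thesis using that P \<open>z \<in> Z\<close> by blast
qed

lemma real_polynomial_function_poly:
  "real_polynomial_function h \<Longrightarrow> real_polynomial_function (\<lambda>x. poly P (h x))"
  unfolding poly_altdef by (intro real_polynomial_function_sum real_polynomial_function.intros(2,4) real_polynomial_function_power) auto

text \<open>The outer variable of \<open>Q\<close> is evaluated at \<open>y\<close>, the variable of its coefficients at \<open>z\<close>.\<close>

definition eval2 :: "real poly poly \<Rightarrow> real \<Rightarrow> real \<Rightarrow> real" where
  "eval2 Q z y = poly (poly Q [:y:]) z"

lemma eval2_mult: "eval2 (Q * R) z y = eval2 Q z y * eval2 R z y"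
  by (simp add: eval2_def)

lemma real_polynomial_function_eval2:
  assumes h: "real_polynomial_function h" and p: "real_polynomial_function p"
  shows "real_polynomial_function (\<lambda>x. eval2 Q (h x) (p x))"
proof (induction Q)
  case 0
  then show ?case by (simp add: eval2_def real_polynomial_function.intros(2))
next
  case (pCons a Q)
  have "real_polynomial_function (\<lambda>x. poly a (h x) + p x * eval2 Q (h x) (p x))"
    by (rule real_polynomial_function.intros(3)[OF real_polynomial_function_poly[OF h]
          real_polynomial_function.intros(4)[OF p pCons.IH]])
  then show ?case by (simp add: eval2_def)
qed

lemma poly_specialise: "poly (map_poly (\<lambda>s. poly s c) T) y = eval2 T c y"
  by (induction T) (simp_all add: eval2_def map_poly_pCons)

lemma factor_out_variable:
  fixes Q :: "'a::idom poly"
  assumes "Q \<noteq> 0"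
  obtains k R where "Q = [:0, 1:] ^ k * R" "poly R 0 \<noteq> 0"
proof -
  obtain R where R: "Q = [:- 0, 1:] ^ Polynomial.order 0 Q * R" "\<not> [:- 0, 1:] dvd R"
    using order_decomp[OF assms, of 0] by blast
  then have "poly R 0 \<noteq> 0" by (simp only: poly_eq_0_iff_dvd) simp
  then show ?thesis using that R by simp
qed

text \<open>Let \<open>p\<close> vanish on \<open>Y\<close> but not on \<open>Z\<close>. In the monic relation for \<open>p\<close> over \<open>\<real>[h]\<close> a power of \<open>p\<close> can
be cancelled on \<open>Z\<close>, and on \<open>Y\<close> only a nonzero polynomial in \<open>h\<close> remains. So \<open>h\<close> has finitely
many values on \<open>Y\<close>, and every polynomial \<open>q\<close> satisfies a nonzero relation with constant coefficients there.
If \<open>q\<close> vanishes on \<open>X\<close> but not on \<open>Y\<close>, cancelling a power of \<open>q\<close> leaves a relation whose constant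
term does not vanish, in contradiction to \<open>q = 0\<close> on \<open>X\<close>.\<close>

lemma no_chain_of_length_2:
  fixes V :: "'a::euclidean_space set"
  assumes h: "real_polynomial_function h"
    and integral: "\<And>p. real_polynomial_function p \<Longrightarrow>
      \<exists>Q. lead_coeff Q = 1 \<and> (\<forall>x\<in>V. eval2 Q (h x) (p x) = 0)"
    and Z: "irreducible_algebraic_set X" "irreducible_algebraic_set Y" "irreducible_algebraic_set Z"
    and sub: "X \<subset> Y" "Y \<subset> Z" "Z \<subseteq> V"
  shows False
proof -
  have alg: "algebraic_set X" "algebraic_set Y" "X \<noteq> {}" "Z \<noteq> {}"
    using Z unfolding irreducible_algebraic_set_def by blast+
  obtain p where p: "real_polynomial_function p" "\<And>x. x \<in> Y \<Longrightarrow> p x = 0" "\<exists>x\<in>Z. p x \<noteq> 0"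
    using separating_polynomial[OF alg(2) sub(2)] by blast
  obtain q where q: "real_polynomial_function q" "\<And>x. x \<in> X \<Longrightarrow> q x = 0" "\<exists>x\<in>Y. q x \<noteq> 0"
    using separating_polynomial[OF alg(1) sub(1)] by blast
  obtain Q where Q: "lead_coeff Q = 1" "\<And>x. x \<in> V \<Longrightarrow> eval2 Q (h x) (p x) = 0"
    using integral[OF p(1)] by blast
  then have "Q \<noteq> 0" by auto
  then obtain k R where R: "Q = [:0, 1:] ^ k * R" "poly R 0 \<noteq> 0"
    by (rule factor_out_variable)
  have var: "eval2 ([:0, 1:] ^ k) z y = y ^ k" for k z y
    by (simp add: eval2_def)
  have "(\<forall>x\<in>Z. p x ^ k = 0) \<or> (\<forall>x\<in>Z. eval2 R (h x) (p x) = 0)"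
  proof (rule irreducible_zero_product[OF Z(3)])
    show "p x ^ k * eval2 R (h x) (p x) = 0" if "x \<in> Z" for x
      using Q(2)[of x] that sub(3) by (auto simp: R(1) eval2_mult var)
  qed (intro real_polynomial_function_power real_polynomial_function_eval2 p h)+
  then have "\<forall>x\<in>Z. eval2 R (h x) (p x) = 0"
    using p(3) by (metis power_eq_0_iff)
  then have "poly (poly R 0) (h x) = 0" if "x \<in> Y" for x
  proof -
    have "eval2 R (h x) (p x) = 0"
      using \<open>\<forall>x\<in>Z. eval2 R (h x) (p x) = 0\<close> that sub(2) by blast
    then show ?thesis by (simp add: p(2)[OF that] eval2_def)
  qed
  then have hroot: "h x \<in> {c. poly (poly R 0) c = 0}" if "x \<in> Y" for x
    using that by blast
  obtain T where T: "lead_coeff T = 1" "\<And>x. x \<in> V \<Longrightarrow> eval2 T (h x) (q x) = 0"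
    using integral[OF q(1)] by blast
  define \<Phi> where "\<Phi> = (\<Prod>c\<in>{c. poly (poly R 0) c = 0}. map_poly (\<lambda>s. poly s c) T)"
  have fin: "finite {c. poly (poly R 0) c = 0}"
    using R(2) by (rule poly_roots_finite)
  have "map_poly (\<lambda>s. poly s c) T \<noteq> 0" for c
  proof -
    have "coeff (map_poly (\<lambda>s. poly s c) T) (degree T) = 1"
      using T(1) by (simp add: coeff_map_poly)
    then show ?thesis by auto
  qed
  then have "\<Phi> \<noteq> 0" unfolding \<Phi>_def using fin by simp
  then obtain m \<Psi> where \<Psi>: "\<Phi> = [:0, 1:] ^ m * \<Psi>" "poly \<Psi> 0 \<noteq> 0"
    by (rule factor_out_variable)
  have "poly \<Phi> (q x) = 0" if "x \<in> Y" for x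
    unfolding \<Phi>_def poly_prod
    using fin hroot[OF that] T(2)[of x] that sub
    by (intro prod_zero) (auto simp: poly_specialise intro!: bexI[of _ "h x"])
  then have "q x ^ m * poly \<Psi> (q x) = 0" if "x \<in> Y" for x
    using that by (simp add: \<Psi>(1))
  then have "(\<forall>x\<in>Y. q x ^ m = 0) \<or> (\<forall>x\<in>Y. poly \<Psi> (q x) = 0)"
    by (intro irreducible_zero_product[OF Z(2)] real_polynomial_function_power
        real_polynomial_function_poly q)
  then have "\<forall>x\<in>Y. poly \<Psi> (q x) = 0"
    using q(3) by (metis power_eq_0_iff)
  moreover obtain x where x: "x \<in> X" "x \<in> Y" using alg(3) sub(1) by blast
  ultimately have "poly \<Psi> (q x) = 0" by blast
  then show False using q(2)[OF x(1)] \<Psi>(2) by simp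
qed

definition line :: "(real ^ 3) set" where
  "line = range (axis 1)"

lemma polynomial_on_line:
  assumes "real_polynomial_function p"
  shows "\<exists>f. \<forall>t. p (axis 1 t :: real ^ 3) = poly f t"
  using assms
proof induction
  case (linear f)
  have "f (axis 1 t) = poly [:0, f (axis 1 1):] t" for t
  proof -
    have "axis 1 t = t *\<^sub>R (axis 1 1 :: real ^ 3)" by (simp add: axis_def vec_eq_iff)
    then show ?thesis using linear_cmul[OF bounded_linear.linear[OF linear]] by simp
  qed
  then show ?case by blast
next
  case (const c)
  then show ?case by (intro exI[of _ "[:c:]"]) simp
next
  case (add f g)
  then obtain F G where "\<forall>t. f (axis 1 t) = poly F t" "\<forall>t. g (axis 1 t) = poly G t" by blast
  then show ?case by (intro exI[of _ "F + G"]) simp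
next
  case (mult f g)
  then obtain F G where "\<forall>t. f (axis 1 t) = poly F t" "\<forall>t. g (axis 1 t) = poly G t" by blast
  then show ?case by (intro exI[of _ "F * G"]) simp
qed

lemma real_polynomial_function_component: "real_polynomial_function (\<lambda>x :: real ^ 'n. x $ i)"
  by (intro real_polynomial_function.intros(1) bounded_linear_vec_nth)

lemma irreducible_line: "irreducible_algebraic_set line"
proof -
  have "line = {x. \<forall>p\<in>{\<lambda>x. x $ 2, \<lambda>x. x $ 3}. p x = 0}"
  proof (intro equalityI subsetI)
    fix x :: "real ^ 3" assume "x \<in> {x. \<forall>p\<in>{\<lambda>x. x $ 2, \<lambda>x. x $ 3}. p x = 0}"
    then have "x = axis 1 (x $ 1)" by (simp add: vec_eq_iff forall_3 axis_def)
    then show "x \<in> line" unfolding line_def by blast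
  qed (auto simp: line_def axis_def)
  then have alg: "algebraic_set line"
    unfolding algebraic_set_def
    by (intro exI[of _ "{\<lambda>x. x $ 2, \<lambda>x. x $ 3}"]) (auto intro: real_polynomial_function_component)
  have "line = A \<or> line = B" if AB: "algebraic_set A" "algebraic_set B" "line = A \<union> B" for A B
  proof (rule ccontr)
    assume "\<not> (line = A \<or> line = B)"
    then have "A \<subset> line" "B \<subset> line" using AB(3) by blast+
    then obtain p q where p: "real_polynomial_function p" "\<And>x. x \<in> A \<Longrightarrow> p x = 0" "\<exists>x\<in>line. p x \<noteq> 0"
      and q: "real_polynomial_function q" "\<And>x. x \<in> B \<Longrightarrow> q x = 0" "\<exists>x\<in>line. q x \<noteq> 0"
      using separating_polynomial AB(1,2) by metis
    obtain f g where fg: "\<And>t. p (axis 1 t) = poly f t" "\<And>t. q (axis 1 t) = poly g t"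
      using polynomial_on_line p(1) q(1) by metis
    have "p x * q x = 0" if "x \<in> line" for x
      using that AB(3) p(2) q(2) by auto
    then have "poly (f * g) t = 0" for t
      by (simp add: line_def flip: fg)
    then have "f * g = 0" using poly_all_0_iff_0 by blast
    then have "f = 0 \<or> g = 0" by simp
    then show False using p(3) q(3) fg by (auto simp: line_def)
  qed
  then show ?thesis
    unfolding irreducible_algebraic_set_def using alg by (auto simp: line_def)
qed

lemma irreducible_origin: "irreducible_algebraic_set {0 :: real ^ 3}"
proof -
  have "{0} = {x :: real ^ 3. \<forall>p\<in>range (\<lambda>i x. x $ i). p x = 0}"
    by (auto simp: vec_eq_iff)
  then have "algebraic_set {0 :: real ^ 3}"
    unfolding algebraic_set_def
    by (intro exI[of _ "range (\<lambda>i x. x $ i)"]) (auto intro: real_polynomial_function_component)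
  moreover have "{0} = A \<or> {0} = B" if "{0 :: real ^ 3} = A \<union> B" for A B
    using that by blast
  ultimately show ?thesis unfolding irreducible_algebraic_set_def by blast
qed

text \<open>The line supplies a chain of length one; on it every polynomial is a polynomial in \<open>h\<close>, so the monic relations
extend to it.\<close>

theorem curve_containing:
  fixes S :: "(real ^ 3) set"
  defines "h \<equiv> \<lambda>x :: real ^ 3. x $ 1 + x $ 3"
  assumes integral: "\<And>p. real_polynomial_function p \<Longrightarrow>
      \<exists>m (c :: nat \<Rightarrow> real poly). \<forall>x\<in>S. p x ^ m = (\<Sum>k<m. poly (c k) (h x) * p x ^ k)"
  shows "\<exists>V. algebraic_set V \<and> algebraic_dim V = 1 \<and> S \<subseteq> V"
proof -
  define V where "V = {x. \<forall>p. real_polynomial_function p \<longrightarrow> (\<forall>y\<in>S \<union> line. p y = 0) \<longrightarrow> p x = 0}"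
  have sub: "S \<union> line \<subseteq> V" unfolding V_def by blast
  have alg: "algebraic_set V"
    unfolding algebraic_set_def V_def
    by (intro exI[of _ "{p. real_polynomial_function p \<and> (\<forall>y\<in>S \<union> line. p y = 0)}"]) blast
  have h: "real_polynomial_function h"
    unfolding h_def by (intro real_polynomial_function.intros(3) real_polynomial_function_component)
  have V: "\<exists>Q. lead_coeff Q = 1 \<and> (\<forall>x\<in>V. eval2 Q (h x) (p x) = 0)"
    if p: "real_polynomial_function p" for p
  proof -
    obtain m c where mc: "\<And>x. x \<in> S \<Longrightarrow> p x ^ m = (\<Sum>k<m. poly (c k) (h x) * p x ^ k)"
      using integral[OF p] by blast
    obtain f where f: "\<And>t. p (axis 1 t) = poly f t" using polynomial_on_line[OF p] by blast
    define Q1 where "Q1 = monom 1 m - (\<Sum>k<m. monom (c k) k)"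
    define Q2 where "Q2 = [:- f, 1:]"
    have cf: "coeff Q1 k = (if k = m then 1 else if k < m then - c k else 0)" for k
      unfolding Q1_def by (simp add: coeff_sum coeff_monom sum.delta)
    have "degree Q1 = m"
      by (intro antisym degree_le le_degree) (auto simp: cf)
    then have "lead_coeff Q1 = 1" by (simp add: cf)
    then have lc: "lead_coeff (Q1 * Q2) = 1"
    proof -
      have "lead_coeff Q2 = 1" by (simp add: Q2_def)
      then show ?thesis using \<open>lead_coeff Q1 = 1\<close> by (simp only: lead_coeff_mult mult_1)
    qed
    have Q1: "eval2 Q1 z y = y ^ m - (\<Sum>k<m. poly (c k) z * y ^ k)" for y z
      by (simp add: eval2_def Q1_def poly_sum poly_monom)
    have "eval2 (Q1 * Q2) (h x) (p x) = 0" if "x \<in> S \<union> line" for x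
      using that
    proof
      assume "x \<in> S"
      then show ?thesis using mc by (simp add: eval2_mult Q1)
    next
      assume "x \<in> line"
      then obtain t where t: "x = axis 1 t" unfolding line_def by blast
      then have "h x = t" by (simp add: h_def axis_def)
      then have "eval2 Q2 (h x) (p x) = 0"
        unfolding t by (simp add: eval2_def Q2_def f)
      then show ?thesis by (simp add: eval2_mult)
    qed
    then have "\<forall>x\<in>V. eval2 (Q1 * Q2) (h x) (p x) = 0"
      unfolding V_def using real_polynomial_function_eval2[OF h p] by blast
    then show ?thesis using lc by blast
  qed
  \<comment> \<open>The set whose supremum is the dimension of \<open>V\<close>.\<close>
  define N where "N = {ereal (real n) | n. \<exists>Z. (\<forall>i\<le>n. irreducible_algebraic_set (Z i) \<and> Z i \<subseteq> V) \<and>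
    (\<forall>i<n. Z i \<subset> Z (Suc i))}"
  have "x \<le> 1" if x: "x \<in> N" for x
  proof -
    obtain n Z where n: "x = ereal (real n)"
      and Z: "\<And>i. i \<le> n \<Longrightarrow> irreducible_algebraic_set (Z i) \<and> Z i \<subseteq> V" "\<And>i. i < n \<Longrightarrow> Z i \<subset> Z (Suc i)"
      using x unfolding N_def by blast
    have "\<not> 2 \<le> n"
      using no_chain_of_length_2[OF h V, of "Z 0" "Z 1" "Z 2"] Z(1)[of 0] Z(1)[of 1] Z(1)[of 2]
        Z(2)[of 0] Z(2)[of 1] by (auto simp: numeral_2_eq_2)
    then show ?thesis by (simp add: n)
  qed
  moreover have "1 \<in> N"
  proof -
    define Z where "Z = (\<lambda>i :: nat. if i = 0 then {0} else line)"
    have "axis 1 0 = (0 :: real ^ 3)" "axis 1 1 \<noteq> (0 :: real ^ 3)" by (simp_all add: axis_eq_0_iff)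
    then have "0 \<in> line" "line \<noteq> {0}" unfolding line_def by (metis rangeI, metis rangeI singletonD)
    then have "(\<forall>i\<le>1. irreducible_algebraic_set (Z i) \<and> Z i \<subseteq> V) \<and> (\<forall>i<1. Z i \<subset> Z (Suc i))"
      using sub irreducible_origin irreducible_line unfolding Z_def by auto
    then show ?thesis unfolding N_def by (intro CollectI exI[of _ 1] conjI exI[of _ Z]) simp_all
  qed
  ultimately have "algebraic_dim V = 1"
    unfolding algebraic_dim_def N_def[symmetric] by (intro antisym Sup_least Sup_upper)
  then show ?thesis using alg sub by blast
qed

section \<open>The period lattices of polyhedral surfaces\<close>

lemma free_abelian_basis2_commute:
  assumes "free_abelian_basis2 G \<alpha> \<beta>"
  shows "\<alpha> \<otimes>\<^bsub>G\<^esub> \<beta> = \<beta> \<otimes>\<^bsub>G\<^esub> \<alpha>"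
proof -
  interpret group G using assms by (simp add: free_abelian_basis2_def)
  have ab: "\<alpha> \<in> carrier G" "\<beta> \<in> carrier G" using assms by (simp_all add: free_abelian_basis2_def)
  define f where "f = (\<lambda>(m::int, n::int). (\<alpha> [^]\<^bsub>G\<^esub> m) \<otimes>\<^bsub>G\<^esub> (\<beta> [^]\<^bsub>G\<^esub> n))"
  have f: "f \<in> hom (integer_group \<times>\<times> integer_group) G"
    using assms by (simp add: free_abelian_basis2_def f_def iso_def)
  have "f ((1, 0) \<otimes>\<^bsub>integer_group \<times>\<times> integer_group\<^esub> (0, 1)) = f (1, 0) \<otimes>\<^bsub>G\<^esub> f (0, 1)"
    "f ((0, 1) \<otimes>\<^bsub>integer_group \<times>\<times> integer_group\<^esub> (1, 0)) = f (0, 1) \<otimes>\<^bsub>G\<^esub> f (1, 0)"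
    by (intro hom_mult[OF f]; simp)+
  then have "f (1, 0) \<otimes>\<^bsub>G\<^esub> f (0, 1) = f (0, 1) \<otimes>\<^bsub>G\<^esub> f (1, 0)"
    by simp
  moreover have "f (1, 0) = \<alpha>" "f (0, 1) = \<beta>"
    using ab by (simp_all add: f_def int_pow_1)
  ultimately show ?thesis by simp
qed

theorem theorem4p1:
  fixes K :: "'v set set"
    and \<Lambda> :: "('g, 'm) monoid_scheme"
    and \<alpha> \<beta> :: 'g
    and \<phi> :: "'g \<Rightarrow> ('v \<Rightarrow> real) \<Rightarrow> ('v \<Rightarrow> real)"
    and l :: "'v \<Rightarrow> 'v \<Rightarrow> real"
  assumes "abstract_complex K"
    and "realization_topology K homeomorphic_space (euclidean :: (real ^ 2) topology)"
    and "free_abelian_basis2 \<Lambda> \<alpha> \<beta>"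
    and "free_simplicial_action \<Lambda> K \<phi>"
    and "\<And>u v. edge K u v \<Longrightarrow> l u v = l v u"
  shows "\<exists>V :: (real ^ 3) set. algebraic_set V \<and> algebraic_dim V = 1 \<and>
           period_gram_set K \<Lambda> \<alpha> \<beta> \<phi> l \<subseteq> V"
proof (rule curve_containing)
  fix p :: "real ^ 3 \<Rightarrow> real" assume p: "real_polynomial_function p"
  define S where "S = period_gram_set K \<Lambda> \<alpha> \<beta> \<phi> l"
  interpret group_action \<Lambda> "realization K" \<phi>
    using assms(4) by (simp add: free_simplicial_action_def)
  have ab: "\<alpha> \<in> carrier \<Lambda>" "\<beta> \<in> carrier \<Lambda>"
    using assms(3) by (simp_all add: free_abelian_basis2_def)
  have simp_map: "simplicial_mapping K K (\<phi> \<alpha>)" "simplicial_mapping K K (\<phi> \<beta>)"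
    using assms(4) ab by (simp_all add: free_simplicial_action_def)
  have closed: "\<phi> \<alpha> x \<in> realization K" "\<phi> \<beta> x \<in> realization K" if "x \<in> realization K" for x
    using surj_prop[OF ab(1)] surj_prop[OF ab(2)] that by blast+
  have comm: "\<phi> \<alpha> (\<phi> \<beta> x) = \<phi> \<beta> (\<phi> \<alpha> x)" if "x \<in> realization K" for x
    using composition_rule[OF that ab] composition_rule[OF that ab(2,1)]
      free_abelian_basis2_commute[OF assms(3)] by simp
  obtain n w where n: "0 < n" and wK: "\<forall>i\<le>n. \<forall>j\<le>n. {w (i, j)} \<in> K"
    and w\<alpha>: "\<forall>j\<le>n. vertex (w (n, j)) = \<phi> \<alpha> (vertex (w (0, j)))"
    and w\<beta>: "\<forall>i\<le>n. vertex (w (i, n)) = \<phi> \<beta> (vertex (w (i, 0)))"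
    and w_edge: "\<forall>i<n. \<forall>j<n. \<forall>p\<in>{(Suc i, j), (i, Suc j), (Suc i, Suc j)}.
      w p = w (i, j) \<or> edge K (w p) (w (i, j))"
    using equivariant_grid[OF assms(1,2) simp_map(1) closed(1) simp_map(2) closed(2) comm] by metis
  define surface where "surface = (\<lambda>\<theta> a b. periodic_polyhedral_surface K \<Lambda> \<alpha> \<beta> \<phi> \<theta> a b \<and>
    (\<forall>u v. edge K u v \<longrightarrow> (norm (\<theta> (vertex u) - \<theta> (vertex v)))\<^sup>2 = l u v))"
  show "\<exists>m (c :: nat \<Rightarrow> real poly). \<forall>x\<in>period_gram_set K \<Lambda> \<alpha> \<beta> \<phi> l.
      p x ^ m = (\<Sum>k<m. poly (c k) (x $ 1 + x $ 3) * p x ^ k)"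
  proof (cases "S = {}")
    case True
    then show ?thesis by (simp add: S_def)
  next
    case False
    then obtain x0 where x0: "x0 \<in> S" by blast
    \<comment> \<open>The surfaces are indexed by all points of the space, with \<open>x0\<close> as the default outside the set of Gram matrices.\<close>
    define r where "r = (\<lambda>x. if x \<in> S then x else x0)"
    have "\<exists>\<theta> a b. surface \<theta> a b \<and> r x = vector [a \<bullet> a, a \<bullet> b, b \<bullet> b]" for x
    proof -
      have "r x \<in> S" using x0 by (simp add: r_def)
      then show ?thesis unfolding S_def period_gram_set_def surface_def by blast
    qed
    then obtain \<theta> a b where s: "\<And>x. surface (\<theta> x) (a x) (b x)"
      and r: "\<And>x. r x = vector [a x \<bullet> a x, a x \<bullet> b x, b x \<bullet> b x]"
      by metis
    define X where "X = (\<lambda>x q. \<theta> x (vertex (w q)))"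
    \<comment> \<open>Neighbouring grid points may carry the same vertex, which gives an edge of length zero.\<close>
    define L where "L = (\<lambda>q q'. if w q' = w q then 0 else l (w q') (w q))"
    have X: "quasiperiodic n (X x) (a x) (b x)" for x
    proof -
      obtain \<psi> where \<psi>: "\<psi> \<alpha> = (\<lambda>p. p + a x)" "\<psi> \<beta> = (\<lambda>p. p + b x)"
        "\<forall>g\<in>carrier \<Lambda>. \<forall>y\<in>realization K. \<theta> x (\<phi> g y) = \<psi> g (\<theta> x y)"
        using s[of x] unfolding surface_def periodic_polyhedral_surface_def by blast
      have vK: "vertex (w (i, j)) \<in> realization K" if "i \<le> n" "j \<le> n" for i j
        by (rule vertex_in_realization) (use wK that in blast)
      have shift: "\<theta> x (\<phi> \<alpha> y) = \<theta> x y + a x" "\<theta> x (\<phi> \<beta> y) = \<theta> x y + b x" if "y \<in> realization K" for y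
        using bspec[OF bspec[OF \<psi>(3) ab(1)] that] bspec[OF bspec[OF \<psi>(3) ab(2)] that]
        by (simp_all add: \<psi>(1,2))
      have "X x (n, j) = X x (0, j) + a x" if "j \<le> n" for j
        unfolding X_def using shift(1)[OF vK[of 0 j]] w\<alpha> that by simp
      moreover have "X x (i, n) = X x (i, 0) + b x" if "i \<le> n" for i
        unfolding X_def using shift(2)[OF vK[of i 0]] w\<beta> that by simp
      ultimately show ?thesis unfolding quasiperiodic_def by blast
    qed
    have edges: "(norm (X x (i', j') - X x (i, j)))\<^sup>2 = L (i, j) (i', j')"
      if "i < n" "j < n" "(i', j') \<in> {(Suc i, j), (i, Suc j), (Suc i, Suc j)}" for x i j i' j'
    proof -
      have "w (i', j') = w (i, j) \<or> edge K (w (i', j')) (w (i, j))"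
        using w_edge that by blast
      then show ?thesis
        using s[of x] unfolding surface_def X_def L_def by auto
    qed
    have "\<exists>m (c :: nat \<Rightarrow> real poly). \<forall>x.
        p (r x) ^ m = (\<Sum>k<m. poly (c k) (r x $ 1 + r x $ 3) * p (r x) ^ k)"
      unfolding r
    proof (rule gram_integral_over_trace[where X = X and L = L])
      show "0 < n" "real_polynomial_function p" by (rule n, rule p)
      show "quasiperiodic n (X x) (a x) (b x)" for x by (rule X)
      show "(norm (X x (i', j') - X x (i, j)))\<^sup>2 = L (i, j) (i', j')"
        if "i < n" "j < n" "(i', j') \<in> {(Suc i, j), (i, Suc j), (Suc i, Suc j)}" for x i j i' j'
        by (rule edges[OF that])
    qed
    then obtain m and c :: "nat \<Rightarrow> real poly" where
      mc: "\<And>x. p (r x) ^ m = (\<Sum>k<m. poly (c k) (r x $ 1 + r x $ 3) * p (r x) ^ k)"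
      by blast
    have "p x ^ m = (\<Sum>k<m. poly (c k) (x $ 1 + x $ 3) * p x ^ k)" if "x \<in> S" for x
      using mc[of x] that by (simp add: r_def)
    then show ?thesis unfolding S_def by blast
  qed
qed

end
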